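(* Let $R=\bigoplus_{\alpha\in\Gamma}R_{\alpha}$ be a graded domain. Then $R$ is a graded-Prüfer domain if and only if the following three conditions hold: (1) $R$ is an integrally closed domain; (2) $R$ is a g-finite conductor domain; (3) $R$ is a graded going-down (gGD) domain.
   Context: All rings are commutative with identity. $\Gamma$ is a nonzero torsionless commutative cancellative monoid, written additively (torsionless is equivalent to the existence of a total order compatible with the monoid operation), with quotient group $\langle\Gamma\rangle$. A graded domain $R=\bigoplus_{\alpha\in\Gamma}R_\alpha$ is an integral domain graded by $\Gamma$; $H=\bigcup_{\alpha\in\Gamma}(R_\alpha\setminus\{0\})$ is its set of nonzero homogeneous elements. The homogeneous quotient field $R_H$ is graded by $\langle\Gamma\rangle$ via $\deg(a/b)=\deg(a)-\deg(b)$. A homogeneous overring of $R$ is a ring $T$ with $R\subseteq T\subseteq R_H$ and $T=\bigoplus_{\alpha\in\langle\Gamma\rangle}(T\cap(R_H)_\alpha)$; it is a $\langle\Gamma\rangle$-graded domain. An ideal is homogeneous if it is generated by homogeneous elements. For a homogeneous overring $T$ of $R$, the extension $R\subseteq T$ satisfies gGD (graded going-down) if, whenever $P_0\subseteq P$ are homogeneous prime ideals of $R$ and $Q$ is a homogeneous prime ideal of $T$ with $Q\cap R=P$, there is a homogeneous prime ideal $Q_0$ of $T$ with $Q_0\subseteq Q$ and $Q_0\cap R=P_0$. $R$ is a gGD domain if $R\subseteq T$ satisfies gGD for every homogeneous overring $T$ of $R$. $R$ is a graded-Prüfer domain if each nonzero finitely generated homogeneous ideal of $R$ is invertible. $R$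 is a g-finite conductor domain if for all $a,b\in H$ there exist finitely many $u_1,\dots,u_n\in H$ with $(a)\cap(b)=(u_1,\dots,u_n)$. Integrally closed means integrally closed in the quotient field. *)

theory Defs
  imports
    "HOL-Algebra.Subrings"
    "HOL-Algebra.Ideal_Product"
    "HOL-Algebra.Algebraic_Closure_Type"
    "HOL-Computational_Algebra.Polynomial"
begin

text \<open>
  Conventions. An integral domain is a subring \<open>R\<close> of an ambient field, the latter given by a
  type \<open>'k :: field\<close>; every domain arises in this way. The ambient field need not be the quotient
  field of \<open>R\<close>: the latter is \<open>quotient_field R\<close> below. Likewise, a commutative cancellative
  monoid \<open>\<Gamma>\<close> is a submonoid of an abelian group, given by a type \<open>'g :: ab_group_add\<close>, and its
  quotient group is the set of differences of its elements. Ideals, prime ideals, etc.\ of a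
  subring \<open>T\<close> are those of HOL-Algebra, for the ring structure \<open>ring_on T\<close> that \<open>T\<close> inherits.
\<close>

abbreviation ambient :: "'k::field ring" where
  "ambient \<equiv> ring_of_type_algebra"

abbreviation ring_on :: "'k::field set \<Rightarrow> 'k ring" where
  "ring_on T \<equiv> ambient\<lparr>carrier := T\<rparr>"

definition quotient_group :: "'g::ab_group_add set \<Rightarrow> 'g set" where
  "quotient_group \<Gamma> = {\<alpha> - \<beta> | \<alpha> \<beta>. \<alpha> \<in> \<Gamma> \<and> \<beta> \<in> \<Gamma>}"

definition quotient_field :: "'k::field set \<Rightarrow> 'k set" where
  "quotient_field R = {a / b | a b. a \<in> R \<and> b \<in> R - {0}}"

text \<open>\<open>(\<Sum>i<n. \<alpha>)\<close> is the \<open>n\<close>-fold multiple of \<open>\<alpha>\<close>.\<close>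

definition torsionless_monoid :: "'g::ab_group_add set \<Rightarrow> bool" where
  "torsionless_monoid \<Gamma> \<longleftrightarrow>
     0 \<in> \<Gamma> \<and> (\<forall>\<alpha>\<in>\<Gamma>. \<forall>\<beta>\<in>\<Gamma>. \<alpha> + \<beta> \<in> \<Gamma>) \<and>
     (\<forall>\<alpha>\<in>\<Gamma>. \<forall>\<beta>\<in>\<Gamma>. \<forall>n::nat. n \<ge> 1 \<longrightarrow> (\<Sum>i<n. \<alpha>) = (\<Sum>i<n. \<beta>) \<longrightarrow> \<alpha> = \<beta>)"

definition is_direct_sum :: "'g set \<Rightarrow> ('g \<Rightarrow> 'k::field set) \<Rightarrow> 'k set \<Rightarrow> bool" where
  "is_direct_sum G C S \<longleftrightarrow>
     (\<forall>\<alpha>\<in>G. additive_subgroup (C \<alpha>) ambient) \<and>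
     S = {\<Sum>\<alpha>\<in>F. f \<alpha> | F f. finite F \<and> F \<subseteq> G \<and> (\<forall>\<alpha>\<in>F. f \<alpha> \<in> C \<alpha>)} \<and>
     (\<forall>F f. finite F \<and> F \<subseteq> G \<and> (\<forall>\<alpha>\<in>F. f \<alpha> \<in> C \<alpha>) \<and> (\<Sum>\<alpha>\<in>F. f \<alpha>) = 0
        \<longrightarrow> (\<forall>\<alpha>\<in>F. f \<alpha> = 0))"

text \<open>\<open>A \<alpha>\<close> is the homogeneous component \<open>R\<^sub>\<alpha>\<close>; its values outside \<open>\<Gamma>\<close> are irrelevant.\<close>

locale graded_domain =
  fixes \<Gamma> :: "'g::ab_group_add set" and A :: "'g \<Rightarrow> 'k::field set" and R :: "'k set"
  assumes torsionless: "torsionless_monoid \<Gamma>"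
    and nonzero: "\<Gamma> \<noteq> {0}"
    and subring: "subring R ambient"
    and direct_sum: "is_direct_sum \<Gamma> A R"
    and component_mult:
      "\<lbrakk>\<alpha> \<in> \<Gamma>; \<beta> \<in> \<Gamma>; a \<in> A \<alpha>; b \<in> A \<beta>\<rbrakk> \<Longrightarrow> a * b \<in> A (\<alpha> + \<beta>)"

definition homogeneous_elements :: "'g set \<Rightarrow> ('g \<Rightarrow> 'k::field set) \<Rightarrow> 'k set" where
  "homogeneous_elements G C = (\<Union>\<alpha>\<in>G. C \<alpha> - {0})"

definition homogeneous_ideal :: "'g set \<Rightarrow> ('g \<Rightarrow> 'k::field set) \<Rightarrow> 'k set \<Rightarrow> 'k set \<Rightarrow> bool" where
  "homogeneous_ideal G C T I \<longleftrightarrow>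
     ideal I (ring_on T) \<and> (\<exists>S \<subseteq> homogeneous_elements G C. I = Idl\<^bsub>ring_on T\<^esub> S)"

definition homogeneous_prime :: "'g set \<Rightarrow> ('g \<Rightarrow> 'k::field set) \<Rightarrow> 'k set \<Rightarrow> 'k set \<Rightarrow> bool" where
  "homogeneous_prime G C T P \<longleftrightarrow> homogeneous_ideal G C T P \<and> primeideal P (ring_on T)"

definition homogeneous_quotient_field ::
  "'g set \<Rightarrow> ('g \<Rightarrow> 'k::field set) \<Rightarrow> 'k set \<Rightarrow> 'k set" where
  "homogeneous_quotient_field \<Gamma> A R = {a / b | a b. a \<in> R \<and> b \<in> homogeneous_elements \<Gamma> A}"

text \<open>
  The component of degree \<open>\<gamma>\<close> of the homogeneous quotient field. Zero is inserted explicitly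
  because there may be no nonzero denominator \<open>b\<close> of a suitable degree (some \<open>A \<beta>\<close> may vanish).
\<close>

definition quotient_component ::
  "'g::ab_group_add set \<Rightarrow> ('g \<Rightarrow> 'k::field set) \<Rightarrow> 'g \<Rightarrow> 'k set" where
  "quotient_component \<Gamma> A \<gamma> =
     insert 0 {a / b | a b \<alpha> \<beta>. \<alpha> \<in> \<Gamma> \<and> \<beta> \<in> \<Gamma> \<and> \<alpha> - \<beta> = \<gamma> \<and> a \<in> A \<alpha> \<and> b \<in> A \<beta> - {0}}"

definition overring_component ::
  "'g::ab_group_add set \<Rightarrow> ('g \<Rightarrow> 'k::field set) \<Rightarrow> 'k set \<Rightarrow> 'g \<Rightarrow> 'k set" where
  "overring_component \<Gamma> A T \<gamma> = T \<inter> quotient_component \<Gamma> A \<gamma>"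

definition homogeneous_overring ::
  "'g::ab_group_add set \<Rightarrow> ('g \<Rightarrow> 'k::field set) \<Rightarrow> 'k set \<Rightarrow> 'k set \<Rightarrow> bool" where
  "homogeneous_overring \<Gamma> A R T \<longleftrightarrow>
     subring T ambient \<and> R \<subseteq> T \<and> T \<subseteq> homogeneous_quotient_field \<Gamma> A R \<and>
     is_direct_sum (quotient_group \<Gamma>) (overring_component \<Gamma> A T) T"

definition gGD_extension ::
  "'g::ab_group_add set \<Rightarrow> ('g \<Rightarrow> 'k::field set) \<Rightarrow> 'k set \<Rightarrow> 'k set \<Rightarrow> bool" where
  "gGD_extension \<Gamma> A R T \<longleftrightarrow>
     (\<forall>P\<^sub>0 P Q.
        homogeneous_prime \<Gamma> A R P\<^sub>0 \<and> homogeneous_prime \<Gamma> A R P \<and> P\<^sub>0 \<subseteq> P \<and>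
        homogeneous_prime (quotient_group \<Gamma>) (overring_component \<Gamma> A T) T Q \<and> Q \<inter> R = P
        \<longrightarrow> (\<exists>Q\<^sub>0. homogeneous_prime (quotient_group \<Gamma>) (overring_component \<Gamma> A T) T Q\<^sub>0 \<and>
                  Q\<^sub>0 \<subseteq> Q \<and> Q\<^sub>0 \<inter> R = P\<^sub>0))"

definition gGD_domain ::
  "'g::ab_group_add set \<Rightarrow> ('g \<Rightarrow> 'k::field set) \<Rightarrow> 'k set \<Rightarrow> bool" where
  "gGD_domain \<Gamma> A R \<longleftrightarrow> (\<forall>T. homogeneous_overring \<Gamma> A R T \<longrightarrow> gGD_extension \<Gamma> A R T)"

definition finitely_generated_ideal :: "'k::field set \<Rightarrow> 'k set \<Rightarrow> bool" where
  "finitely_generated_ideal R I \<longleftrightarrow> (\<exists>S. finite S \<and> S \<subseteq> R \<and> I = Idl\<^bsub>ring_on R\<^esub> S)"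

definition inverse_ideal :: "'k::field set \<Rightarrow> 'k set \<Rightarrow> 'k set" where
  "inverse_ideal R I = {x \<in> quotient_field R. \<forall>a\<in>I. x * a \<in> R}"

text \<open>
  \<open>ideal_prod ambient I J\<close> consists of the finite sums of products \<open>i * j\<close>, formed in the ambient
  field; hence it is also the product of fractional ideals.
\<close>

definition invertible_ideal :: "'k::field set \<Rightarrow> 'k set \<Rightarrow> bool" where
  "invertible_ideal R I \<longleftrightarrow> ideal_prod ambient I (inverse_ideal R I) = R"

definition graded_Prufer_domain ::
  "'g set \<Rightarrow> ('g \<Rightarrow> 'k::field set) \<Rightarrow> 'k set \<Rightarrow> bool" where
  "graded_Prufer_domain \<Gamma> A R \<longleftrightarrow>
     (\<forall>I. homogeneous_ideal \<Gamma> A R I \<and> finitely_generated_ideal R I \<and> I \<noteq> {0}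
        \<longrightarrow> invertible_ideal R I)"

definition g_finite_conductor_domain ::
  "'g set \<Rightarrow> ('g \<Rightarrow> 'k::field set) \<Rightarrow> 'k set \<Rightarrow> bool" where
  "g_finite_conductor_domain \<Gamma> A R \<longleftrightarrow>
     (\<forall>a \<in> homogeneous_elements \<Gamma> A. \<forall>b \<in> homogeneous_elements \<Gamma> A.
        \<exists>U. finite U \<and> U \<subseteq> homogeneous_elements \<Gamma> A \<and>
            PIdl\<^bsub>ring_on R\<^esub> a \<inter> PIdl\<^bsub>ring_on R\<^esub> b = Idl\<^bsub>ring_on R\<^esub> U)"

definition integrally_closed_domain :: "'k::field set \<Rightarrow> bool" where
  "integrally_closed_domain R \<longleftrightarrow>
     (\<forall>x \<in> quotient_field R.
        (\<exists>p :: 'k poly. Polynomial.lead_coeff p = 1 \<and> (\<forall>i. Polynomial.coeff p i \<in> R) \<and> poly p x = 0)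
        \<longrightarrow> x \<in> R)"

end

theory Submission
  imports Defs "HOL-Library.Product_Plus" "HOL-Computational_Algebra.Normalized_Fraction"
    "Jordan_Normal_Form.Char_Poly"
begin

text \<open>
  Both sides are compared with a local condition, \<open>locally_comparable\<close>: for every homogeneous prime
  \<open>M\<close> and nonzero homogeneous \<open>a\<close>, \<open>b\<close>, a homogeneous multiplier outside \<open>M\<close> turns one of \<open>a\<close>, \<open>b\<close>
  into a multiple of the other. In other words, the homogeneous localizations of \<open>R\<close> at its
  homogeneous primes are graded valuation domains. Just as for ordinary Pruefer domains, this is
  equivalent to being graded-Pruefer: if \<open>(a, b)\<close> is invertible, then \<open>1 = a x + b y\<close> with \<open>x\<close>, \<open>y\<close> in
  the inverse ideal, and one of the summands is a multiplier outside \<open>M\<close>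
  (\<open>Prufer_locally_comparable\<close>); conversely, a finitely generated homogeneous ideal is locally generated
  by one of its generators, so that its product with its inverse lies in no homogeneous prime
  (\<open>Prufer_if_locally_comparable\<close>).

  The equation \<open>1 = a x + b y\<close> also exhibits generators \<open>a b x\<close>, \<open>a b y\<close> of \<open>(a) \<inter> (b)\<close>. Local
  comparability gives going down, because a homogeneous overring \<open>T\<close> has the same homogeneous
  localization at \<open>Q\<close> as \<open>R\<close> at \<open>Q \<inter> R\<close> (\<open>gGD_extension_if_locally_comparable\<close>). It gives integral
  closedness in two steps. An element \<open>f / g\<close> of the quotient field that is integral over \<open>R\<close> has
  a homogeneous denominator (\<open>integral_has_homogeneous_denominator\<close>): an integer-valued degree that separates
  the finitely many degrees involved embeds the situation into Laurent polynomials in one variable over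
  a field, which are integrally closed, and long division by \<open>g\<close> creates only powers of the leading
  coefficient of \<open>g\<close> as denominators. Then local comparability removes the homogeneous denominator, by
  the argument for valuation rings (\<open>integral_homogeneous_denominator\<close>).

  For the converse, let \<open>R\<close> satisfy the three conditions and suppose that \<open>a\<close>, \<open>b\<close> are not comparable at
  \<open>M\<close>. With \<open>u = a / b\<close>, the conductors \<open>I = (R : u)\<close> and \<open>J = u I = (R : u\<^bsup>-1\<^esup>)\<close> are contained
  in \<open>M\<close>. If \<open>z J \<subseteq> I\<close>, then \<open>z u J \<subseteq> J\<close>; as \<open>J\<close> is finitely generated, \<open>z u\<close> is integral over \<open>R\<close>,
  so it is in \<open>R\<close> and \<open>z \<in> I\<close>. This saturation property makes it impossible that \<open>J\<close> lies in
  the radical of \<open>I\<close> locally at \<open>M\<close>, so there are a homogeneous prime \<open>P\<close> with \<open>I \<subseteq> P \<subseteq> M\<close> and an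
  element \<open>y\<close> of \<open>J\<close> outside \<open>P\<close>. On the other hand, a homogeneous prime of \<open>R[u]\<close> lies over \<open>M\<close>, and
  going down produces one over \<open>P\<close>. It contains \<open>y / u \<in> I\<close>, hence also \<open>y\<close>, a contradiction
  (\<open>locally_comparable_if_going_down\<close>).
\<close>

section \<open>Ideals of subrings of a field\<close>

lemma ambient_simps [simp]:
  "carrier (ambient :: 'k::field ring) = UNIV"
  "monoid.mult (ambient :: 'k::field ring) = (*)"
  "one (ambient :: 'k::field ring) = 1"
  "zero (ambient :: 'k::field ring) = 0"
  "add (ambient :: 'k::field ring) = (+)"
  by (simp_all add: ring_of_type_algebra_def)

lemma cring_ambient: "cring (ambient :: 'k::field ring)"
  by (rule cring_from_type_algebra)

lemma ambient_uminus [simp]: "\<ominus>\<^bsub>(ambient :: 'k::field ring)\<^esub> x = - x"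
proof -
  interpret cring "ambient :: 'k ring" by (rule cring_ambient)
  show ?thesis by (rule minus_equality) auto
qed

lemma subringD:
  assumes "subring R (ambient :: 'k::field ring)"
  shows "0 \<in> R" "1 \<in> R" "\<And>x y. x \<in> R \<Longrightarrow> y \<in> R \<Longrightarrow> x + y \<in> R"
    "\<And>x y. x \<in> R \<Longrightarrow> y \<in> R \<Longrightarrow> x * y \<in> R" "\<And>x. x \<in> R \<Longrightarrow> - x \<in> R"
    "\<And>x y. x \<in> R \<Longrightarrow> y \<in> R \<Longrightarrow> x - y \<in> R"
proof -
  interpret cring "ambient :: 'k ring" by (rule cring_ambient)
  show "0 \<in> R" "1 \<in> R" and pl: "\<And>x y. x \<in> R \<Longrightarrow> y \<in> R \<Longrightarrow> x + y \<in> R"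
    and "\<And>x y. x \<in> R \<Longrightarrow> y \<in> R \<Longrightarrow> x * y \<in> R" and um: "\<And>x. x \<in> R \<Longrightarrow> - x \<in> R"
    using subringE[OF assms] by auto
  show "\<And>x y. x \<in> R \<Longrightarrow> y \<in> R \<Longrightarrow> x - y \<in> R"
    using pl um by (metis add_uminus_conv_diff)
qed

lemma subring_ambientI:
  assumes "1 \<in> R" "\<And>x y. x \<in> R \<Longrightarrow> y \<in> R \<Longrightarrow> x + y \<in> R"
    "\<And>x y. x \<in> R \<Longrightarrow> y \<in> R \<Longrightarrow> x * y \<in> R" "\<And>x. x \<in> R \<Longrightarrow> - x \<in> R"
  shows "subring R (ambient :: 'k::field ring)"
proof -
  interpret cring "ambient :: 'k ring" by (rule cring_ambient)
  show ?thesis using assms by (intro subringI) auto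
qed

lemma ideal_ring_on_iff:
  assumes R: "subring R (ambient :: 'k::field ring)"
  shows "ideal I (ring_on R) \<longleftrightarrow>
    I \<subseteq> R \<and> 0 \<in> I \<and> (\<forall>x\<in>I. \<forall>y\<in>I. x + y \<in> I) \<and> (\<forall>r\<in>R. \<forall>x\<in>I. r * x \<in> I)"
    (is "?L \<longleftrightarrow> ?R")
proof
  assume ?L
  then interpret ideal I "ring_on R" .
  show ?R using a_subset additive_subgroup.zero_closed[OF is_additive_subgroup]
      additive_subgroup.a_closed[OF is_additive_subgroup] I_l_closed by auto
next
  assume r: ?R
  interpret A: cring "ambient :: 'k ring" by (rule cring_ambient)
  have ring: "ring (ring_on R)" by (rule A.subring_is_ring[OF R])
  interpret S: ring "ring_on R" by (rule ring)
  have um: "- x \<in> I" if "x \<in> I" for x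
  proof -
    have "- 1 \<in> R" using subringD[OF R] by blast
    then have "(- 1) * x \<in> I" using r that by blast
    then show ?thesis by simp
  qed
  have inv: "inv\<^bsub>add_monoid (ring_on R)\<^esub> x = - x" if "x \<in> I" for x
  proof -
    have "x \<in> R" "- x \<in> R" using that r um by auto
    then have "\<ominus>\<^bsub>ring_on R\<^esub> x = - x" by (intro S.minus_equality) auto
    then show ?thesis by (simp add: a_inv_def)
  qed
  show ?L
  proof (rule idealI[OF ring])
    show "subgroup I (add_monoid (ring_on R))"
      by (rule subgroup.intro) (use r um inv in auto)
    fix a x assume "a \<in> I" "x \<in> carrier (ring_on R)"
    then have "x * a \<in> I" using r by simp
    then show "x \<otimes>\<^bsub>ring_on R\<^esub> a \<in> I" "a \<otimes>\<^bsub>ring_on R\<^esub> x \<in> I" by (simp_all add: mult.commute)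
  qed
qed

lemma primeideal_ring_on_iff:
  assumes R: "subring R (ambient :: 'k::field ring)"
  shows "primeideal P (ring_on R) \<longleftrightarrow>
    ideal P (ring_on R) \<and> 1 \<notin> P \<and> (\<forall>x\<in>R. \<forall>y\<in>R. x * y \<in> P \<longrightarrow> x \<in> P \<or> y \<in> P)"
    (is "?L \<longleftrightarrow> ?R")
proof
  assume L: ?L
  then interpret primeideal P "ring_on R" .
  show ?R using I_prime I_notcarr one_imp_carrier ideal_axioms by auto
next
  assume r: ?R
  interpret A: cring "ambient :: 'k ring" by (rule cring_ambient)
  interpret I: ideal P "ring_on R" using r by blast
  have c: "cring (ring_on R)"
    by (intro cring.intro I.ring_axioms comm_monoid.intro comm_monoid_axioms.intro I.is_monoid)
       (auto simp: mult.commute)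
  show ?L
    by (intro primeideal.intro primeideal_axioms.intro I.ideal_axioms c)
       (use r subringD[OF R] in auto)
qed

lemma PIdl_ring_on: "PIdl\<^bsub>ring_on R\<^esub> a = {r * a | r. r \<in> (R :: 'k::field set)}"
  by (simp add: cgenideal_def)

lemma Idl_subset:
  assumes "ideal I (ring_on R)" "S \<subseteq> I"
  shows "Idl\<^bsub>ring_on R\<^esub> S \<subseteq> I"
  using assms by (auto simp: genideal_def)

lemma subset_Idl: "S \<subseteq> Idl\<^bsub>ring_on R\<^esub> S"
  by (auto simp: genideal_def)

lemma ideal_Idl:
  assumes "subring R (ambient :: 'k::field ring)" "S \<subseteq> R"
  shows "ideal (Idl\<^bsub>ring_on R\<^esub> S) (ring_on R)"
proof -
  interpret A: cring "ambient :: 'k ring" by (rule cring_ambient)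
  interpret S: ring "ring_on R" by (rule A.subring_is_ring[OF assms(1)])
  show ?thesis using assms by (intro S.genideal_ideal) auto
qed

lemma Idl_finite:
  assumes R: "subring R (ambient :: 'k::field ring)" and S: "S \<subseteq> R" "finite S"
  shows "Idl\<^bsub>ring_on R\<^esub> S = {\<Sum>s\<in>S. c s * s | c. \<forall>s\<in>S. c s \<in> R}" (is "_ = ?C")
proof
  have "ideal ?C (ring_on R)"
    unfolding ideal_ring_on_iff[OF R]
  proof (intro conjI ballI)
    have "(\<Sum>s\<in>F. c s * s) \<in> R" if "F \<subseteq> S" "\<forall>s\<in>S. c s \<in> R" for F c
      using finite_subset[OF that(1) S(2)] that S(1)
      by induction (auto intro!: subringD[OF R])
    then show "?C \<subseteq> R" by blast
    show "0 \<in> ?C" by (rule CollectI, rule exI[of _ "\<lambda>_. 0"]) (auto intro!: subringD[OF R])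
    fix x y assume "x \<in> ?C" "y \<in> ?C"
    then obtain c d where F: "\<forall>s\<in>S. c s \<in> R" "x = (\<Sum>s\<in>S. c s * s)"
      and G: "\<forall>s\<in>S. d s \<in> R" "y = (\<Sum>s\<in>S. d s * s)" by blast
    then have "x + y = (\<Sum>s\<in>S. (c s + d s) * s)" by (simp add: distrib_right sum.distrib)
    then show "x + y \<in> ?C" using F G
      by (intro CollectI exI[of _ "\<lambda>s. c s + d s"]) (auto intro!: subringD[OF R])
  next
    fix r x assume r: "r \<in> R" and "x \<in> ?C"
    then obtain c where F: "\<forall>s\<in>S. c s \<in> R" "x = (\<Sum>s\<in>S. c s * s)" by blast
    then show "r * x \<in> ?C" using r
      by (intro CollectI exI[of _ "\<lambda>s. r * c s"])
        (auto simp: sum_distrib_left mult.assoc intro!: subringD[OF R])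
  qed
  moreover have "S \<subseteq> ?C"
  proof
    fix s assume s: "s \<in> S"
    have "s = (\<Sum>t\<in>S. (if t = s then 1 else 0) * t)"
      using s S(2) by (simp add: if_distrib[of "\<lambda>z. z * _"] cong: if_cong)
    then show "s \<in> ?C"
      by (intro CollectI exI[of _ "\<lambda>t. if t = s then 1 else 0"]) (auto intro!: subringD[OF R])
  qed
  ultimately show "Idl\<^bsub>ring_on R\<^esub> S \<subseteq> ?C" by (rule Idl_subset)
next
  have id: "ideal (Idl\<^bsub>ring_on R\<^esub> S) (ring_on R)" by (rule ideal_Idl[OF R S(1)])
  have "(\<Sum>s\<in>F. c s * s) \<in> Idl\<^bsub>ring_on R\<^esub> S" if "F \<subseteq> S" "\<forall>s\<in>S. c s \<in> R" for F c
    using finite_subset[OF that(1) S(2)] that id subset_Idl[of S R] unfolding ideal_ring_on_iff[OF R]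
    by induction auto
  then show "?C \<subseteq> Idl\<^bsub>ring_on R\<^esub> S" by blast
qed

lemma Idl_pair:
  assumes R: "subring R (ambient :: 'k::field ring)" and S: "a \<in> R" "b \<in> R"
  shows "Idl\<^bsub>ring_on R\<^esub> {a, b} = {r * a + t * b | r t. r \<in> R \<and> t \<in> R}" (is "?L = ?P")
proof
  have "ideal ?P (ring_on R)"
    unfolding ideal_ring_on_iff[OF R]
  proof (intro conjI ballI)
    show "?P \<subseteq> R" using S by (auto intro!: subringD[OF R])
    show "0 \<in> ?P" by (rule CollectI, rule exI[of _ 0], rule exI[of _ 0]) (auto intro!: subringD[OF R])
    fix x y assume "x \<in> ?P" "y \<in> ?P"
    then obtain r t r' t' where *: "x = r * a + t * b" "y = r' * a + t' * b"
      "r \<in> R" "t \<in> R" "r' \<in> R" "t' \<in> R" by blast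
    then have "x + y = (r + r') * a + (t + t') * b" by (simp add: algebra_simps)
    then show "x + y \<in> ?P" using * subringD(3)[OF R] by blast
  next
    fix q x assume "q \<in> R" "x \<in> ?P"
    moreover from this obtain r t where "x = r * a + t * b" "r \<in> R" "t \<in> R" by blast
    moreover have "q * (r * a + t * b) = (q * r) * a + (q * t) * b" for r t
      by (simp add: algebra_simps)
    ultimately show "q * x \<in> ?P" using subringD(4)[OF R] by blast
  qed
  moreover have "a \<in> ?P" by (rule CollectI, rule exI[of _ 1], rule exI[of _ 0]) (auto intro!: subringD[OF R])
  moreover have "b \<in> ?P" by (rule CollectI, rule exI[of _ 0], rule exI[of _ 1]) (auto intro!: subringD[OF R])
  ultimately show "?L \<subseteq> ?P" by (intro Idl_subset) auto
  have "ideal ?L (ring_on R)" "a \<in> ?L" "b \<in> ?L"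
    using ideal_Idl[OF R, of "{a, b}"] subset_Idl[of "{a,b}" R] S by auto
  then show "?P \<subseteq> ?L" unfolding ideal_ring_on_iff[OF R] by blast
qed

section \<open>Integral elements\<close>

definition integral_over :: "'k::field set \<Rightarrow> 'k \<Rightarrow> bool" where
  "integral_over R x \<longleftrightarrow>
     (\<exists>p. Polynomial.lead_coeff p = 1 \<and> (\<forall>i. Polynomial.coeff p i \<in> R) \<and> poly p x = 0)"

lemma coeffs_in_mult:
  assumes R: "subring R (ambient :: 'k::field ring)"
    and "\<forall>i. Polynomial.coeff p i \<in> R" "\<forall>i. Polynomial.coeff q i \<in> R"
  shows "Polynomial.coeff (p * q) i \<in> R"
proof -
  have "(\<Sum>j\<in>F. Polynomial.coeff p j * Polynomial.coeff q (i - j)) \<in> R" if "finite F" for F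
    using that assms(2,3) by induction (auto intro!: subringD[OF R])
  then show ?thesis by (simp add: coeff_mult)
qed

lemma coeffs_in_sum:
  assumes R: "subring R (ambient :: 'k::field ring)"
    and "finite F" "\<And>x. x \<in> F \<Longrightarrow> \<forall>i. Polynomial.coeff (f x) i \<in> R"
  shows "\<forall>i. Polynomial.coeff (sum f F) i \<in> R"
  using assms(2,3) by induction (auto intro!: subringD[OF R])

lemma coeffs_in_prod:
  assumes R: "subring R (ambient :: 'k::field ring)"
    and "finite F" "\<And>x. x \<in> F \<Longrightarrow> \<forall>i. Polynomial.coeff (f x) i \<in> R"
  shows "\<forall>i. Polynomial.coeff (prod f F) i \<in> R"
  using assms(2,3)
proof (induction)
  case empty
  then show ?case using subringD(1,2)[OF R] by (auto simp: coeff_1)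
next
  case (insert x F)
  then show ?case using coeffs_in_mult[OF R, of "f x" "prod f F"] by auto
qed

text \<open>
  The determinant trick: \<open>v\<close> is an eigenvalue of the matrix that describes multiplication by \<open>v\<close>
  on the generators \<open>Y\<close>, and the characteristic polynomial of a matrix over \<open>R\<close> is monic with
  coefficients in \<open>R\<close>.
\<close>

lemma integral_over_if_stabilizes:
  fixes v :: "'k::field"
  assumes R: "subring R (ambient :: 'k ring)" and Y: "finite Y" "\<exists>y\<in>Y. y \<noteq> 0"
    and stab: "\<And>y. y \<in> Y \<Longrightarrow> \<exists>c. (\<forall>z\<in>Y. c z \<in> R) \<and> v * y = (\<Sum>z\<in>Y. c z * z)"
  shows "integral_over R v"
proof -
  define n where "n = card Y"
  obtain h where h: "bij_betw h {0..<n} Y"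
    using ex_bij_betw_nat_finite[OF Y(1)] by (auto simp: n_def)
  have hY: "h i \<in> Y" if "i < n" for i using h that by (auto simp: bij_betw_def)
  obtain c where c: "\<And>y z. y \<in> Y \<Longrightarrow> z \<in> Y \<Longrightarrow> c y z \<in> R"
    "\<And>y. y \<in> Y \<Longrightarrow> v * y = (\<Sum>z\<in>Y. c y z * z)"
    using stab by metis
  define M where "M = mat n n (\<lambda>(i, j). c (h i) (h j))"
  define w where "w = vec n h"
  have M: "M \<in> carrier_mat n n" by (simp add: M_def)
  have "M *\<^sub>v w = v \<cdot>\<^sub>v w"
  proof (rule eq_vecI)
    fix i assume "i < dim_vec (v \<cdot>\<^sub>v w)"
    then have i: "i < n" by (simp add: w_def)
    have "(M *\<^sub>v w) $ i = (\<Sum>j\<in>{0..<n}. c (h i) (h j) * h j)"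
      using i by (simp add: M_def w_def scalar_prod_def)
    also have "\<dots> = (\<Sum>z\<in>Y. c (h i) z * z)" by (rule sum.reindex_bij_betw[OF h])
    finally show "(M *\<^sub>v w) $ i = (v \<cdot>\<^sub>v w) $ i" using i c(2)[OF hY[OF i]] by (simp add: w_def)
  qed (simp add: M_def w_def)
  moreover have "w \<noteq> 0\<^sub>v n"
  proof
    assume "w = 0\<^sub>v n"
    then have "h i = 0" if "i < n" for i using that by (metis index_vec index_zero_vec(1) w_def)
    then show False using Y(2) h by (metis atLeastLessThan_iff bij_betw_iff_bijections)
  qed
  ultimately have "eigenvalue M v"
    unfolding eigenvalue_def eigenvector_def using M by (intro exI[of _ w]) (auto simp: w_def)
  then have root: "poly (char_poly M) v = 0" using eigenvalue_root_char_poly[OF M] by simp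
  have monic: "lead_coeff (char_poly M) = 1" using degree_monic_char_poly[OF M] by simp
  have entry: "\<forall>k. Polynomial.coeff (char_poly_matrix M $$ (i, j)) k \<in> R" if "i < n" "j < n" for i j
    using that c(1)[OF hY hY, of i j]
    by (auto simp: char_poly_matrix_def M_def coeff_pCons coeff_monom split: nat.split
        intro!: subringD[OF R])
  have "\<forall>k. Polynomial.coeff (char_poly M) k \<in> R"
    unfolding char_poly_def det_def'[OF char_poly_matrix_closed[OF M]]
  proof (rule coeffs_in_sum[OF R])
    fix p assume "p \<in> {p. p permutes {0..<n}}"
    then have p: "p permutes {0..<n}" by simp
    have "\<forall>k. Polynomial.coeff (\<Prod>i = 0..<n. char_poly_matrix M $$ (i, p i)) k \<in> R"
      using permutes_in_image[OF p] by (intro coeffs_in_prod[OF R] entry) auto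
    then show "\<forall>k. Polynomial.coeff (signof p * (\<Prod>i = 0..<n. char_poly_matrix M $$ (i, p i))) k \<in> R"
      by (auto simp: sign_def intro!: subringD[OF R])
  qed (simp add: finite_permutations)
  then show ?thesis unfolding integral_over_def using monic root by blast
qed

section \<open>Additive functions on an abelian group\<close>

abbreviation nmult :: "nat \<Rightarrow> 'g::ab_group_add \<Rightarrow> 'g" where
  "nmult n x \<equiv> (\<Sum>i<n. x)"

lemma nmult_add: "nmult (a + b) x = nmult a x + nmult b x"
  by (induction b) (auto simp: algebra_simps)

lemma nmult_nmult: "nmult (a * b) x = nmult a (nmult b x)"
  by (induction a) (auto simp: nmult_add algebra_simps)

lemma nmult_Pair: "nmult n (x, q :: rat) = (nmult n x, of_nat n * q)"
  by (induction n) (auto simp: algebra_simps zero_prod_def)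

text \<open>
  Graphs of additive functions from a subgroup to the rational numbers. Working with graphs makes
  the extension argument below an application of Zorn's lemma to a family of sets.
\<close>

definition partial_additive :: "('g::ab_group_add \<times> rat) set \<Rightarrow> bool" where
  "partial_additive F \<longleftrightarrow> F \<noteq> {} \<and> (\<forall>x\<in>F. \<forall>y\<in>F. x - y \<in> F) \<and> (\<forall>q. (0, q) \<in> F \<longrightarrow> q = 0)"

lemma partial_additiveD:
  assumes "partial_additive F"
  shows "0 \<in> F" "\<And>x. x \<in> F \<Longrightarrow> - x \<in> F" "\<And>x y. x \<in> F \<Longrightarrow> y \<in> F \<Longrightarrow> x + y \<in> F"
    "\<And>x. x \<in> F \<Longrightarrow> nmult n x \<in> F"
proof -
  show z: "0 \<in> F" using assms unfolding partial_additive_def by (metis all_not_in_conv diff_self)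
  show m: "- x \<in> F" if "x \<in> F" for x
    using assms z that unfolding partial_additive_def by (metis diff_0)
  show p: "x + y \<in> F" if "x \<in> F" "y \<in> F" for x y
    using assms m that unfolding partial_additive_def by (metis diff_minus_eq_add)
  show "nmult n x \<in> F" if "x \<in> F" for x
    using that by (induction n) (auto intro: z p)
qed

text \<open>
  The rational numbers are divisible, so the domain can be enlarged by any element \<open>e\<close>: if a positive
  multiple of \<open>e\<close> already has a value, that value divided by the multiplicity is the only choice for
  \<open>e\<close>, and otherwise every value is consistent.
\<close>

lemma partial_additive_extend:
  assumes F: "partial_additive F"
  shows "\<exists>F' q. partial_additive F' \<and> F \<subseteq> F' \<and> (e, q) \<in> F'"
proof -
  obtain q where q: "\<And>n r. n \<ge> 1 \<Longrightarrow> (nmult n e, r) \<in> F \<Longrightarrow> r = of_nat n * q"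
  proof (cases "\<exists>m\<ge>1. \<exists>r. (nmult m e, r) \<in> F")
    case True
    then obtain m r where m: "m \<ge> 1" "(nmult m e, r) \<in> F" by blast
    show ?thesis
    proof (rule that[of "r / of_nat m"])
      fix n r' assume n: "n \<ge> 1" "(nmult n e, r') \<in> F"
      have "nmult n (nmult m e, r) - nmult m (nmult n e, r') \<in> F"
        using F partial_additiveD(4)[OF F] m n unfolding partial_additive_def by blast
      also have "nmult n (nmult m e, r) - nmult m (nmult n e, r') =
          (0, of_nat n * r - of_nat m * r')"
        by (simp add: nmult_Pair nmult_nmult[symmetric] mult.commute)
      finally have "of_nat n * r = of_nat m * r'" using F unfolding partial_additive_def by auto
      then show "r' = of_nat n * (r / of_nat m)" using m by (simp add: field_simps)
    qed
  qed (use that in blast)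
  define v where "v = (e, q)"
  define F' where "F' = {x + nmult a v - nmult b v | x a b. x \<in> F}"
  have "partial_additive F'"
    unfolding partial_additive_def
  proof (intro conjI ballI allI impI)
    show "F' \<noteq> {}" unfolding F'_def using partial_additiveD(1)[OF F] by blast
    fix y z assume "y \<in> F'" "z \<in> F'"
    then obtain x a b x' a' b' where *: "x \<in> F" "x' \<in> F"
      "y = x + nmult a v - nmult b v" "z = x' + nmult a' v - nmult b' v"
      unfolding F'_def by blast
    have "y - z = (x - x') + nmult (a + b') v - nmult (b + a') v"
      unfolding * nmult_add by (simp add: algebra_simps)
    moreover have "x - x' \<in> F" using * F unfolding partial_additive_def by blast
    ultimately show "y - z \<in> F'" unfolding F'_def by blast
  next
    fix r assume "(0, r) \<in> F'"
    then obtain x a b where x: "x \<in> F" "(0, r) = x + nmult a v - nmult b v"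
      unfolding F'_def by blast
    have F0: "\<And>r. (0, r) \<in> F \<Longrightarrow> r = 0" using F unfolding partial_additive_def by blast
    consider "a = b" | n where "n \<ge> 1" "b = a + n" | n where "n \<ge> 1" "a = b + n"
      by (metis Suc_leI add.commute le_add_diff_inverse2 linorder_neqE_nat nat_le_linear zero_less_diff One_nat_def less_imp_le)
    then show "r = 0"
    proof cases
      case 1
      then show ?thesis using x F0 by simp
    next
      case 2
      then have "x = nmult n v + (0, r)" using x(2) by (simp add: nmult_add algebra_simps)
      then have "(nmult n e, of_nat n * q + r) \<in> F" using x(1) by (simp add: v_def nmult_Pair)
      then show ?thesis using q[OF 2(1)] by fastforce
    next
      case 3
      then have "- x = nmult n v - (0, r)" using x(2) by (simp add: nmult_add algebra_simps)
      then have "(nmult n e, of_nat n * q - r) \<in> F"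
        using partial_additiveD(2)[OF F x(1)] by (simp add: v_def nmult_Pair)
      then show ?thesis using q[OF 3(1)] by fastforce
    qed
  qed
  moreover have "F \<subseteq> F'"
  proof
    fix x assume "x \<in> F"
    moreover have "x = x + nmult 0 v - nmult 0 v" by simp
    ultimately show "x \<in> F'" unfolding F'_def by blast
  qed
  moreover have "(e, q) = 0 + nmult 1 v - nmult 0 v" by (simp add: v_def)
  then have "(e, q) \<in> F'" unfolding F'_def using partial_additiveD(1)[OF F] by blast
  ultimately show ?thesis by blast
qed

text \<open>
  Start from \<open>d \<mapsto> 1\<close> on the cyclic group generated by \<open>d\<close>, which is well defined because \<open>d\<close> has
  infinite order, and extend to the whole group by Zorn's lemma.
\<close>

lemma ex_additive_nonzero:
  fixes d :: "'g::ab_group_add"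
  assumes tf: "\<And>n. n \<ge> 1 \<Longrightarrow> nmult n d \<noteq> 0"
  shows "\<exists>\<phi>::'g \<Rightarrow> rat. additive \<phi> \<and> \<phi> d \<noteq> 0"
proof -
  define Z where "Z = {F. partial_additive F \<and> (d, 1) \<in> F}"
  have "\<exists>F\<in>Z. \<forall>U\<in>Z. F \<subseteq> U \<longrightarrow> U = F"
  proof (rule subset_Zorn_nonempty)
    define F0 where "F0 = {nmult a (d, 1 :: rat) - nmult b (d, 1) | a b. True}"
    have "partial_additive F0"
      unfolding partial_additive_def
    proof (intro conjI ballI allI impI)
      fix y z assume "y \<in> F0" "z \<in> F0"
      then obtain a b a' b' where *: "y = nmult a (d, 1 :: rat) - nmult b (d, 1)"
        "z = nmult a' (d, 1 :: rat) - nmult b' (d, 1)" unfolding F0_def by blast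
      have "y - z = nmult (a + b') (d, 1) - nmult (b + a') (d, 1)"
        unfolding * nmult_add by (simp add: algebra_simps)
      then show "y - z \<in> F0" unfolding F0_def by blast
    next
      fix q :: rat assume "(0, q) \<in> F0"
      then obtain a b where "(0, q) = nmult a (d, 1 :: rat) - nmult b (d, 1)"
        unfolding F0_def by blast
      then have ab: "nmult a d = nmult b d" "q = of_nat a - of_nat b" by (simp_all add: nmult_Pair)
      have *: "a = b" if "nmult a d = nmult b d" "a \<le> b" for a b
      proof (rule ccontr)
        assume "a \<noteq> b"
        then have "b - a \<ge> 1" "b = a + (b - a)" using that by auto
        then have "nmult b d = nmult a d + nmult (b - a) d" by (metis nmult_add)
        then show False using tf[OF \<open>b - a \<ge> 1\<close>] that by simp
      qed
      have "a = b" using *[of a b] *[of b a] ab(1) by (metis nat_le_linear)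
      then show "q = 0" using ab by simp
    qed (unfold F0_def, blast)
    moreover have "(d, 1) = nmult 1 (d, 1 :: rat) - nmult 0 (d, 1)" by simp
    then have "(d, 1) \<in> F0" unfolding F0_def by blast
    ultimately show "Z \<noteq> {}" unfolding Z_def by blast
  next
    fix C assume C: "C \<noteq> {}" "subset.chain Z C"
    then have CZ: "\<And>F. F \<in> C \<Longrightarrow> F \<in> Z" by (auto simp: subset.chain_def)
    have "x - y \<in> \<Union>C" if xy: "x \<in> \<Union>C" "y \<in> \<Union>C" for x y
    proof -
      obtain U Y where XY: "U \<in> C" "Y \<in> C" "x \<in> U" "y \<in> Y" using xy by blast
      then have "U \<subseteq> Y \<or> Y \<subseteq> U" using C(2) by (auto simp: subset.chain_def)
      then show ?thesis using XY CZ[of U] CZ[of Y] unfolding Z_def partial_additive_def by blast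
    qed
    then show "\<Union>C \<in> Z"
      using C(1) CZ unfolding Z_def partial_additive_def by auto
  qed
  then obtain F where F: "partial_additive F" "(d, 1) \<in> F"
    and max: "\<And>U. partial_additive U \<Longrightarrow> F \<subseteq> U \<Longrightarrow> U = F"
    unfolding Z_def by blast
  have total: "\<exists>q. (x, q) \<in> F" for x
    using partial_additive_extend[OF F(1), of x] max by blast
  have uniq: "q = r" if "(x, q) \<in> F" "(x, r) \<in> F" for x q r
  proof -
    have "(x, q) - (x, r) \<in> F" using that F(1) unfolding partial_additive_def by blast
    then show ?thesis using F(1) unfolding partial_additive_def by auto
  qed
  define \<phi> where "\<phi> x = (THE q. (x, q) \<in> F)" for x
  have \<phi>: "(x, \<phi> x) \<in> F" for x
    unfolding \<phi>_def using total uniq by (rule_tac theI') blast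
  have "additive \<phi>"
  proof
    fix x y
    have "(x, \<phi> x) + (y, \<phi> y) \<in> F" using partial_additiveD(3)[OF F(1)] \<phi> by blast
    then have "(x + y, \<phi> x + \<phi> y) \<in> F" by simp
    then show "\<phi> (x + y) = \<phi> x + \<phi> y" using uniq \<phi> by blast
  qed
  moreover have "\<phi> d = 1" using uniq \<phi> F(2) by blast
  ultimately show ?thesis by (metis zero_neq_one)
qed

lemma ex_additive_nonvanishing:
  fixes D :: "'g::ab_group_add set"
  assumes "finite D" and "\<And>d n. d \<in> D \<Longrightarrow> n \<ge> 1 \<Longrightarrow> nmult n d \<noteq> 0"
  shows "\<exists>\<phi>::'g \<Rightarrow> rat. additive \<phi> \<and> (\<forall>d\<in>D. \<phi> d \<noteq> 0)"
  using assms
proof (induction D rule: finite_induct)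
  case empty
  have "additive (\<lambda>_::'g. 0::rat)" by standard simp
  then show ?case by blast
next
  case (insert e D)
  obtain \<phi> where \<phi>: "additive \<phi>" "\<And>d. d \<in> D \<Longrightarrow> \<phi> d \<noteq> (0::rat)" using insert by blast
  obtain \<psi> where \<psi>: "additive \<psi>" "\<psi> e \<noteq> (0::rat)"
    using ex_additive_nonzero[of e] insert.prems by blast
  (* All but finitely many combinations of the two functions vanish nowhere on the larger set. *)
  have "finite ((\<lambda>d. - \<phi> d / \<psi> d) ` insert e D)" using insert.hyps by blast
  then obtain m :: rat where m: "m \<notin> (\<lambda>d. - \<phi> d / \<psi> d) ` insert e D" 
    using ex_new_if_finite[OF infinite_UNIV_char_0] by blast
  have "additive (\<lambda>x. \<phi> x + m * \<psi> x)"
    by standard (simp add: additive.add[OF \<phi>(1)] additive.add[OF \<psi>(1)] algebra_simps)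
  moreover have "\<phi> d + m * \<psi> d \<noteq> 0" if d: "d \<in> insert e D" for d
  proof
    assume *: "\<phi> d + m * \<psi> d = 0"
    show False
    proof (cases "\<psi> d = 0")
      case True
      then show False using * d \<phi>(2) \<psi>(2) by auto
    next
      case False
      then have "m = - \<phi> d / \<psi> d" using * by (simp add: field_simps add_eq_0_iff)
      then show False using m d by blast
    qed
  qed
  ultimately show ?case by blast
qed

lemma ex_common_denominator:
  fixes E :: "rat set"
  assumes "finite E"
  shows "\<exists>N::rat. N > 0 \<and> N \<in> \<int> \<and> (\<forall>e\<in>E. N * e \<in> \<int>)"
  using assms
proof (induction E rule: finite_induct)
  case empty
  show ?case by (rule exI[of _ 1]) auto
next
  case (insert e E)
  obtain N :: rat where N: "N > 0" "N \<in> \<int>" "\<forall>e\<in>E. N * e \<in> \<int>" using insert by blast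
  obtain a b where ab: "e = Rat.Fract a b" "b > 0" by (cases e) auto
  then have "of_int b * e = of_int a" by (simp add: Fract_of_int_quotient)
  then have "of_int b * N * e = N * of_int a" by (metis mult.assoc mult.commute)
  moreover have "N * of_int a \<in> \<int>" using N by simp
  ultimately have "of_int b * N * e \<in> \<int>" by metis
  moreover have "of_int b * N * x \<in> \<int>" if "x \<in> E" for x
    using N(3) that by (simp add: mult.assoc)
  ultimately show ?case using N ab by (intro exI[of _ "of_int b * N"]) auto
qed

text \<open>
  In a torsion-free group, finitely many elements can be told apart by one additive degree
  with integer values on them: ask for a function that vanishes on none of their differences and clear denominators.
  Such a degree stands in for a total order on the grading group when leading terms are compared, and
  for a choice of coordinates when homogeneous elements are turned into monomials.
\<close>

lemma ex_additive_separating: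
  fixes E :: "'g::ab_group_add set"
  assumes E: "finite E" and tf: "\<And>x y n. x \<in> E \<Longrightarrow> y \<in> E \<Longrightarrow> n \<ge> 1 \<Longrightarrow> nmult n x = nmult n y \<Longrightarrow> x = y"
  shows "\<exists>\<phi>::'g \<Rightarrow> rat. additive \<phi> \<and> inj_on \<phi> E \<and> (\<forall>e\<in>E. \<phi> e \<in> \<int>)"
proof -
  define D where "D = (\<lambda>(x, y). x - y) ` {(x, y). x \<in> E \<and> y \<in> E \<and> x \<noteq> y}"
  have "finite {(x, y). x \<in> E \<and> y \<in> E \<and> x \<noteq> y}"
    by (rule finite_subset[of _ "E \<times> E"]) (use E in auto)
  then have "finite D" by (simp add: D_def)
  moreover have "nmult n d \<noteq> 0" if "d \<in> D" "n \<ge> 1" for d n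
    using that tf by (auto simp: D_def sum_subtractf)
  ultimately obtain \<phi> where \<phi>: "additive \<phi>" "\<And>d. d \<in> D \<Longrightarrow> \<phi> d \<noteq> (0::rat)"
    using ex_additive_nonvanishing by metis
  obtain N where N: "N > 0" "\<And>e. e \<in> E \<Longrightarrow> N * \<phi> e \<in> \<int>"
    using ex_common_denominator[of "\<phi> ` E"] E by auto
  have "additive (\<lambda>x. N * \<phi> x)" by standard (simp add: additive.add[OF \<phi>(1)] algebra_simps)
  moreover have "inj_on (\<lambda>x. N * \<phi> x) E"
  proof (rule inj_onI)
    fix x y assume *: "x \<in> E" "y \<in> E" "N * \<phi> x = N * \<phi> y"
    then have "\<phi> (x - y) = 0" using N(1) by (simp add: additive.diff[OF \<phi>(1)])
    moreover have "x - y \<in> D" if "x \<noteq> y" using that * unfolding D_def by force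
    ultimately show "x = y" using \<phi>(2) by blast
  qed
  ultimately show ?thesis using N by blast
qed

section \<open>Homogeneous components\<close>

lemma additive_subgroup_ambientD:
  assumes "additive_subgroup B (ambient :: 'k::field ring)"
  shows "0 \<in> B" "\<And>x y. x \<in> B \<Longrightarrow> y \<in> B \<Longrightarrow> x + y \<in> B" "\<And>x. x \<in> B \<Longrightarrow> - x \<in> B"
proof -
  interpret additive_subgroup B "ambient :: 'k ring" by fact
  show "0 \<in> B" using zero_closed by simp
  show "x + y \<in> B" if "x \<in> B" "y \<in> B" for x y using a_closed[OF that] by simp
  show "- x \<in> B" if "x \<in> B" for x
    using subgroup.m_inv_closed[OF a_subgroup that] ambient_uminus[of x] by (simp add: a_inv_def)
qed

lemma additive_subgroup_ambientI:
  assumes "0 \<in> B" "\<And>x y. x \<in> B \<Longrightarrow> y \<in> B \<Longrightarrow> x + y \<in> B" "\<And>x. x \<in> B \<Longrightarrow> - x \<in> B"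
  shows "additive_subgroup B (ambient :: 'k::field ring)"
proof (rule additive_subgroupI, rule subgroup.intro)
  fix x assume "x \<in> B"
  then show "inv\<^bsub>add_monoid (ambient :: 'k ring)\<^esub> x \<in> B"
    using assms(3)[of x] ambient_uminus[of x] by (simp add: a_inv_def)
qed (use assms in auto)

context graded_domain
begin

text \<open>
  Extending the components by \<open>{0}\<close> to all of the ambient group makes degrees such as
  \<open>\<gamma> - \<alpha>\<close> meaningful without knowing that they lie in \<open>\<Gamma>\<close>.
\<close>

definition part :: "'g \<Rightarrow> 'k set" where
  "part \<gamma> = (if \<gamma> \<in> \<Gamma> then A \<gamma> else {0})"

definition hom_decomposition :: "'k \<Rightarrow> ('g \<Rightarrow> 'k) \<Rightarrow> bool" where
  "hom_decomposition x f \<longleftrightarrow>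
     finite {\<gamma>. f \<gamma> \<noteq> 0} \<and> (\<forall>\<gamma>. f \<gamma> \<in> part \<gamma>) \<and> x = (\<Sum>\<gamma>\<in>{\<gamma>. f \<gamma> \<noteq> 0}. f \<gamma>)"

definition hcomp :: "'k \<Rightarrow> 'g \<Rightarrow> 'k" where
  "hcomp x = (THE f. hom_decomposition x f)"

abbreviation H :: "'k set" where
  "H \<equiv> homogeneous_elements \<Gamma> A"

lemma monoid_closed: "0 \<in> \<Gamma>" "\<And>\<alpha> \<beta>. \<alpha> \<in> \<Gamma> \<Longrightarrow> \<beta> \<in> \<Gamma> \<Longrightarrow> \<alpha> + \<beta> \<in> \<Gamma>"
  using torsionless unfolding torsionless_monoid_def by blast+

lemma torsion_free: "\<alpha> \<in> \<Gamma> \<Longrightarrow> \<beta> \<in> \<Gamma> \<Longrightarrow> n \<ge> 1 \<Longrightarrow> nmult n \<alpha> = nmult n \<beta> \<Longrightarrow> \<alpha> = \<beta>"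
  using torsionless unfolding torsionless_monoid_def by blast

lemmas R_closed = subringD[OF subring]

lemma R_sum: "(\<And>i. i \<in> F \<Longrightarrow> f i \<in> R) \<Longrightarrow> sum f F \<in> R"
  by (induction F rule: infinite_finite_induct) (auto intro: R_closed)

lemma R_prod: "(\<And>i. i \<in> F \<Longrightarrow> f i \<in> R) \<Longrightarrow> prod f F \<in> R"
  by (induction F rule: infinite_finite_induct) (auto intro: R_closed)

lemma R_power: "x \<in> R \<Longrightarrow> x ^ n \<in> R"
  by (induction n) (auto intro: R_closed)

lemma A_subgroup: "\<gamma> \<in> \<Gamma> \<Longrightarrow> additive_subgroup (A \<gamma>) ambient"
  using direct_sum unfolding is_direct_sum_def by blast

lemma A_closed:
  assumes "\<gamma> \<in> \<Gamma>"
  shows "0 \<in> A \<gamma>" "\<And>x y. x \<in> A \<gamma> \<Longrightarrow> y \<in> A \<gamma> \<Longrightarrow> x + y \<in> A \<gamma>" "\<And>x. x \<in> A \<gamma> \<Longrightarrow> - x \<in> A \<gamma>"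
  using additive_subgroup_ambientD[OF A_subgroup[OF assms]] by blast+

lemma part_closed:
  shows "0 \<in> part \<gamma>" "\<And>x y. x \<in> part \<gamma> \<Longrightarrow> y \<in> part \<gamma> \<Longrightarrow> x + y \<in> part \<gamma>"
    "\<And>x. x \<in> part \<gamma> \<Longrightarrow> - x \<in> part \<gamma>"
    "\<And>x y. x \<in> part \<gamma> \<Longrightarrow> y \<in> part \<gamma> \<Longrightarrow> x - y \<in> part \<gamma>"
proof -
  show "0 \<in> part \<gamma>" and p: "\<And>x y. x \<in> part \<gamma> \<Longrightarrow> y \<in> part \<gamma> \<Longrightarrow> x + y \<in> part \<gamma>"
    and m: "\<And>x. x \<in> part \<gamma> \<Longrightarrow> - x \<in> part \<gamma>"
    using A_closed by (auto simp: part_def split: if_splits)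
  show "x - y \<in> part \<gamma>" if "x \<in> part \<gamma>" "y \<in> part \<gamma>" for x y
    using p[OF that(1) m[OF that(2)]] by simp
qed

lemma part_mult: "a \<in> part \<alpha> \<Longrightarrow> b \<in> part \<beta> \<Longrightarrow> a * b \<in> part (\<alpha> + \<beta>)"
  using component_mult monoid_closed(2) A_closed(1) by (auto simp: part_def split: if_splits)

lemma part_subset: "part \<gamma> \<subseteq> R"
proof
  fix x assume x: "x \<in> part \<gamma>"
  show "x \<in> R"
  proof (cases "\<gamma> \<in> \<Gamma>")
    case True
    then have "x = (\<Sum>\<alpha>\<in>{\<gamma>}. x) \<and> finite {\<gamma>} \<and> {\<gamma>} \<subseteq> \<Gamma> \<and> (\<forall>\<alpha>\<in>{\<gamma>}. x \<in> A \<alpha>)"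
      using x by (simp add: part_def)
    then show ?thesis using direct_sum unfolding is_direct_sum_def by blast
  qed (use x R_closed in \<open>auto simp: part_def\<close>)
qed

lemma part_independent:
  assumes "finite F" "\<And>\<gamma>. \<gamma> \<in> F \<Longrightarrow> f \<gamma> \<in> part \<gamma>" "(\<Sum>\<gamma>\<in>F. f \<gamma>) = 0" "\<gamma> \<in> F"
  shows "f \<gamma> = 0"
proof (cases "\<gamma> \<in> \<Gamma>")
  case True
  have "(\<Sum>\<gamma>\<in>F \<inter> \<Gamma>. f \<gamma>) = (\<Sum>\<gamma>\<in>F. f \<gamma>)"
  proof (rule sum.mono_neutral_left[OF assms(1)])
    show "\<forall>i\<in>F - F \<inter> \<Gamma>. f i = 0"
    proof
      fix i assume "i \<in> F - F \<inter> \<Gamma>"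
      then show "f i = 0" using assms(2)[of i] by (auto simp: part_def)
    qed
  qed simp
  moreover have "f \<gamma> \<in> A \<gamma>" if "\<gamma> \<in> F \<inter> \<Gamma>" for \<gamma> using assms(2)[of \<gamma>] that by (simp add: part_def)
  moreover have "finite (F \<inter> \<Gamma>)" "F \<inter> \<Gamma> \<subseteq> \<Gamma>" using assms(1) by auto
  moreover have "\<And>F f. finite F \<and> F \<subseteq> \<Gamma> \<and> (\<forall>\<alpha>\<in>F. f \<alpha> \<in> A \<alpha>) \<and> sum f F = 0 \<Longrightarrow> \<forall>\<alpha>\<in>F. f \<alpha> = 0"
    using direct_sum unfolding is_direct_sum_def by simp
  ultimately have "\<forall>\<gamma>\<in>F \<inter> \<Gamma>. f \<gamma> = 0" using assms(3) by (metis (no_types, lifting))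
  then show ?thesis using True assms(4) by blast
next
  case False
  then show ?thesis using assms(2)[OF assms(4)] by (simp add: part_def)
qed

lemma hom_decomposition_unique:
  assumes "hom_decomposition x f" "hom_decomposition x g"
  shows "f = g"
proof
  fix \<gamma>
  define F where "F = {\<gamma>. f \<gamma> \<noteq> 0} \<union> {\<gamma>. g \<gamma> \<noteq> 0}"
  have F: "finite F" using assms by (auto simp: F_def hom_decomposition_def)
  have "x = (\<Sum>\<gamma>\<in>F. h \<gamma>)" if "hom_decomposition x h" "{\<gamma>. h \<gamma> \<noteq> 0} \<subseteq> F" for h
    using that sum.mono_neutral_left[OF F that(2), of h] unfolding hom_decomposition_def by auto
  from this[OF assms(1)] this[OF assms(2)] have "sum f F = sum g F" by (simp add: F_def)
  then have "(\<Sum>\<gamma>\<in>F. f \<gamma> - g \<gamma>) = 0" by (simp add: sum_subtractf)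
  then have "f \<gamma> - g \<gamma> = 0" if "\<gamma> \<in> F"
    using part_independent[OF F, of "\<lambda>\<gamma>. f \<gamma> - g \<gamma>"] assms that part_closed(4)
    unfolding hom_decomposition_def by blast
  then show "f \<gamma> = g \<gamma>" by (cases "\<gamma> \<in> F") (auto simp: F_def)
qed

lemma hom_decomposition_finite:
  assumes "finite F" "\<And>\<gamma>. \<gamma> \<in> F \<Longrightarrow> f \<gamma> \<in> part \<gamma>" "x = (\<Sum>\<gamma>\<in>F. f \<gamma>)"
  shows "hom_decomposition x (\<lambda>\<gamma>. if \<gamma> \<in> F then f \<gamma> else 0)"
  using assms part_closed(1) unfolding hom_decomposition_def
  by (auto intro!: sum.mono_neutral_cong_right elim: finite_subset[rotated])

lemma hcomp_eqI:
  assumes "finite F" "\<And>\<gamma>. \<gamma> \<in> F \<Longrightarrow> f \<gamma> \<in> part \<gamma>" "x = (\<Sum>\<gamma>\<in>F. f \<gamma>)"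
  shows "hcomp x \<gamma> = (if \<gamma> \<in> F then f \<gamma> else 0)"
proof -
  define g where "g = (\<lambda>\<gamma>. if \<gamma> \<in> F then f \<gamma> else 0)"
  have g: "hom_decomposition x g" unfolding g_def using assms by (rule hom_decomposition_finite)
  then have "hcomp x = g" unfolding hcomp_def using hom_decomposition_unique by blast
  then show ?thesis by (simp add: g_def)
qed

lemma hom_decomposition_hcomp:
  assumes "x \<in> R"
  shows "hom_decomposition x (hcomp x)"
proof -
  obtain F f where *: "finite F" "F \<subseteq> \<Gamma>" "\<forall>\<gamma>\<in>F. f \<gamma> \<in> A \<gamma>" "x = (\<Sum>\<gamma>\<in>F. f \<gamma>)"
    using assms direct_sum unfolding is_direct_sum_def by blast
  then have "hom_decomposition x (\<lambda>\<gamma>. if \<gamma> \<in> F then f \<gamma> else 0)"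
    by (intro hom_decomposition_finite) (auto simp: part_def)
  then show ?thesis using hom_decomposition_unique unfolding hcomp_def by (metis theI)
qed

lemma hcomp_part: "x \<in> R \<Longrightarrow> hcomp x \<gamma> \<in> part \<gamma>"
  and finite_supp: "x \<in> R \<Longrightarrow> finite {\<gamma>. hcomp x \<gamma> \<noteq> 0}"
  and sum_hcomp: "x \<in> R \<Longrightarrow> (\<Sum>\<gamma>\<in>{\<gamma>. hcomp x \<gamma> \<noteq> 0}. hcomp x \<gamma>) = x"
  using hom_decomposition_hcomp unfolding hom_decomposition_def by auto

lemma hcomp_R: "x \<in> R \<Longrightarrow> hcomp x \<gamma> \<in> R"
  using hcomp_part part_subset by blast

lemma supp_subset: "x \<in> R \<Longrightarrow> {\<gamma>. hcomp x \<gamma> \<noteq> 0} \<subseteq> \<Gamma>"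
  using hcomp_part by (fastforce simp: part_def split: if_splits)

lemma sum_hcomp_superset:
  assumes "x \<in> R" "finite F" "{\<gamma>. hcomp x \<gamma> \<noteq> 0} \<subseteq> F"
  shows "(\<Sum>\<gamma>\<in>F. hcomp x \<gamma>) = x"
  using sum.mono_neutral_left[OF assms(2,3), of "hcomp x"] sum_hcomp[OF assms(1)] by simp

lemma hcomp_add:
  assumes "x \<in> R" "y \<in> R"
  shows "hcomp (x + y) \<gamma> = hcomp x \<gamma> + hcomp y \<gamma>"
proof -
  define F where "F = {\<gamma>. hcomp x \<gamma> \<noteq> 0} \<union> {\<gamma>. hcomp y \<gamma> \<noteq> 0}"
  have F: "finite F" using finite_supp assms by (simp add: F_def)
  have "x + y = (\<Sum>\<gamma>\<in>F. hcomp x \<gamma> + hcomp y \<gamma>)"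
    using sum_hcomp_superset[OF _ F] assms by (simp add: sum.distrib F_def)
  then have "hcomp (x + y) \<gamma> = (if \<gamma> \<in> F then hcomp x \<gamma> + hcomp y \<gamma> else 0)"
    using assms hcomp_part part_closed(2) by (intro hcomp_eqI[OF F]) auto
  then show ?thesis by (auto simp: F_def)
qed

lemma hcomp_part_eq: "a \<in> part \<alpha> \<Longrightarrow> hcomp a \<gamma> = (if \<gamma> = \<alpha> then a else 0)"
  using hcomp_eqI[of "{\<alpha>}" "\<lambda>_. a" a] by auto

lemma hcomp_0 [simp]: "hcomp 0 \<gamma> = 0"
  using hcomp_part_eq[OF part_closed(1)] by auto

lemma hcomp_sum:
  "(\<And>i. i \<in> F \<Longrightarrow> f i \<in> R) \<Longrightarrow> hcomp (sum f F) \<gamma> = (\<Sum>i\<in>F. hcomp (f i) \<gamma>)"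
  by (induction F rule: infinite_finite_induct) (auto simp: hcomp_add R_sum)

lemma hcomp_part_mult:
  assumes "a \<in> part \<alpha>" "x \<in> R"
  shows "hcomp (a * x) \<gamma> = a * hcomp x (\<gamma> - \<alpha>)"
proof -
  define F where "F = (+) \<alpha> ` {\<gamma>. hcomp x \<gamma> \<noteq> 0}"
  have F: "finite F" using finite_supp assms by (simp add: F_def)
  have "a * x = a * (\<Sum>\<gamma>\<in>{\<gamma>. hcomp x \<gamma> \<noteq> 0}. hcomp x \<gamma>)" using sum_hcomp assms by simp
  also have "\<dots> = (\<Sum>\<gamma>\<in>F. a * hcomp x (\<gamma> - \<alpha>))"
    unfolding F_def by (subst sum.reindex) (auto simp: sum_distrib_left intro: inj_onI)
  finally have "a * x = (\<Sum>\<gamma>\<in>F. a * hcomp x (\<gamma> - \<alpha>))" .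
  moreover have "a * hcomp x (\<gamma> - \<alpha>) \<in> part \<gamma>" for \<gamma>
    using part_mult[OF assms(1) hcomp_part[OF assms(2)], of "\<gamma> - \<alpha>"] by simp
  ultimately have "hcomp (a * x) \<gamma> = (if \<gamma> \<in> F then a * hcomp x (\<gamma> - \<alpha>) else 0)"
    by (intro hcomp_eqI[OF F]) auto
  moreover have "hcomp x (\<gamma> - \<alpha>) = 0" if "\<gamma> \<notin> F"
  proof (rule ccontr)
    assume "hcomp x (\<gamma> - \<alpha>) \<noteq> 0"
    then have "\<alpha> + (\<gamma> - \<alpha>) \<in> F" unfolding F_def by blast
    then show False using that by simp
  qed
  ultimately show ?thesis by auto
qed

lemma hcomp_mult:
  assumes "x \<in> R" "y \<in> R"
  shows "hcomp (x * y) \<gamma> = (\<Sum>\<alpha>\<in>{\<alpha>. hcomp x \<alpha> \<noteq> 0}. hcomp x \<alpha> * hcomp y (\<gamma> - \<alpha>))"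
proof -
  have "x * y = (\<Sum>\<alpha>\<in>{\<alpha>. hcomp x \<alpha> \<noteq> 0}. hcomp x \<alpha> * y)"
    using sum_hcomp[OF assms(1)] by (metis sum_distrib_right)
  then show ?thesis
    using assms hcomp_part_mult[OF hcomp_part[OF assms(1)] assms(2)]
    by (simp add: hcomp_sum hcomp_R R_closed)
qed

text \<open>
  A component of \<open>1\<close> of nonzero degree would move a nonzero homogeneous element to another degree.
\<close>

lemma one_part: "1 \<in> part 0"
proof -
  have "hcomp 1 \<gamma> = 0" if "\<gamma> \<noteq> 0" for \<gamma>
  proof -
    obtain \<alpha> where \<alpha>: "hcomp 1 \<alpha> \<noteq> 0"
      using sum_hcomp[OF R_closed(2)] by (metis (mono_tags, lifting) mem_Collect_eq sum.neutral zero_neq_one)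
    have p: "hcomp 1 \<alpha> \<in> part \<alpha>" using hcomp_part R_closed by blast
    have "hcomp (hcomp 1 \<alpha> * 1) (\<alpha> + \<gamma>) = hcomp 1 \<alpha> * hcomp 1 \<gamma>"
      using hcomp_part_mult[OF p R_closed(2), of "\<alpha> + \<gamma>"] by simp
    moreover have "hcomp (hcomp 1 \<alpha> * 1) (\<alpha> + \<gamma>) = 0" using hcomp_part_eq[OF p] that by simp
    ultimately show ?thesis using \<alpha> by simp
  qed
  then have "{\<gamma>. hcomp 1 \<gamma> \<noteq> 0} \<subseteq> {0}" by blast
  then have "(\<Sum>\<gamma>\<in>{0}. hcomp 1 \<gamma>) = 1" by (intro sum_hcomp_superset R_closed) auto
  then show ?thesis using hcomp_part[OF R_closed(2), of 0] by simp
qed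

lemma H_iff: "x \<in> H \<longleftrightarrow> x \<noteq> 0 \<and> (\<exists>\<gamma>. x \<in> part \<gamma>)"
  by (auto simp: homogeneous_elements_def part_def)

lemma H_mult: "x \<in> H \<Longrightarrow> y \<in> H \<Longrightarrow> x * y \<in> H"
  using part_mult unfolding H_iff by fastforce

lemma H_one: "1 \<in> H"
  using one_part unfolding H_iff by auto

lemma H_power: "x \<in> H \<Longrightarrow> x ^ n \<in> H"
  by (induction n) (auto simp: H_one H_mult)

lemma H_R: "x \<in> H \<Longrightarrow> x \<in> R"
  using part_subset unfolding H_iff by blast

lemma hcomp_H: "x \<in> R \<Longrightarrow> hcomp x \<gamma> \<noteq> 0 \<Longrightarrow> hcomp x \<gamma> \<in> H"
  using hcomp_part unfolding H_iff by blast

lemma part_cancel: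
  assumes "a \<in> part \<alpha>" "a \<noteq> 0" "x \<in> R" "a * x \<in> part \<gamma>"
  shows "x \<in> part (\<gamma> - \<alpha>)"
proof -
  have "hcomp x \<delta> = 0" if "\<delta> \<noteq> \<gamma> - \<alpha>" for \<delta>
    using hcomp_part_mult[OF assms(1,3), of "\<alpha> + \<delta>"] hcomp_part_eq[OF assms(4), of "\<alpha> + \<delta>"] that assms(2)
    by (auto simp: algebra_simps split: if_splits)
  then have "(\<Sum>\<delta>\<in>{\<gamma> - \<alpha>}. hcomp x \<delta>) = x" by (intro sum_hcomp_superset assms) auto
  then show ?thesis using hcomp_part[OF assms(3), of "\<gamma> - \<alpha>"] by simp
qed

section \<open>Homogeneous ideals and homogeneous primes\<close>

definition graded_ideal :: "'k set \<Rightarrow> bool" where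
  "graded_ideal I \<longleftrightarrow> ideal I (ring_on R) \<and> (\<forall>x\<in>I. \<forall>\<gamma>. hcomp x \<gamma> \<in> I)"

lemmas ideal_iff = ideal_ring_on_iff[OF subring]
lemmas prime_iff = primeideal_ring_on_iff[OF subring]

lemma graded_idealD:
  assumes "graded_ideal I"
  shows "I \<subseteq> R" "0 \<in> I" "\<And>x y. x \<in> I \<Longrightarrow> y \<in> I \<Longrightarrow> x + y \<in> I"
    "\<And>r x. r \<in> R \<Longrightarrow> x \<in> I \<Longrightarrow> r * x \<in> I" "\<And>x \<gamma>. x \<in> I \<Longrightarrow> hcomp x \<gamma> \<in> I"
  using assms unfolding graded_ideal_def ideal_iff by auto

lemma graded_idealI:
  assumes "I \<subseteq> R" "0 \<in> I" "\<And>x y. x \<in> I \<Longrightarrow> y \<in> I \<Longrightarrow> x + y \<in> I"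
    "\<And>r x. r \<in> R \<Longrightarrow> x \<in> I \<Longrightarrow> r * x \<in> I" "\<And>x \<gamma>. x \<in> I \<Longrightarrow> hcomp x \<gamma> \<in> I"
  shows "graded_ideal I"
  using assms unfolding graded_ideal_def ideal_iff by simp

lemma ideal_sum:
  assumes "ideal I (ring_on R)" "\<And>i. i \<in> F \<Longrightarrow> f i \<in> I"
  shows "sum f F \<in> I"
  using assms(2) assms(1)[unfolded ideal_iff] by (induction F rule: infinite_finite_induct) auto

lemma ideal_memI_components:
  assumes "ideal I (ring_on R)" "x \<in> R" "\<And>\<gamma>. hcomp x \<gamma> \<in> I"
  shows "x \<in> I"
  using ideal_sum[OF assms(1), of "{\<gamma>. hcomp x \<gamma> \<noteq> 0}" "hcomp x"] assms(2,3) sum_hcomp by simp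

definition homogeneous_core :: "'k set \<Rightarrow> 'k set" where
  "homogeneous_core I = {x \<in> I. \<forall>\<gamma>. hcomp x \<gamma> \<in> I}"

lemma graded_ideal_core:
  assumes I: "ideal I (ring_on R)"
  shows "graded_ideal (homogeneous_core I)"
proof -
  note I' = I[unfolded ideal_iff]
  have "ideal (homogeneous_core I) (ring_on R)"
    unfolding ideal_iff
  proof (intro conjI ballI)
    show "homogeneous_core I \<subseteq> R" "0 \<in> homogeneous_core I"
      using I' by (auto simp: homogeneous_core_def)
    fix x y assume xy: "x \<in> homogeneous_core I" "y \<in> homogeneous_core I"
    then have "x \<in> R" "y \<in> R" using I' by (auto simp: homogeneous_core_def)
    then show "x + y \<in> homogeneous_core I" using xy I' by (simp add: homogeneous_core_def hcomp_add)
  next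
    fix r x assume r: "r \<in> R" and x: "x \<in> homogeneous_core I"
    then have "x \<in> R" using I' by (auto simp: homogeneous_core_def)
    have "hcomp (r * x) \<gamma> \<in> I" for \<gamma>
      unfolding hcomp_mult[OF r \<open>x \<in> R\<close>]
      using I' x hcomp_R[OF r] by (intro ideal_sum[OF I]) (auto simp: homogeneous_core_def)
    then show "r * x \<in> homogeneous_core I" using r x I' by (simp add: homogeneous_core_def)
  qed
  moreover have "hcomp (hcomp x \<gamma>) \<delta> \<in> I" if "x \<in> homogeneous_core I" for x \<gamma> \<delta>
    using that I' hcomp_part_eq[OF hcomp_part, of x \<gamma> \<delta>] by (auto simp: homogeneous_core_def)
  ultimately show ?thesis by (auto simp: graded_ideal_def homogeneous_core_def)
qed

lemma homogeneous_ideal_iff: "homogeneous_ideal \<Gamma> A R I \<longleftrightarrow> graded_ideal I"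
proof
  assume "homogeneous_ideal \<Gamma> A R I"
  then have I: "ideal I (ring_on R)" and "\<exists>S. S \<subseteq> H \<and> I = Idl\<^bsub>ring_on R\<^esub> S"
    unfolding homogeneous_ideal_def by simp_all
  from this(2) obtain S where "S \<subseteq> H \<and> I = Idl\<^bsub>ring_on R\<^esub> S" by (rule exE)
  then have S: "S \<subseteq> H" "I = Idl\<^bsub>ring_on R\<^esub> S" by simp_all
  have "s \<in> homogeneous_core I" if s: "s \<in> S" for s
  proof -
    have "s \<in> H" using s S(1) by blast
    then obtain \<gamma> where "s \<in> part \<gamma>" using H_iff by blast
    moreover have "s \<in> I" using subset_Idl[of S R] s S(2) by blast
    moreover have "0 \<in> I" using I[unfolded ideal_iff] by simp
    ultimately show ?thesis unfolding homogeneous_core_def using hcomp_part_eq by auto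
  qed
  moreover have "ideal (homogeneous_core I) (ring_on R)"
    using graded_ideal_core[OF I] unfolding graded_ideal_def by simp
  ultimately have "Idl\<^bsub>ring_on R\<^esub> S \<subseteq> homogeneous_core I" by (intro Idl_subset) auto
  then have "I \<subseteq> homogeneous_core I" using S(2) by simp
  then show "graded_ideal I" using I by (auto simp: graded_ideal_def homogeneous_core_def)
next
  assume "graded_ideal I"
  then have I: "ideal I (ring_on R)" and c: "\<And>x \<gamma>. x \<in> I \<Longrightarrow> hcomp x \<gamma> \<in> I"
    by (auto simp: graded_ideal_def)
  note I' = I[unfolded ideal_iff]
  define S where "S = I \<inter> H"
  have "S \<subseteq> R" using H_R by (auto simp: S_def)
  have id: "ideal (Idl\<^bsub>ring_on R\<^esub> S) (ring_on R)" by (rule ideal_Idl[OF subring \<open>S \<subseteq> R\<close>])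
  have "Idl\<^bsub>ring_on R\<^esub> S = I"
  proof
    show "Idl\<^bsub>ring_on R\<^esub> S \<subseteq> I" by (rule Idl_subset[OF I]) (simp add: S_def)
    show "I \<subseteq> Idl\<^bsub>ring_on R\<^esub> S"
    proof
      fix x assume x: "x \<in> I"
      then have "x \<in> R" using I' by blast
      show "x \<in> Idl\<^bsub>ring_on R\<^esub> S"
      proof (rule ideal_memI_components[OF id \<open>x \<in> R\<close>])
        fix \<gamma>
        show "hcomp x \<gamma> \<in> Idl\<^bsub>ring_on R\<^esub> S"
          using hcomp_H[OF \<open>x \<in> R\<close>] c[OF x] subset_Idl[of S R] id[unfolded ideal_iff]
          by (cases "hcomp x \<gamma> = 0") (auto simp: S_def)
      qed
    qed
  qed
  moreover have "S \<subseteq> H" by (simp add: S_def)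
  ultimately show "homogeneous_ideal \<Gamma> A R I"
    using I unfolding homogeneous_ideal_def by (intro conjI exI[of _ S]) simp_all
qed

lemma graded_ideal_finite_generators:
  assumes I: "graded_ideal I" and fg: "finitely_generated_ideal R I"
  shows "\<exists>E. finite E \<and> E \<subseteq> H \<and> I = Idl\<^bsub>ring_on R\<^esub> E"
proof -
  obtain S where S: "finite S" "S \<subseteq> R" "I = Idl\<^bsub>ring_on R\<^esub> S"
    using fg unfolding finitely_generated_ideal_def by blast
  define E where "E = (\<Union>s\<in>S. hcomp s ` {\<gamma>. hcomp s \<gamma> \<noteq> 0})"
  have E: "finite E" "E \<subseteq> H" using S finite_supp hcomp_H by (auto simp: E_def)
  have SI: "S \<subseteq> I" using subset_Idl S(3) by blast
  have "E \<subseteq> I" using SI I by (auto simp: E_def graded_ideal_def)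
  have id: "ideal (Idl\<^bsub>ring_on R\<^esub> E) (ring_on R)" using E(2) H_R by (intro ideal_Idl[OF subring]) blast
  have "S \<subseteq> Idl\<^bsub>ring_on R\<^esub> E"
  proof
    fix s assume s: "s \<in> S"
    have "hcomp s \<gamma> \<in> Idl\<^bsub>ring_on R\<^esub> E" for \<gamma>
    proof (cases "hcomp s \<gamma> = 0")
      case True
      then show ?thesis using id[unfolded ideal_iff] by simp
    next
      case False
      then have "hcomp s \<gamma> \<in> E" using s unfolding E_def by blast
      then show ?thesis using subset_Idl by blast
    qed
    then show "s \<in> Idl\<^bsub>ring_on R\<^esub> E" using ideal_memI_components[OF id] s S(2) by blast
  qed
  then have "I \<subseteq> Idl\<^bsub>ring_on R\<^esub> E" unfolding S(3) by (rule Idl_subset[OF id])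
  moreover have "Idl\<^bsub>ring_on R\<^esub> E \<subseteq> I" using I \<open>E \<subseteq> I\<close> by (intro Idl_subset) (auto simp: graded_ideal_def)
  ultimately have "I = Idl\<^bsub>ring_on R\<^esub> E" by (rule subset_antisym)
  then show ?thesis using E by (intro exI[of _ E] conjI)
qed

lemma homogeneous_prime_iff:
  "homogeneous_prime \<Gamma> A R P \<longleftrightarrow> graded_ideal P \<and> primeideal P (ring_on R)"
  unfolding homogeneous_prime_def homogeneous_ideal_iff by (rule refl)

lemma homogeneous_primeD:
  assumes "homogeneous_prime \<Gamma> A R P"
  shows "P \<subseteq> R" "0 \<in> P" "1 \<notin> P" "\<And>x y. x \<in> P \<Longrightarrow> y \<in> P \<Longrightarrow> x + y \<in> P"
    "\<And>r x. r \<in> R \<Longrightarrow> x \<in> P \<Longrightarrow> r * x \<in> P"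
    "\<And>x y. x \<in> R \<Longrightarrow> y \<in> R \<Longrightarrow> x * y \<in> P \<Longrightarrow> x \<in> P \<or> y \<in> P"
    "\<And>x \<gamma>. x \<in> P \<Longrightarrow> hcomp x \<gamma> \<in> P"
proof -
  have id: "ideal P (ring_on R)" and c: "\<forall>x\<in>P. \<forall>\<gamma>. hcomp x \<gamma> \<in> P" and p: "primeideal P (ring_on R)"
    using assms unfolding homogeneous_prime_iff graded_ideal_def by simp_all
  show "P \<subseteq> R" "0 \<in> P" using id unfolding ideal_iff by simp_all
  show "1 \<notin> P" using p unfolding prime_iff by simp
  show "x + y \<in> P" if "x \<in> P" "y \<in> P" for x y using id that unfolding ideal_iff by simp
  show "r * x \<in> P" if "r \<in> R" "x \<in> P" for r x using id that unfolding ideal_iff by simp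
  show "x \<in> P \<or> y \<in> P" if "x \<in> R" "y \<in> R" "x * y \<in> P" for x y
    using p that unfolding prime_iff by simp
  show "hcomp x \<gamma> \<in> P" if "x \<in> P" for x \<gamma> using c that by simp
qed

lemma prime_ex_component:
  assumes "homogeneous_prime \<Gamma> A R P" "x \<in> R" "x \<notin> P"
  shows "\<exists>\<gamma>. hcomp x \<gamma> \<in> H \<and> hcomp x \<gamma> \<notin> P"
proof -
  have "ideal P (ring_on R)"
    using assms(1) unfolding homogeneous_prime_iff graded_ideal_def by simp
  then obtain \<gamma> where "hcomp x \<gamma> \<notin> P" using ideal_memI_components[OF _ assms(2)] assms(3) by blast
  moreover from this have "hcomp x \<gamma> \<in> H"
    using hcomp_H[OF assms(2)] homogeneous_primeD(2)[OF assms(1)] by metis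
  ultimately show ?thesis by blast
qed

lemma separating_degree_function:
  assumes "finite E" "E \<subseteq> \<Gamma>"
  shows "\<exists>\<phi>::'g \<Rightarrow> rat. additive \<phi> \<and> inj_on \<phi> E \<and> (\<forall>e\<in>E. \<phi> e \<in> \<int>)"
  using assms torsion_free by (intro ex_additive_separating) blast+

text \<open>
  It suffices to test primality on homogeneous elements. For \<open>x\<close> and \<open>y\<close> outside \<open>P\<close>, take the
  components outside \<open>P\<close> whose degrees are largest with respect to a function that separates the
  finitely many degrees involved. In the component of \<open>x * y\<close> of the sum of their degrees, every other
  contribution has a factor in \<open>P\<close>.
\<close>

lemma homogeneous_primeI:
  assumes P: "graded_ideal P" "1 \<notin> P" and pr: "\<And>a b. a \<in> H \<Longrightarrow> b \<in> H \<Longrightarrow> a * b \<in> P \<Longrightarrow> a \<in> P \<or> b \<in> P"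
  shows "homogeneous_prime \<Gamma> A R P"
proof -
  have id: "ideal P (ring_on R)" and c: "\<And>x \<gamma>. x \<in> P \<Longrightarrow> hcomp x \<gamma> \<in> P"
    using P(1) unfolding graded_ideal_def by auto
  note P' = id[unfolded ideal_iff]
  have "x \<in> P \<or> y \<in> P" if xy: "x \<in> R" "y \<in> R" "x * y \<in> P" for x y
  proof (rule ccontr)
    assume neg: "\<not> (x \<in> P \<or> y \<in> P)"
    define U where "U = {\<gamma>. hcomp x \<gamma> \<notin> P}"
    define Y where "Y = {\<gamma>. hcomp y \<gamma> \<notin> P}"
    have sub: "U \<subseteq> {\<gamma>. hcomp x \<gamma> \<noteq> 0}" "Y \<subseteq> {\<gamma>. hcomp y \<gamma> \<noteq> 0}" using P' by (auto simp: U_def Y_def)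
    have fin: "finite U" "finite Y" using sub finite_supp xy finite_subset by metis+
    have ne: "U \<noteq> {}" "Y \<noteq> {}"
      using ideal_memI_components[OF id] neg xy by (auto simp: U_def Y_def)
    have "U \<union> Y \<subseteq> \<Gamma>" using sub supp_subset xy by blast
    then obtain \<phi> :: "'g \<Rightarrow> rat" where \<phi>: "additive \<phi>" "inj_on \<phi> (U \<union> Y)"
      using separating_degree_function[of "U \<union> Y"] fin by auto
    obtain \<alpha> where \<alpha>: "\<alpha> \<in> U" "\<And>\<gamma>. \<gamma> \<in> U \<Longrightarrow> \<phi> \<gamma> \<le> \<phi> \<alpha>"
      using obtains_MAX[OF fin(1) ne(1), of \<phi>] Max_ge[OF finite_imageI[OF fin(1), of \<phi>]]
      by (metis imageI)
    obtain \<beta> where \<beta>: "\<beta> \<in> Y" "\<And>\<gamma>. \<gamma> \<in> Y \<Longrightarrow> \<phi> \<gamma> \<le> \<phi> \<beta>"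
      using obtains_MAX[OF fin(2) ne(2), of \<phi>] Max_ge[OF finite_imageI[OF fin(2), of \<phi>]]
      by (metis imageI)
    have other: "hcomp x \<gamma> * hcomp y (\<alpha> + \<beta> - \<gamma>) \<in> P" if "\<gamma> \<noteq> \<alpha>" for \<gamma>
    proof (cases "\<gamma> \<in> U")
      case True
      then have "\<phi> \<gamma> < \<phi> \<alpha>" using \<alpha> that \<phi>(2) by (metis UnCI inj_onD order_le_less)
      then have "\<phi> (\<alpha> + \<beta> - \<gamma>) > \<phi> \<beta>"
        by (simp add: additive.add[OF \<phi>(1)] additive.diff[OF \<phi>(1)])
      then have "\<alpha> + \<beta> - \<gamma> \<notin> Y" using \<beta>(2) by fastforce
      then show ?thesis using P' hcomp_R[OF xy(1)] by (auto simp: Y_def)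
    next
      case False
      then have "hcomp y (\<alpha> + \<beta> - \<gamma>) * hcomp x \<gamma> \<in> P" using P' hcomp_R[OF xy(2)] by (auto simp: U_def)
      then show ?thesis by (simp add: mult.commute)
    qed
    define S where "S = {\<gamma>. hcomp x \<gamma> \<noteq> 0}"
    have S: "finite S" "\<alpha> \<in> S" using finite_supp xy \<alpha>(1) sub by (auto simp: S_def)
    have "hcomp (x * y) (\<alpha> + \<beta>) = (\<Sum>\<gamma>\<in>S. hcomp x \<gamma> * hcomp y (\<alpha> + \<beta> - \<gamma>))"
      unfolding S_def by (rule hcomp_mult[OF xy(1,2)])
    also have "\<dots> = hcomp x \<alpha> * hcomp y \<beta> + (\<Sum>\<gamma>\<in>S - {\<alpha>}. hcomp x \<gamma> * hcomp y (\<alpha> + \<beta> - \<gamma>))"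
      using S by (simp add: sum.remove)
    finally have eq: "hcomp x \<alpha> * hcomp y \<beta> =
        hcomp (x * y) (\<alpha> + \<beta>) + (- 1) * (\<Sum>\<gamma>\<in>S - {\<alpha>}. hcomp x \<gamma> * hcomp y (\<alpha> + \<beta> - \<gamma>))" by simp
    have "(\<Sum>\<gamma>\<in>S - {\<alpha>}. hcomp x \<gamma> * hcomp y (\<alpha> + \<beta> - \<gamma>)) \<in> P" using other by (intro ideal_sum[OF id]) auto
    moreover have "- 1 \<in> R" using R_closed by blast
    ultimately have "hcomp x \<alpha> * hcomp y \<beta> \<in> P" unfolding eq using P' c[OF xy(3)] by blast
    moreover have "hcomp x \<alpha> \<in> H" "hcomp y \<beta> \<in> H" using \<alpha>(1) \<beta>(1) sub hcomp_H xy by auto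
    ultimately show False using pr \<alpha>(1) \<beta>(1) by (auto simp: U_def Y_def)
  qed
  then show ?thesis unfolding homogeneous_prime_iff prime_iff using P id by blast
qed

lemma graded_ideal_insert:
  assumes P: "graded_ideal P" and a: "a \<in> H"
  shows "graded_ideal {p + r * a | p r. p \<in> P \<and> r \<in> R}" (is "graded_ideal ?Q")
proof -
  have id: "ideal P (ring_on R)" and c: "\<And>x \<gamma>. x \<in> P \<Longrightarrow> hcomp x \<gamma> \<in> P"
    using P unfolding graded_ideal_def by auto
  note P' = id[unfolded ideal_iff]
  obtain \<alpha> where \<alpha>: "a \<in> part \<alpha>" using a H_iff by blast
  have aR: "a \<in> R" using a H_R by blast
  have "ideal ?Q (ring_on R)"
    unfolding ideal_iff
  proof (intro conjI ballI)
    show "?Q \<subseteq> R" using P' aR by (auto intro!: R_closed)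
    have "0 = 0 + 0 * a" by simp
    then show "0 \<in> ?Q" using P' R_closed(1) by blast
    fix x y assume "x \<in> ?Q" "y \<in> ?Q"
    then obtain p r q t where *: "x = p + r * a" "y = q + t * a" "p \<in> P" "q \<in> P" "r \<in> R" "t \<in> R"
      by blast
    have "x + y = (p + q) + (r + t) * a" unfolding * by (simp add: algebra_simps)
    then show "x + y \<in> ?Q" using * P' R_closed(3) by blast
  next
    fix t x assume "t \<in> R" "x \<in> ?Q"
    then obtain p r where *: "x = p + r * a" "p \<in> P" "r \<in> R" "t \<in> R" by blast
    have "t * x = t * p + (t * r) * a" unfolding * by (simp add: algebra_simps)
    then show "t * x \<in> ?Q" using * P' R_closed(4) by blast
  qed
  moreover have "hcomp x \<gamma> \<in> ?Q" if "x \<in> ?Q" for x \<gamma>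
  proof -
    obtain p r where *: "x = p + r * a" "p \<in> P" "r \<in> R" using \<open>x \<in> ?Q\<close> by blast
    have "hcomp x \<gamma> = hcomp p \<gamma> + hcomp (a * r) \<gamma>"
      unfolding * using * P' aR by (subst hcomp_add) (auto intro!: R_closed simp: mult.commute)
    also have "\<dots> = hcomp p \<gamma> + hcomp r (\<gamma> - \<alpha>) * a" using hcomp_part_mult[OF \<alpha> \<open>r \<in> R\<close>] by simp
    finally show ?thesis using c[OF \<open>p \<in> P\<close>] hcomp_R[OF \<open>r \<in> R\<close>] by blast
  qed
  ultimately show ?thesis unfolding graded_ideal_def by blast
qed

text \<open>
  The homogeneous form of Krull's theorem: an ideal that is maximal among the homogeneous ideals
  disjoint from the multiplicative set \<open>W\<close> is prime.
\<close>

lemma ex_homogeneous_prime_avoiding: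
  assumes I: "graded_ideal I" and W: "W \<subseteq> H" "1 \<in> W" "\<And>x y. x \<in> W \<Longrightarrow> y \<in> W \<Longrightarrow> x * y \<in> W"
    and disj: "I \<inter> W = {}"
  shows "\<exists>P. homogeneous_prime \<Gamma> A R P \<and> I \<subseteq> P \<and> P \<inter> W = {}"
proof -
  define Z where "Z = {J. graded_ideal J \<and> I \<subseteq> J \<and> J \<inter> W = {}}"
  have "\<exists>P\<in>Z. \<forall>U\<in>Z. P \<subseteq> U \<longrightarrow> U = P"
  proof (rule subset_Zorn_nonempty)
    show "Z \<noteq> {}" using I disj unfolding Z_def by blast
  next
    fix C assume C: "C \<noteq> {}" "subset.chain Z C"
    then have CZ: "\<And>F. F \<in> C \<Longrightarrow> F \<in> Z" by (auto simp: subset.chain_def)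
    then have Cid: "\<And>F. F \<in> C \<Longrightarrow> graded_ideal F" by (auto simp: Z_def)
    have "graded_ideal (\<Union>C)"
    proof (rule graded_idealI)
      show "\<Union>C \<subseteq> R" using graded_idealD(1)[OF Cid] by blast
      show "0 \<in> \<Union>C" using graded_idealD(2)[OF Cid] C(1) by blast
      show "r * x \<in> \<Union>C" if "r \<in> R" "x \<in> \<Union>C" for r x
        using graded_idealD(4)[OF Cid] that by blast
      show "hcomp x \<gamma> \<in> \<Union>C" if "x \<in> \<Union>C" for x \<gamma> using graded_idealD(5)[OF Cid] that by blast
      fix x y assume "x \<in> \<Union>C" "y \<in> \<Union>C"
      then obtain J K where JK: "J \<in> C" "K \<in> C" "x \<in> J" "y \<in> K" by blast
      then have "J \<subseteq> K \<or> K \<subseteq> J" using C(2) by (auto simp: subset.chain_def)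
      then have "x + y \<in> J \<or> x + y \<in> K"
        using graded_idealD(3)[OF Cid] JK by blast
      then show "x + y \<in> \<Union>C" using JK(1,2) by blast
    qed
    then show "\<Union>C \<in> Z" using C(1) CZ unfolding Z_def by blast
  qed
  then obtain P where PZ: "P \<in> Z" and maxZ: "\<forall>U\<in>Z. P \<subseteq> U \<longrightarrow> U = P" by (rule bexE)
  have P: "graded_ideal P" "I \<subseteq> P" "P \<inter> W = {}" using PZ by (simp_all add: Z_def)
  have max: "U = P" if "graded_ideal U" "P \<subseteq> U" "U \<inter> W = {}" for U
    using maxZ that P(2) by (simp add: Z_def)
  note P' = graded_idealD[OF P(1)]
  have meet: "\<exists>p r. p \<in> P \<and> r \<in> R \<and> p + r * a \<in> W" if a: "a \<in> H" "a \<notin> P" for a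
  proof (rule ccontr)
    assume neg: "\<not> ?thesis"
    let ?Q = "{p + r * a | p r. p \<in> P \<and> r \<in> R}"
    have "P \<subseteq> ?Q"
    proof
      fix p assume "p \<in> P"
      moreover have "p = p + 0 * a" by simp
      ultimately show "p \<in> ?Q" using R_closed(1) by blast
    qed
    then have "?Q = P" using neg by (intro max graded_ideal_insert P a) auto
    moreover have "a = 0 + 1 * a" by simp
    then have "a \<in> ?Q" using P' R_closed(2) by blast
    ultimately show False using a by blast
  qed
  have "homogeneous_prime \<Gamma> A R P"
  proof (rule homogeneous_primeI[OF P(1)])
    show "1 \<notin> P" using P(3) W(2) by blast
    fix a b assume ab: "a \<in> H" "b \<in> H" "a * b \<in> P"
    show "a \<in> P \<or> b \<in> P"
    proof (rule ccontr)
      assume "\<not> (a \<in> P \<or> b \<in> P)"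
      then obtain p r q t where *: "p \<in> P" "r \<in> R" "p + r * a \<in> W" "q \<in> P" "t \<in> R" "q + t * b \<in> W"
        using meet[OF ab(1)] meet[OF ab(2)] by blast
      have R: "p \<in> R" "q \<in> R" "a \<in> R" "b \<in> R" using * P' H_R ab by auto
      have "(p + r * a) * (q + t * b) = (q + t * b) * p + ((r * a) * q + (r * t) * (a * b))"
        by (simp add: algebra_simps)
      moreover have "(q + t * b) * p + ((r * a) * q + (r * t) * (a * b)) \<in> P"
        using P' * R ab(3) R_closed by simp
      ultimately show False using W(3)[OF *(3,6)] P(3) by auto
    qed
  qed
  then show ?thesis using P by blast
qed

text \<open>
  The local-global principle for ideals that need not be homogeneous: otherwise some homogeneous
  prime would contain the homogeneous elements of \<open>U\<close>.
\<close>

lemma one_mem_if_local: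
  assumes U: "ideal U (ring_on R)"
    and loc: "\<And>M. homogeneous_prime \<Gamma> A R M \<Longrightarrow> \<exists>s\<in>H. s \<in> U \<and> s \<notin> M"
  shows "1 \<in> U"
proof (rule ccontr)
  assume "1 \<notin> U"
  then have "homogeneous_core U \<inter> {1} = {}" by (auto simp: homogeneous_core_def)
  then obtain M where M: "homogeneous_prime \<Gamma> A R M" "homogeneous_core U \<subseteq> M"
    using ex_homogeneous_prime_avoiding[OF graded_ideal_core[OF U], of "{1}"] H_one by auto
  obtain s where s: "s \<in> H" "s \<in> U" "s \<notin> M" using loc[OF M(1)] by blast
  then obtain \<gamma> where "s \<in> part \<gamma>" using H_iff by blast
  then have "s \<in> homogeneous_core U"
    using s(2) U[unfolded ideal_iff] hcomp_part_eq by (auto simp: homogeneous_core_def)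
  then show False using M(2) s(3) by blast
qed

end

section \<open>Local comparability of homogeneous elements\<close>

context graded_domain
begin

text \<open>
  Equivalently, the homogeneous localization of \<open>R\<close> at each homogeneous prime \<open>M\<close> is a graded
  valuation domain. Clearing denominators keeps the condition inside \<open>R\<close>.
\<close>

definition locally_comparable :: bool where
  "locally_comparable \<longleftrightarrow>
     (\<forall>M. homogeneous_prime \<Gamma> A R M \<longrightarrow> (\<forall>a\<in>H. \<forall>b\<in>H. \<exists>s\<in>H. s \<notin> M \<and>
        ((\<exists>r\<in>R. s * a = b * r) \<or> (\<exists>r\<in>R. s * b = a * r))))"

text \<open>
  This is what allows multipliers to be chosen homogeneous.
\<close>

lemma component_multiplier:
  assumes "a \<in> H" "b \<in> H" "s \<in> R" "r \<in> R" "s * a = b * r"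
  shows "\<exists>r'\<in>R. hcomp s \<gamma> * a = b * r'"
proof -
  obtain \<alpha> \<beta> where p: "a \<in> part \<alpha>" "b \<in> part \<beta>" using assms(1,2) H_iff by blast
  have "a * hcomp s \<gamma> = hcomp (b * r) (\<alpha> + \<gamma>)"
    using hcomp_part_mult[OF p(1) assms(3), of "\<alpha> + \<gamma>"] assms(5) by (simp add: mult.commute)
  also have "\<dots> = b * hcomp r (\<alpha> + \<gamma> - \<beta>)" by (rule hcomp_part_mult[OF p(2) assms(4)])
  finally show ?thesis using hcomp_R[OF assms(4)] by (metis mult.commute)
qed

text \<open>
  The equation is \<open>1 \<in> I I\<^bsup>-1\<^esup>\<close> for \<open>I = (a, b)\<close>; both \<open>x\<close> and \<open>y\<close> lie in \<open>I\<^bsup>-1\<^esup>\<close>.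
\<close>

lemma Prufer_pair:
  assumes Pr: "graded_Prufer_domain \<Gamma> A R" and a: "a \<in> H" and b: "b \<in> H"
  shows "\<exists>x y. x * a \<in> R \<and> x * b \<in> R \<and> y * a \<in> R \<and> y * b \<in> R \<and> a * x + b * y = 1"
proof -
  have ab: "{a, b} \<subseteq> R" using a b H_R by blast
  define I where "I = Idl\<^bsub>ring_on R\<^esub> {a, b}"
  have I: "I = {r * a + t * b | r t. r \<in> R \<and> t \<in> R}"
    unfolding I_def using ab by (intro Idl_pair[OF subring]) auto
  have "homogeneous_ideal \<Gamma> A R I"
    unfolding homogeneous_ideal_def
    using ideal_Idl[OF subring ab] a b by (intro conjI exI[of _ "{a, b}"]) (simp_all add: I_def)
  moreover have "finitely_generated_ideal R I"
    unfolding finitely_generated_ideal_def I_def using ab by (intro exI[of _ "{a, b}"]) auto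
  moreover have abI: "a \<in> I" "b \<in> I" using subset_Idl[of "{a, b}" R] unfolding I_def by auto
  then have "I \<noteq> {0}" using a H_iff by auto
  ultimately have "invertible_ideal R I" using Pr unfolding graded_Prufer_domain_def by blast
  then have 1: "1 \<in> ideal_prod ambient I (inverse_ideal R I)"
    unfolding invertible_ideal_def using R_closed(2) by simp
  have "\<exists>x y. x * a \<in> R \<and> x * b \<in> R \<and> y * a \<in> R \<and> y * b \<in> R \<and> a * x + b * y = z"
    if "z \<in> ideal_prod ambient I (inverse_ideal R I)" for z
    using that
  proof (induction rule: ideal_prod.induct)
    case (prod i j)
    then obtain r t where i: "i = r * a + t * b" "r \<in> R" "t \<in> R" unfolding I by blast
    have j: "j * a \<in> R" "j * b \<in> R" using prod(2) abI unfolding inverse_ideal_def by simp_all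
    have "r * j * a \<in> R" "r * j * b \<in> R" "t * j * a \<in> R" "t * j * b \<in> R"
      using R_closed(4)[OF i(2) j(1)] R_closed(4)[OF i(2) j(2)]
        R_closed(4)[OF i(3) j(1)] R_closed(4)[OF i(3) j(2)] by (simp_all add: mult.assoc)
    moreover have "a * (r * j) + b * (t * j) = i \<otimes>\<^bsub>ambient\<^esub> j" by (simp add: i algebra_simps)
    ultimately show ?case by blast
  next
    case (sum z1 z2)
    then obtain x y x' y' where *: "x * a \<in> R" "x * b \<in> R" "y * a \<in> R" "y * b \<in> R"
      "x' * a \<in> R" "x' * b \<in> R" "y' * a \<in> R" "y' * b \<in> R"
      "a * x + b * y = z1" "a * x' + b * y' = z2" by blast
    have "(x + x') * a \<in> R" "(x + x') * b \<in> R" "(y + y') * a \<in> R" "(y + y') * b \<in> R"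
      using * by (simp_all add: distrib_right R_closed(3))
    moreover have "a * (x + x') + b * (y + y') = z1 \<oplus>\<^bsub>ambient\<^esub> z2"
      by (simp add: *(9,10)[symmetric] algebra_simps)
    ultimately show ?case by blast
  qed
  then show ?thesis using 1 by blast
qed

text \<open>
  In \<open>a x + b y = 1\<close> one of the two summands lies outside \<open>M\<close>; if it is \<open>a x\<close>, then
  \<open>(a x) b = a (x b)\<close> is a multiple of \<open>a\<close>.
\<close>

lemma Prufer_locally_comparable:
  assumes Pr: "graded_Prufer_domain \<Gamma> A R"
  shows locally_comparable
  unfolding locally_comparable_def
proof (intro allI impI ballI)
  fix M a b assume M: "homogeneous_prime \<Gamma> A R M" and ab: "a \<in> H" "b \<in> H"
  have hom: "\<exists>s\<in>H. s \<notin> M \<and> (\<exists>r\<in>R. s * a = b * r)"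
    if "a \<in> H" "b \<in> H" "s \<in> R" "r \<in> R" "s * a = b * r" "s \<notin> M" for a b s r
    using prime_ex_component[OF M that(3,6)] component_multiplier[OF that(1-5)] by blast
  obtain x y where xy: "x * a \<in> R" "x * b \<in> R" "y * a \<in> R" "y * b \<in> R" "a * x + b * y = 1"
    using Prufer_pair[OF Pr ab] by blast
  have "x * a \<notin> M \<or> y * b \<notin> M"
    using homogeneous_primeD(3,4)[OF M] xy(5) by (metis mult.commute)
  then show "\<exists>s\<in>H. s \<notin> M \<and> ((\<exists>r\<in>R. s * a = b * r) \<or> (\<exists>r\<in>R. s * b = a * r))"
  proof
    assume "x * a \<notin> M"
    moreover have "x * a * b = a * (x * b)" by simp
    ultimately show ?thesis using hom[OF ab(2,1) xy(1,2)] by blast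
  next
    assume "y * b \<notin> M"
    moreover have "y * b * a = b * (y * a)" by simp
    ultimately show ?thesis using hom[OF ab xy(4,3)] by blast
  qed
qed

lemma graded_ideal_principal:
  assumes a: "a \<in> H"
  shows "graded_ideal (PIdl\<^bsub>ring_on R\<^esub> a)"
  unfolding PIdl_ring_on
proof (rule graded_idealI)
  have aR: "a \<in> R" using a H_R by blast
  obtain \<alpha> where \<alpha>: "a \<in> part \<alpha>" using a H_iff by blast
  show "{r * a | r. r \<in> R} \<subseteq> R" using aR R_closed(4) by blast
  have "0 = 0 * a" by simp
  then show "0 \<in> {r * a | r. r \<in> R}" using R_closed(1) by blast
  show "x + y \<in> {r * a | r. r \<in> R}" if xy: "x \<in> {r * a | r. r \<in> R}" "y \<in> {r * a | r. r \<in> R}" for x y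
  proof -
    obtain r t where "x = r * a" "y = t * a" "r \<in> R" "t \<in> R" using xy by blast
    moreover from this have "x + y = (r + t) * a" by (simp add: distrib_right)
    ultimately show ?thesis using R_closed(3) by blast
  qed
  show "r * x \<in> {r * a | r. r \<in> R}" if rx: "r \<in> R" "x \<in> {r * a | r. r \<in> R}" for r x
  proof -
    obtain t where "x = t * a" "t \<in> R" using rx by blast
    moreover from this have "r * x = (r * t) * a" by simp
    ultimately show ?thesis using rx(1) R_closed(4) by blast
  qed
  show "hcomp x \<gamma> \<in> {r * a | r. r \<in> R}" if x: "x \<in> {r * a | r. r \<in> R}" for x \<gamma>
  proof -
    obtain r where r: "r \<in> R" "x = a * r" using x by (auto simp: mult.commute)
    have "hcomp x \<gamma> = hcomp r (\<gamma> - \<alpha>) * a" using hcomp_part_mult[OF \<alpha> r(1)] r(2) by simp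
    then show ?thesis using hcomp_R[OF r(1)] by blast
  qed
qed

lemma graded_ideal_Int: "graded_ideal I \<Longrightarrow> graded_ideal J \<Longrightarrow> graded_ideal (I \<inter> J)"
  using graded_idealD[of I] graded_idealD[of J] by (intro graded_idealI) auto

text \<open>
  With \<open>a x + b y = 1\<close> as above, \<open>(a) \<inter> (b)\<close> is generated by \<open>a b x\<close> and \<open>a b y\<close>. These need not
  be homogeneous, but their components also generate.
\<close>

lemma Prufer_finite_conductor:
  assumes Pr: "graded_Prufer_domain \<Gamma> A R"
  shows "g_finite_conductor_domain \<Gamma> A R"
  unfolding g_finite_conductor_domain_def
proof (intro ballI)
  fix a b assume ab: "a \<in> H" "b \<in> H"
  define J where "J = PIdl\<^bsub>ring_on R\<^esub> a \<inter> PIdl\<^bsub>ring_on R\<^esub> b"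
  have J: "graded_ideal J" unfolding J_def by (intro graded_ideal_Int graded_ideal_principal ab)
  obtain x y where xy: "x * a \<in> R" "x * b \<in> R" "y * a \<in> R" "y * b \<in> R" "a * x + b * y = 1"
    using Prufer_pair[OF Pr ab] by blast
  have aR: "a \<in> R" "b \<in> R" using ab H_R by blast+
  define p q where "p = (x * b) * a" and "q = (y * a) * b"
  have pq: "p \<in> R" "q \<in> R" using xy aR R_closed(4) by (auto simp: p_def q_def)
  have "p = (x * a) * b" "q = (y * b) * a" by (auto simp: p_def q_def)
  then have "p \<in> J" "q \<in> J" unfolding J_def PIdl_ring_on using xy p_def q_def by blast+
  then have "Idl\<^bsub>ring_on R\<^esub> {p, q} \<subseteq> J" using J by (intro Idl_subset) (auto simp: graded_ideal_def)
  moreover have "J \<subseteq> Idl\<^bsub>ring_on R\<^esub> {p, q}"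
  proof
    fix z assume "z \<in> J"
    then obtain r t where z: "z = r * a" "z = t * b" "r \<in> R" "t \<in> R"
      unfolding J_def PIdl_ring_on by blast
    have "z = z * (a * x + b * y)" using xy(5) by simp
    also have "\<dots> = (t * b) * (a * x) + (r * a) * (b * y)" using z by (simp add: distrib_left)
    also have "\<dots> = t * p + r * q" by (simp add: p_def q_def algebra_simps)
    finally show "z \<in> Idl\<^bsub>ring_on R\<^esub> {p, q}" unfolding Idl_pair[OF subring pq] using z by blast
  qed
  ultimately have "finitely_generated_ideal R J"
    unfolding finitely_generated_ideal_def using pq by (intro exI[of _ "{p, q}"]) auto
  then show "\<exists>U. finite U \<and> U \<subseteq> H \<and> PIdl\<^bsub>ring_on R\<^esub> a \<inter> PIdl\<^bsub>ring_on R\<^esub> b = Idl\<^bsub>ring_on R\<^esub> U"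
    using graded_ideal_finite_generators[OF J] unfolding J_def by blast
qed

lemma locally_comparable_least:
  assumes lc: locally_comparable and M: "homogeneous_prime \<Gamma> A R M"
    and E: "finite E" "E \<noteq> {}" "E \<subseteq> H"
  shows "\<exists>e\<in>E. \<exists>s\<in>H. s \<notin> M \<and> (\<forall>f\<in>E. \<exists>r\<in>R. s * f = e * r)"
  using E
proof (induction rule: finite_ne_induct)
  case (singleton f)
  then show ?case using H_one homogeneous_primeD(3)[OF M] R_closed(2)
    by (intro bexI[of _ f] bexI[of _ 1]) (auto intro!: bexI[of _ 1])
next
  case (insert f E)
  then obtain e s where es: "e \<in> E" "s \<in> H" "s \<notin> M" "\<And>g. g \<in> E \<Longrightarrow> \<exists>r\<in>R. s * g = e * r" by blast
  have "e \<in> H" "f \<in> H" using insert.prems es(1) by auto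
  then have "\<exists>t\<in>H. t \<notin> M \<and> ((\<exists>r\<in>R. t * f = e * r) \<or> (\<exists>r\<in>R. t * e = f * r))"
    using lc M unfolding locally_comparable_def by simp
  then obtain t where t: "t \<in> H" "t \<notin> M" "(\<exists>r\<in>R. t * f = e * r) \<or> (\<exists>r\<in>R. t * e = f * r)"
    by auto
  have R: "s \<in> R" "t \<in> R" using es(2) t(1) H_R by simp_all
  have st: "s * t \<in> H" "s * t \<notin> M"
    using es(2,3) t(1,2) H_mult homogeneous_primeD(6)[OF M R] by auto
  from t(3) show ?case
  proof
    assume "\<exists>r\<in>R. t * f = e * r"
    then obtain r where r: "r \<in> R" "t * f = e * r" by blast
    have "s * t * f = e * (s * r)" using r by (simp add: mult.assoc mult.left_commute)
    moreover have "\<exists>r\<in>R. s * t * g = e * r" if g: "g \<in> E" for g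
    proof -
      obtain r' where "r' \<in> R" "s * g = e * r'" using es(4)[OF g] by blast
      moreover from this have "s * t * g = e * (t * r')" by (metis mult.assoc mult.commute)
      ultimately show ?thesis using R R_closed(4) by blast
    qed
    ultimately have "\<forall>g\<in>insert f E. \<exists>r\<in>R. s * t * g = e * r" using R r R_closed(4) by blast
    then show ?thesis using st es(1) by blast
  next
    assume "\<exists>r\<in>R. t * e = f * r"
    then obtain r where r: "r \<in> R" "t * e = f * r" by blast
    have "\<exists>r\<in>R. s * t * g = f * r" if g: "g \<in> E" for g
    proof -
      obtain r' where r': "r' \<in> R" "s * g = e * r'" using es(4)[OF g] by blast
      have "s * t * g = t * (s * g)" by simp
      also have "\<dots> = t * e * r'" using r' by simp
      also have "\<dots> = f * (r * r')" using r by simp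
      finally show ?thesis using r r' R_closed(4) by blast
    qed
    moreover have "s * t * f = f * (s * t)" by simp
    ultimately have "\<forall>g\<in>insert f E. \<exists>r\<in>R. s * t * g = f * r" using R R_closed(4) by blast
    then show ?thesis using st by blast
  qed
qed

text \<open>
  At each homogeneous prime \<open>M\<close> some generator \<open>e\<close> of \<open>I\<close> divides the others up to a multiplier
  \<open>s \<notin> M\<close>. Then \<open>s / e\<close> lies in the inverse of \<open>I\<close>, so \<open>s\<close> lies in the product of \<open>I\<close> with its
  inverse, and this product is contained in no homogeneous prime.
\<close>

lemma Prufer_if_locally_comparable:
  assumes lc: locally_comparable
  shows "graded_Prufer_domain \<Gamma> A R"
  unfolding graded_Prufer_domain_def
proof (intro allI impI)
  fix I assume "homogeneous_ideal \<Gamma> A R I \<and> finitely_generated_ideal R I \<and> I \<noteq> {0}"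
  then have I: "graded_ideal I" "finitely_generated_ideal R I" "I \<noteq> {0}"
    unfolding homogeneous_ideal_iff by auto
  have id: "ideal I (ring_on R)" using I(1) unfolding graded_ideal_def by blast
  note I' = id[unfolded ideal_iff]
  obtain E where E: "finite E" "E \<subseteq> H" "I = Idl\<^bsub>ring_on R\<^esub> E"
    using graded_ideal_finite_generators[OF I(1,2)] by blast
  have ER: "E \<subseteq> R" using E(2) H_R by blast
  have EI: "E \<subseteq> I" using subset_Idl E(3) by blast
  have "E \<noteq> {}"
    using I(3) E(3) Idl_finite[OF subring ER E(1)] by auto
  define D where "D = ideal_prod ambient I (inverse_ideal R I)"
  have DR: "D \<subseteq> R"
  proof
    fix z assume "z \<in> D"
    then show "z \<in> R" unfolding D_def
    proof (induction rule: ideal_prod.induct)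
      case (prod i j)
      then show ?case by (auto simp: inverse_ideal_def mult.commute)
    qed (auto intro!: R_closed)
  qed
  have mult: "i * j \<in> D" if "i \<in> I" "j \<in> inverse_ideal R I" for i j
    unfolding D_def using ideal_prod.prod[OF that, of ambient] by simp
  have plus: "x + y \<in> D" if "x \<in> D" "y \<in> D" for x y
    using ideal_prod.sum[OF that[unfolded D_def]] unfolding D_def by simp
  have scale: "r * x \<in> D" if "r \<in> R" "x \<in> D" for r x
    using that(2) unfolding D_def
  proof (induction rule: ideal_prod.induct)
    case (prod i j)
    have "r * i \<in> I" using I' prod(1) that(1) by blast
    then show ?case using mult prod(2) unfolding D_def by (simp add: mult.assoc[symmetric])
  next
    case (sum x y)
    then show ?case using plus unfolding D_def by (simp add: distrib_left)
  qed
  have id0: "0 \<in> inverse_ideal R I"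
  proof -
    have "(0::'k) = 0 / 1" by simp
    then have "0 \<in> quotient_field R"
      using R_closed(1,2) unfolding quotient_field_def by fastforce
    then show ?thesis using R_closed(1) by (simp add: inverse_ideal_def)
  qed
  have "0 \<in> D" using mult[OF _ id0, of 0] I' by simp
  then have idD: "ideal D (ring_on R)" unfolding ideal_iff using DR plus scale by blast
  have "1 \<in> D"
  proof (rule one_mem_if_local[OF idD])
    fix M assume M: "homogeneous_prime \<Gamma> A R M"
    obtain e s where es: "e \<in> E" "s \<in> H" "s \<notin> M" and c: "\<And>f. f \<in> E \<Longrightarrow> \<exists>r\<in>R. s * f = e * r"
      using locally_comparable_least[OF lc M E(1) \<open>E \<noteq> {}\<close> E(2)] by blast
    have e: "e \<noteq> 0" "e \<in> R" using es E(2) H_iff ER by blast+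
    have "s \<in> R" using es H_R by blast
    define K where "K = {i \<in> R. s / e * i \<in> R}"
    have "ideal K (ring_on R)"
      unfolding ideal_iff K_def
    proof (intro conjI ballI)
      fix x y assume "x \<in> {i \<in> R. s / e * i \<in> R}" "y \<in> {i \<in> R. s / e * i \<in> R}"
      then show "x + y \<in> {i \<in> R. s / e * i \<in> R}"
        using R_closed(3)[of "s / e * x" "s / e * y"] R_closed(3) by (simp add: distrib_left add_divide_distrib)
    next
      fix r x assume "r \<in> R" "x \<in> {i \<in> R. s / e * i \<in> R}"
      moreover have "s / e * (r * x) = r * (s / e * x)" by simp
      ultimately show "r * x \<in> {i \<in> R. s / e * i \<in> R}"
        using R_closed(4) by (metis (mono_tags, lifting) mem_Collect_eq)
    qed (use R_closed(1) in auto)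
    moreover have "E \<subseteq> K"
    proof
      fix f assume f: "f \<in> E"
      obtain r where "r \<in> R" "s * f = e * r" using c[OF f] by blast
      then have "s / e * f = r" using e by (simp add: field_simps)
      then show "f \<in> K" using \<open>r \<in> R\<close> f ER unfolding K_def by blast
    qed
    ultimately have "I \<subseteq> K" unfolding E(3) by (rule Idl_subset)
    moreover have "s / e \<in> quotient_field R"
      unfolding quotient_field_def using \<open>s \<in> R\<close> e by blast
    ultimately have "s / e \<in> inverse_ideal R I" unfolding inverse_ideal_def K_def by blast
    then have "e * (s / e) \<in> D" using mult es(1) EI by blast
    then have "s \<in> D" using e by simp
    then show "\<exists>s\<in>H. s \<in> D \<and> s \<notin> M" using es by blast
  qed
  then have "D = R" using DR idD[unfolded ideal_iff] by fastforce
  then show "invertible_ideal R I" unfolding invertible_ideal_def D_def .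
qed

lemma prime_power_mem:
  assumes "homogeneous_prime \<Gamma> A R M" "x \<in> R" "x ^ n \<in> M"
  shows "x \<in> M"
  using assms(3)
proof (induction n)
  case 0
  then show ?case using homogeneous_primeD(3)[OF assms(1)] by simp
next
  case (Suc n)
  then show ?case using homogeneous_primeD(6)[OF assms(1,2) R_power[OF assms(2), of n]] by auto
qed

text \<open>
  Locally at \<open>M\<close>, write \<open>x = f / h\<close> and let \<open>e\<close> divide \<open>h\<close> and all components of \<open>f\<close> up to
  \<open>s \<notin> M\<close>, so that \<open>F = s f / e\<close> and \<open>r = s h / e\<close> lie in \<open>R\<close> and \<open>x = F / r\<close>. If \<open>r\<close> were in
  \<open>M\<close>, the integral equation would put \<open>F\<close> into \<open>M\<close>; but \<open>s\<close> occurs among \<open>r\<close> and the components of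
  \<open>F\<close>, because \<open>e\<close> is \<open>h\<close> or a component of \<open>f\<close>. Hence \<open>r\<close> is a denominator of \<open>x\<close> outside \<open>M\<close>.
\<close>

lemma integral_homogeneous_denominator:
  assumes lc: locally_comparable and x: "h \<in> H" "h * x \<in> R" and int: "integral_over R x"
  shows "x \<in> R"
proof -
  define f where "f = h * x"
  have f: "f \<in> R" using x by (simp add: f_def)
  have h: "h \<noteq> 0" "h \<in> R" using x H_iff H_R by blast+
  obtain p where p: "Polynomial.lead_coeff p = 1" "\<And>i. Polynomial.coeff p i \<in> R" "poly p x = 0"
    using int unfolding integral_over_def by blast
  define U where "U = {r \<in> R. r * x \<in> R}"
  have "ideal U (ring_on R)"
    unfolding ideal_iff U_def using R_closed by (auto simp: distrib_right mult.assoc)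
  then have "1 \<in> U"
  proof (rule one_mem_if_local)
    fix M assume M: "homogeneous_prime \<Gamma> A R M"
    define E where "E = insert h (hcomp f ` {\<gamma>. hcomp f \<gamma> \<noteq> 0})"
    have E: "finite E" "E \<noteq> {}" "E \<subseteq> H" using finite_supp hcomp_H x(1) f by (auto simp: E_def)
    have "\<exists>e\<in>E. \<exists>s\<in>H. s \<notin> M \<and> (\<forall>g\<in>E. \<exists>r\<in>R. s * g = e * r)"
      by (rule locally_comparable_least[OF lc M E])
    then obtain e s where es: "e \<in> E" "s \<in> H" "s \<notin> M" and c: "\<And>g. g \<in> E \<Longrightarrow> \<exists>r\<in>R. s * g = e * r"
      by (elim bexE conjE) simp
    have eH: "e \<in> H" using es(1) E(3) by (rule subsetD[rotated])
    then have eR: "e \<in> R" "e \<noteq> 0" "e \<in> H" using H_R H_iff by simp_all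
    obtain r where r: "r \<in> R" "s * h = e * r" using c[of h] by (auto simp: E_def)
    define F where "F = s / e * f"
    have "F = (\<Sum>\<gamma>\<in>{\<gamma>. hcomp f \<gamma> \<noteq> 0}. s / e * hcomp f \<gamma>)"
      unfolding F_def sum_distrib_left[symmetric] sum_hcomp[OF f] ..
    moreover have "s / e * hcomp f \<gamma> \<in> R" if "hcomp f \<gamma> \<noteq> 0" for \<gamma>
    proof -
      have "hcomp f \<gamma> \<in> E" using that by (auto simp: E_def)
      then obtain r' where "r' \<in> R" "s * hcomp f \<gamma> = e * r'" using c by blast
      then show ?thesis using eR by simp
    qed
    ultimately have F: "F \<in> R" by (auto intro: R_sum)
    have rx: "r * x = F" using r(2) eR h by (simp add: F_def f_def field_simps)
    obtain \<epsilon> where "e \<in> part \<epsilon>" using eR(3) H_iff by blast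
    moreover obtain \<sigma> where "s \<in> part \<sigma>" using es(2) H_iff by blast
    moreover obtain \<eta> where "h \<in> part \<eta>" using x(1) H_iff by blast
    ultimately have deg: "e \<in> part \<epsilon>" "s \<in> part \<sigma>" "h \<in> part \<eta>" .
    have "e * r \<in> part (\<sigma> + \<eta>)" using part_mult[OF deg(2,3)] r(2) by simp
    then have "r \<in> part (\<sigma> + \<eta> - \<epsilon>)" by (rule part_cancel[OF deg(1) eR(2) r(1)])
    moreover have "s \<noteq> 0" using es(2) H_iff by blast
    then have "r \<noteq> 0" using r(2) h(1) by auto
    ultimately have rH: "r \<in> H" unfolding H_iff by blast
    have "r \<notin> M"
    proof
      assume rM: "r \<in> M"
      define n where "n = degree p"
      have "0 = r ^ n * poly p x" using p(3) by simp
      also have "\<dots> = (\<Sum>i\<le>n. Polynomial.coeff p i * (r ^ (n - i) * F ^ i))"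
        unfolding poly_altdef n_def sum_distrib_left rx[symmetric]
      proof (rule sum.cong[OF refl])
        fix i assume "i \<in> {..degree p}"
        then have "r ^ degree p = r ^ (degree p - i) * r ^ i" by (simp flip: power_add)
        then show "r ^ degree p * (Polynomial.coeff p i * x ^ i) =
            Polynomial.coeff p i * (r ^ (degree p - i) * (r * x) ^ i)"
          by (simp add: power_mult_distrib)
      qed
      also have "\<dots> = (\<Sum>i<n. Polynomial.coeff p i * (r ^ (n - i) * F ^ i)) + F ^ n"
        using p(1) by (simp add: n_def flip: lessThan_Suc_atMost)
      finally have "F ^ n = (- 1) * (\<Sum>i<n. Polynomial.coeff p i * (r ^ (n - i) * F ^ i))"
        by (simp add: eq_neg_iff_add_eq_0 add.commute)
      moreover have "(\<Sum>i<n. Polynomial.coeff p i * (r ^ (n - i) * F ^ i)) \<in> M"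
      proof (rule ideal_sum)
        show "ideal M (ring_on R)" using M unfolding homogeneous_prime_iff graded_ideal_def by simp
        fix i assume "i \<in> {..<n}"
        then have "n - i = Suc (n - i - 1)" by simp
        then have "r ^ (n - i) = r ^ (n - i - 1) * r" by (metis power_Suc2)
        then have "Polynomial.coeff p i * (r ^ (n - i) * F ^ i) =
            (Polynomial.coeff p i * r ^ (n - i - 1) * F ^ i) * r" (is "_ = ?c * r") by simp
        moreover have "?c \<in> R" using p(2) R_power[OF F] R_power[OF r(1)] R_closed(4) by simp
        ultimately show "Polynomial.coeff p i * (r ^ (n - i) * F ^ i) \<in> M"
          using homogeneous_primeD(5)[OF M _ rM] by (simp only:)
      qed
      ultimately have "F ^ n \<in> M" using homogeneous_primeD(5)[OF M R_closed(5)[OF R_closed(2)]] by simp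
      then have FM: "F \<in> M" by (rule prime_power_mem[OF M F])
      have "s \<in> M"
      proof (cases "e = h")
        case True
        then show ?thesis using r(2) rM h by simp
      next
        case False
        then obtain \<gamma> where \<gamma>: "e = hcomp f \<gamma>" "hcomp f \<gamma> \<noteq> 0" using es(1) by (auto simp: E_def)
        then have e': "e \<in> part \<gamma>" using hcomp_part[OF f] by simp
        have "e * F = s * f" using eR by (simp add: F_def)
        then have "e * hcomp F \<sigma> = s * hcomp f \<gamma>"
          using hcomp_part_mult[OF e' F, of "\<gamma> + \<sigma>"] hcomp_part_mult[OF deg(2) f, of "\<gamma> + \<sigma>"] by simp
        then have "hcomp F \<sigma> = s" using \<gamma> by simp
        then show ?thesis using homogeneous_primeD(7)[OF M FM, of \<sigma>] by simp
      qed
      then show False using es by blast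
    qed
    moreover have "r \<in> U" using r(1) rx F by (simp add: U_def)
    ultimately show "\<exists>s\<in>H. s \<in> U \<and> s \<notin> M" using rH by blast
  qed
  then show ?thesis by (simp add: U_def)
qed

end

section \<open>Integral elements have homogeneous denominators\<close>

lemma to_fract_power: "to_fract (a ^ n) = to_fract a ^ n"
  by (induction n) simp_all

text \<open>
  The powers of an integral element \<open>z\<close> have a common denominator, and division with remainder
  then shows that \<open>z\<close> is a polynomial.
\<close>

lemma fract_poly_integrally_closed:
  fixes z :: "'k::field poly fract"
  assumes monic: "lead_coeff p = 1" and coeffs: "\<And>i. Polynomial.coeff p i \<in> range to_fract"
    and root: "poly p z = 0"
  shows "z \<in> range to_fract"
proof -
  define P where "P = range (to_fract :: 'k poly \<Rightarrow> _)"
  have P_add: "u + v \<in> P" and P_mult: "u * v \<in> P" and P_diff: "u - v \<in> P"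
    if uv: "u \<in> P" "v \<in> P" for u v
  proof -
    obtain a b where "u = to_fract a" "v = to_fract b" using uv unfolding P_def by blast
    then have "u + v = to_fract (a + b)" "u * v = to_fract (a * b)" "u - v = to_fract (a - b)" by simp_all
    then show "u + v \<in> P" "u * v \<in> P" "u - v \<in> P" unfolding P_def by blast+
  qed
  have P_0: "0 \<in> P" unfolding P_def by (metis rangeI to_fract_0)
  have P_1: "1 \<in> P" unfolding P_def by (metis rangeI to_fract_1)
  have P_power: "u ^ n \<in> P" if "u \<in> P" for u n using that by (induction n) (auto intro: P_1 P_mult)
  have P_sum: "sum f F \<in> P" if "\<And>i. i \<in> F \<Longrightarrow> f i \<in> P" for F :: "nat set" and f
    using that by (induction F rule: infinite_finite_induct) (auto intro: P_0 P_add)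
  have P_iff: "to_fract a \<in> P" for a unfolding P_def by blast
  obtain a b where ab: "z = to_fract a / to_fract b" "b \<noteq> 0"
    by (cases z) (auto simp: Fract_conv_to_fract)
  define n where "n = degree p"
  have bnd: "to_fract b ^ n * z ^ m \<in> P" for m
  proof (induction m rule: less_induct)
    case (less m)
    show ?case
    proof (cases "m \<le> n")
      case True
      have "to_fract b ^ n = to_fract b ^ (n - m) * to_fract b ^ m" using True by (simp flip: power_add)
      then have "to_fract b ^ n * z ^ m = to_fract b ^ (n - m) * to_fract a ^ m"
        using ab by (simp add: power_divide)
      then show ?thesis using P_iff P_power P_mult by simp
    next
      case False
      have "(\<Sum>i<n. Polynomial.coeff p i * z ^ i) + z ^ n = 0"
        using root monic unfolding poly_altdef n_def by (simp flip: lessThan_Suc_atMost)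
      then have "z ^ n = 0 - (\<Sum>i<n. Polynomial.coeff p i * z ^ i)"
        by (metis add_diff_cancel_left')
      moreover have "z ^ m = z ^ (m - n) * z ^ n" using False by (simp flip: power_add)
      ultimately have eq: "to_fract b ^ n * z ^ m =
          0 - (\<Sum>i<n. Polynomial.coeff p i * (to_fract b ^ n * z ^ (m - n + i)))"
        by (simp add: sum_distrib_left power_add algebra_simps)
      moreover have "to_fract b ^ n * z ^ (m - n + i) \<in> P" if "i < n" for i
        using less.IH[of "m - n + i"] that False by simp
      moreover have "Polynomial.coeff p i \<in> P" for i using coeffs by (simp add: P_def)
      ultimately have "Polynomial.coeff p i * (to_fract b ^ n * z ^ (m - n + i)) \<in> P" if "i < n" for i
        using P_mult that by blast
      then have "0 - (\<Sum>i<n. Polynomial.coeff p i * (to_fract b ^ n * z ^ (m - n + i))) \<in> P"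
        by (intro P_diff P_0 P_sum) simp
      then show ?thesis using eq by simp
    qed
  qed
  (* The polynomials that multiply all powers of z into the polynomial ring form an ideal; a generator
     of it, found here as an element of least degree, shows that z itself is a polynomial. *)
  define D where "D d \<longleftrightarrow> d \<noteq> 0 \<and> (\<forall>m. to_fract d * z ^ m \<in> P)" for d
  have "D (b ^ n)"
    using bnd ab(2) by (simp add: D_def to_fract_power)
  then obtain d where d: "D d" and min: "\<And>e. D e \<Longrightarrow> degree d \<le> degree e"
    using ex_has_least_nat[of D "b ^ n" degree] by blast
  then have d0: "d \<noteq> 0" and dz: "\<And>m. to_fract d * z ^ m \<in> P" by (auto simp: D_def)
  obtain e where e: "to_fract d * z = to_fract e" using dz[of 1] unfolding P_def by auto
  define q r where "q = e div d" and "r = e mod d"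
  have qr: "r = e - q * d" by (simp add: q_def r_def minus_div_mult_eq_mod)
  have "to_fract r * z ^ m \<in> P" for m
  proof -
    have "to_fract r * z ^ m = to_fract d * z ^ Suc m - to_fract q * (to_fract d * z ^ m)"
      unfolding qr using e by (simp add: algebra_simps)
    also have "\<dots> \<in> P" by (rule P_diff[OF dz P_mult[OF P_iff dz]])
    finally show ?thesis .
  qed
  then have "r \<noteq> 0 \<Longrightarrow> degree d \<le> degree r" using min[of r] by (simp add: D_def)
  moreover have "r = 0 \<or> degree r < degree d" unfolding r_def by (rule degree_mod_less[OF d0])
  ultimately have "r = 0" by linarith
  then have "to_fract d * z = to_fract d * to_fract q" using e qr by (simp add: mult.commute)
  then show ?thesis using d0 by simp
qed

text \<open>
  Long division by \<open>g\<close> introduces no denominators except powers of the leading coefficient of \<open>g\<close>.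
\<close>

lemma leading_coeff_clears_quotient:
  fixes g y :: "'k::field poly"
  assumes R: "subring R ambient" and g: "\<And>i. Polynomial.coeff g i \<in> R"
    and gy: "\<And>i. Polynomial.coeff (g * y) i \<in> R"
  shows "\<exists>m. \<forall>i. lead_coeff g ^ m * Polynomial.coeff y i \<in> R"
  using gy
proof (induction "degree y" arbitrary: y rule: less_induct)
  case less
  define c where "c = lead_coeff g"
  have lead: "c * lead_coeff y \<in> R"
    using less.prems[of "degree g + degree y"] by (simp add: c_def coeff_mult_degree_sum)
  have c: "c \<in> R" using g by (simp add: c_def)
  have cp: "c ^ m \<in> R" for m using c by (induction m) (auto intro!: subringD[OF R])
  show ?case
  proof (cases "degree y = 0")
    case True
    then have "c ^ 1 * Polynomial.coeff y i \<in> R" for i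
      using lead by (cases "i = 0") (auto simp: coeff_eq_0 intro: subringD[OF R])
    then show ?thesis unfolding c_def by blast
  next
    case False
    define y1 where "y1 = Polynomial.smult c (y - Polynomial.monom (lead_coeff y) (degree y))"
    have cy1: "Polynomial.coeff y1 i = (if i = degree y then 0 else c * Polynomial.coeff y i)" for i
      by (simp add: y1_def coeff_monom)
    have "degree y1 < degree y"
    proof (rule degree_lessI)
      show "y1 \<noteq> 0 \<or> degree y > 0" using False by simp
      show "\<forall>k\<ge>degree y. Polynomial.coeff y1 k = 0" by (simp add: cy1 coeff_eq_0)
    qed
    moreover have "Polynomial.coeff (g * y1) i \<in> R" for i
    proof -
      have "g * y1 = Polynomial.smult c (g * y) - g * Polynomial.monom (c * lead_coeff y) (degree y)"
        by (simp add: y1_def algebra_simps smult_monom[symmetric] del: smult_monom flip: smult_diff_right)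
      moreover have "Polynomial.coeff (g * Polynomial.monom (c * lead_coeff y) (degree y)) i \<in> R"
        using g lead subringD(1)[OF R]
        by (intro coeffs_in_mult[OF R]) (auto simp: coeff_monom)
      ultimately show ?thesis using less.prems c by (auto intro!: subringD(4,6)[OF R])
    qed
    ultimately obtain m where m: "\<And>i. c ^ m * Polynomial.coeff y1 i \<in> R"
      using less.hyps unfolding c_def by blast
    have "c ^ Suc m * Polynomial.coeff y i \<in> R" for i
    proof (cases "i = degree y")
      case True
      have "c ^ m * (c * lead_coeff y) \<in> R" by (rule subringD(4)[OF R cp lead])
      then show ?thesis using True by (simp add: algebra_simps)
    next
      case False
      then show ?thesis using m[of i] by (simp add: cy1 algebra_simps)
    qed
    then show ?thesis unfolding c_def by blast
  qed
qed

lemma coeff_sum_monom_inj: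
  assumes "finite S" "inj_on k S" "Polynomial.coeff (\<Sum>\<gamma>\<in>S. Polynomial.monom (c \<gamma>) (k \<gamma>)) j \<noteq> 0"
  shows "\<exists>\<gamma>\<in>S. Polynomial.coeff (\<Sum>\<gamma>\<in>S. Polynomial.monom (c \<gamma>) (k \<gamma>)) j = c \<gamma>"
proof -
  have eq: "Polynomial.coeff (\<Sum>\<gamma>\<in>S. Polynomial.monom (c \<gamma>) (k \<gamma>)) j
      = (\<Sum>\<gamma>\<in>S. if k \<gamma> = j then c \<gamma> else 0)"
    by (simp add: coeff_sum coeff_monom)
  have "\<exists>\<gamma>\<in>S. k \<gamma> = j"
  proof (rule ccontr)
    assume "\<not> (\<exists>\<gamma>\<in>S. k \<gamma> = j)"
    then have "(\<Sum>\<gamma>\<in>S. if k \<gamma> = j then c \<gamma> else 0) = 0" by (intro sum.neutral) auto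
    then show False using assms(3) eq by simp
  qed
  then obtain \<delta> where \<delta>: "\<delta> \<in> S" "k \<delta> = j" by (rule bexE)
  have "(\<Sum>\<gamma>\<in>S. if k \<gamma> = j then c \<gamma> else 0) = (\<Sum>\<gamma>\<in>S. if \<gamma> = \<delta> then c \<gamma> else 0)"
    using \<delta> assms(2) by (intro sum.cong) (auto dest: inj_onD)
  then show ?thesis unfolding eq using \<delta>(1) assms(1) by auto
qed

context graded_domain
begin

text \<open>
  The map \<open>r\<^sub>\<gamma> \<mapsto> r\<^sub>\<gamma> T\<^bsup>\<phi> \<gamma>\<^esup>\<close> into the field of rational functions. It is multiplicative on elements
  whose degrees have integral values under \<open>\<phi>\<close>; rounding down is harmless there and only serves to
  turn the rational number \<open>\<phi> \<gamma>\<close> into an exponent.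
\<close>

definition laurent :: "('g \<Rightarrow> rat) \<Rightarrow> 'k \<Rightarrow> 'k poly fract" where
  "laurent \<phi> s = (\<Sum>\<gamma>\<in>{\<gamma>. hcomp s \<gamma> \<noteq> 0}. to_fract [:hcomp s \<gamma>:] * to_fract [:0, 1:] powi \<lfloor>\<phi> \<gamma>\<rfloor>)"

text \<open>
  The polynomial \<open>T\<^sup>L * laurent \<phi> s\<close>, for \<open>L\<close> large enough to remove the negative exponents.
\<close>

definition laurent_shift :: "('g \<Rightarrow> rat) \<Rightarrow> nat \<Rightarrow> 'k \<Rightarrow> 'k poly" where
  "laurent_shift \<phi> L s = (\<Sum>\<gamma>\<in>{\<gamma>. hcomp s \<gamma> \<noteq> 0}. Polynomial.monom (hcomp s \<gamma>) (nat (\<lfloor>\<phi> \<gamma>\<rfloor> + int L)))"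

lemma laurent_superset:
  assumes "finite F" "{\<gamma>. hcomp s \<gamma> \<noteq> 0} \<subseteq> F"
  shows "laurent \<phi> s = (\<Sum>\<gamma>\<in>F. to_fract [:hcomp s \<gamma>:] * to_fract [:0, 1:] powi \<lfloor>\<phi> \<gamma>\<rfloor>)"
  unfolding laurent_def using assms by (intro sum.mono_neutral_left) auto

lemma laurent_add:
  assumes "s \<in> R" "t \<in> R"
  shows "laurent \<phi> (s + t) = laurent \<phi> s + laurent \<phi> t"
proof -
  define F where "F = {\<gamma>. hcomp s \<gamma> \<noteq> 0} \<union> {\<gamma>. hcomp t \<gamma> \<noteq> 0}"
  have F: "finite F" using finite_supp assms by (simp add: F_def)
  have "to_fract [:hcomp (s + t) \<gamma>:] = to_fract [:hcomp s \<gamma>:] + to_fract [:hcomp t \<gamma>:]" for \<gamma>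
    unfolding hcomp_add[OF assms] by (simp flip: to_fract_add)
  moreover have "{\<gamma>. hcomp (s + t) \<gamma> \<noteq> 0} \<subseteq> F" by (auto simp: F_def hcomp_add[OF assms])
  ultimately show ?thesis
    using laurent_superset[OF F, of "s + t" \<phi>] laurent_superset[OF F, of s \<phi>] laurent_superset[OF F, of t \<phi>]
    by (simp add: F_def distrib_right sum.distrib)
qed

lemma laurent_0: "laurent \<phi> 0 = 0"
  by (simp add: laurent_def)

lemma laurent_sum: "(\<And>i. i \<in> F \<Longrightarrow> f i \<in> R) \<Longrightarrow> laurent \<phi> (sum f F) = (\<Sum>i\<in>F. laurent \<phi> (f i))"
  by (induction F rule: infinite_finite_induct) (auto simp: laurent_add laurent_0 R_sum)

lemma laurent_part:
  assumes "a \<in> part \<alpha>"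
  shows "laurent \<phi> a = to_fract [:a:] * to_fract [:0, 1:] powi \<lfloor>\<phi> \<alpha>\<rfloor>"
proof -
  have "{\<gamma>. hcomp a \<gamma> \<noteq> 0} \<subseteq> {\<alpha>}" using hcomp_part_eq[OF assms] by auto
  then show ?thesis using laurent_superset[of "{\<alpha>}" a \<phi>] hcomp_part_eq[OF assms] by simp
qed

lemma laurent_mult:
  assumes \<phi>: "additive \<phi>" and s: "s \<in> R" "\<And>\<gamma>. hcomp s \<gamma> \<noteq> 0 \<Longrightarrow> \<phi> \<gamma> \<in> \<int>" and t: "t \<in> R"
  shows "laurent \<phi> (s * t) = laurent \<phi> s * laurent \<phi> t"
proof -
  let ?S = "{\<gamma>. hcomp s \<gamma> \<noteq> 0}" and ?T = "{\<gamma>. hcomp t \<gamma> \<noteq> 0}"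
  have "s * t = (\<Sum>\<alpha>\<in>?S. \<Sum>\<beta>\<in>?T. hcomp s \<alpha> * hcomp t \<beta>)"
    using sum_hcomp[OF s(1)] sum_hcomp[OF t] by (metis sum_product)
  then have "laurent \<phi> (s * t) = (\<Sum>\<alpha>\<in>?S. \<Sum>\<beta>\<in>?T. laurent \<phi> (hcomp s \<alpha> * hcomp t \<beta>))"
    using s(1) t by (simp add: laurent_sum R_sum R_closed(4) hcomp_R)
  also have "\<dots> = (\<Sum>\<alpha>\<in>?S. \<Sum>\<beta>\<in>?T. (to_fract [:hcomp s \<alpha>:] * to_fract [:0, 1:] powi \<lfloor>\<phi> \<alpha>\<rfloor>) *
      (to_fract [:hcomp t \<beta>:] * to_fract [:0, 1:] powi \<lfloor>\<phi> \<beta>\<rfloor>))"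
  proof (intro sum.cong refl)
    fix \<alpha> \<beta> assume "\<alpha> \<in> ?S"
    then obtain k where k: "\<phi> \<alpha> = of_int k" using s(2) by (auto elim: Ints_cases)
    have "\<lfloor>\<phi> (\<alpha> + \<beta>)\<rfloor> = \<lfloor>\<phi> \<alpha>\<rfloor> + \<lfloor>\<phi> \<beta>\<rfloor>" by (simp add: additive.add[OF \<phi>] k)
    moreover have "to_fract [:0, 1 :: 'k:] \<noteq> 0" by simp
    moreover have "to_fract [:hcomp s \<alpha> * hcomp t \<beta>:] = to_fract [:hcomp s \<alpha>:] * to_fract [:hcomp t \<beta>:]"
      by (simp flip: to_fract_mult)
    ultimately show "laurent \<phi> (hcomp s \<alpha> * hcomp t \<beta>) =
        (to_fract [:hcomp s \<alpha>:] * to_fract [:0, 1:] powi \<lfloor>\<phi> \<alpha>\<rfloor>) *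
        (to_fract [:hcomp t \<beta>:] * to_fract [:0, 1:] powi \<lfloor>\<phi> \<beta>\<rfloor>)"
      unfolding laurent_part[OF part_mult[OF hcomp_part[OF s(1)] hcomp_part[OF t]]]
      by (simp add: power_int_add)
  qed
  also have "\<dots> = laurent \<phi> s * laurent \<phi> t" unfolding laurent_def sum_product ..
  finally show ?thesis .
qed

lemma laurent_one:
  assumes "additive \<phi>"
  shows "laurent \<phi> 1 = 1"
  using laurent_part[OF one_part, of \<phi>] additive.zero[OF assms] by (simp flip: one_pCons)

lemma laurent_power_mult:
  assumes \<phi>: "additive \<phi>" and s: "s \<in> R" "\<And>\<gamma>. hcomp s \<gamma> \<noteq> 0 \<Longrightarrow> \<phi> \<gamma> \<in> \<int>" and t: "t \<in> R"
  shows "laurent \<phi> (s ^ n * t) = laurent \<phi> s ^ n * laurent \<phi> t"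
proof (induction n)
  case (Suc n)
  have "laurent \<phi> (s ^ Suc n * t) = laurent \<phi> (s * (s ^ n * t))" by (simp add: mult.assoc)
  then show ?case using Suc laurent_mult[OF \<phi> s] R_power[OF s(1)] t R_closed(4) by simp
qed simp

lemma laurent_eq_shift:
  assumes "\<And>\<gamma>. hcomp s \<gamma> \<noteq> 0 \<Longrightarrow> \<lfloor>\<phi> \<gamma>\<rfloor> + int L \<ge> 0"
  shows "laurent \<phi> s * to_fract [:0, 1:] ^ L = to_fract (laurent_shift \<phi> L s)"
proof -
  have sum: "to_fract (sum f F) = (\<Sum>i\<in>F. to_fract (f i))" for f :: "'g \<Rightarrow> 'k poly" and F
    by (induction F rule: infinite_finite_induct) auto
  have "to_fract [:c:] * to_fract [:0, 1:] powi k * to_fract [:0, 1:] ^ L =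
      to_fract (Polynomial.monom c (nat (k + int L)))" if "k + int L \<ge> 0" for c :: 'k and k
  proof -
    have "to_fract [:0, 1 :: 'k:] powi k * to_fract [:0, 1:] ^ L = to_fract [:0, 1:] powi (k + int L)"
      by (simp add: power_int_add)
    also have "\<dots> = to_fract ([:0, 1:] ^ nat (k + int L))" using that by (simp add: power_int_def to_fract_power)
    finally show ?thesis by (simp add: monom_altdef mult.assoc flip: to_fract_mult)
  qed
  then show ?thesis
    unfolding laurent_def laurent_shift_def sum sum_distrib_right using assms by (intro sum.cong) auto
qed

lemma poly_laurent_shift_1: "s \<in> R \<Longrightarrow> poly (laurent_shift \<phi> L s) 1 = s"
  using sum_hcomp by (simp add: laurent_shift_def poly_sum poly_monom)

lemma coeff_laurent_shift: "s \<in> R \<Longrightarrow> Polynomial.coeff (laurent_shift \<phi> L s) i \<in> R"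
  unfolding laurent_shift_def coeff_sum using hcomp_R R_closed(1) by (intro R_sum) (auto simp: coeff_monom)

text \<open>
  Write \<open>x = f / g\<close> and choose \<open>\<phi>\<close> integral and injective on the finitely many degrees that occur in
  \<open>f\<close>, \<open>g\<close> and an integral equation of \<open>x\<close>. The quotient of the images of \<open>f\<close> and \<open>g\<close> satisfies the
  image of this equation, so up to a power of \<open>T\<close> it is a polynomial \<open>y\<close>, with \<open>x = y(1)\<close>. Its
  coefficients are fractions over \<open>R\<close> whose denominator is a power of the leading coefficient of the
  image of \<open>g\<close>. As \<open>\<phi>\<close> separates the degrees of \<open>g\<close>, that leading coefficient is a homogeneous
  component of \<open>g\<close>.
\<close>

lemma integral_has_homogeneous_denominator:
  assumes x: "x \<in> quotient_field R" and int: "integral_over R x"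
  shows "\<exists>h\<in>H. h * x \<in> R"
proof -
  obtain f g where fg: "x = f / g" "f \<in> R" "g \<in> R" "g \<noteq> 0" using x unfolding quotient_field_def by blast
  obtain p where p: "Polynomial.lead_coeff p = 1" "\<And>i. Polynomial.coeff p i \<in> R" "poly p x = 0"
    using int unfolding integral_over_def by blast
  define n where "n = degree p"
  define c where "c = Polynomial.coeff p"
  have c: "c i \<in> R" for i using p(2) by (simp add: c_def)
  define E where "E = {\<gamma>. hcomp f \<gamma> \<noteq> 0} \<union> {\<gamma>. hcomp g \<gamma> \<noteq> 0} \<union> (\<Union>i\<le>n. {\<gamma>. hcomp (c i) \<gamma> \<noteq> 0})"
  have "finite E" "E \<subseteq> \<Gamma>" using finite_supp supp_subset fg c unfolding E_def by auto
  then obtain \<phi> :: "'g \<Rightarrow> rat" where \<phi>: "additive \<phi>" "inj_on \<phi> E" "\<And>e. e \<in> E \<Longrightarrow> \<phi> e \<in> \<int>"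
    using separating_degree_function[of E] by blast
  define L where "L = (\<Sum>e\<in>E. nat \<bar>\<lfloor>\<phi> e\<rfloor>\<bar>)"
  have L: "\<lfloor>\<phi> e\<rfloor> + int L \<ge> 0" if "e \<in> E" for e
  proof -
    have "nat \<bar>\<lfloor>\<phi> e\<rfloor>\<bar> \<le> L"
      unfolding L_def using that \<open>finite E\<close> by (intro member_le_sum) auto
    then show ?thesis by linarith
  qed
  let ?l = "laurent \<phi>" and ?T = "to_fract [:0, 1 :: 'k:]"
  have intg: "\<phi> \<gamma> \<in> \<int>" if "hcomp g \<gamma> \<noteq> 0" for \<gamma> using that \<phi>(3) by (simp add: E_def)
  have intf: "\<phi> \<gamma> \<in> \<int>" if "hcomp f \<gamma> \<noteq> 0" for \<gamma> using that \<phi>(3) by (simp add: E_def)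
  have intc: "\<phi> \<gamma> \<in> \<int>" if "hcomp (c i) \<gamma> \<noteq> 0" "i \<le> n" for i \<gamma> using that \<phi>(3) by (auto simp: E_def)
  define G where "G = laurent_shift \<phi> L g"
  have lg: "?l g * ?T ^ L = to_fract G"
    unfolding G_def by (rule laurent_eq_shift) (use L in \<open>auto simp: E_def\<close>)
  have "G \<noteq> 0"
    using poly_laurent_shift_1[OF fg(3), of \<phi> L] fg(4) unfolding G_def by auto
  then have lg0: "?l g \<noteq> 0" using lg by auto
  have "0 = g ^ n * poly p x" using p(3) by simp
  also have "\<dots> = (\<Sum>i\<le>n. c i * (f ^ i * (g ^ (n - i) * 1)))"
    unfolding poly_altdef n_def c_def sum_distrib_left
  proof (rule sum.cong[OF refl])
    fix i assume "i \<in> {..degree p}"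
    then have "g ^ degree p = g ^ (degree p - i) * g ^ i" by (simp flip: power_add)
    then show "g ^ degree p * (Polynomial.coeff p i * x ^ i) =
        Polynomial.coeff p i * (f ^ i * (g ^ (degree p - i) * 1))"
      using fg by (simp add: power_divide)
  qed
  finally have "0 = ?l (\<Sum>i\<le>n. c i * (f ^ i * (g ^ (n - i) * 1)))" by (simp add: laurent_0)
  also have "\<dots> = (\<Sum>i\<le>n. ?l (c i * (f ^ i * (g ^ (n - i) * 1))))"
    using c fg R_power by (intro laurent_sum R_closed)
  also have "\<dots> = (\<Sum>i\<le>n. ?l (c i) * (?l f ^ i * ?l g ^ (n - i)))"
  proof (rule sum.cong[OF refl])
    fix i assume "i \<in> {..n}"
    then have i: "i \<le> n" by simp
    have g: "g ^ (n - i) * 1 \<in> R" using R_power fg by simp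
    have f: "f ^ i * (g ^ (n - i) * 1) \<in> R" using R_power fg R_closed(4) by simp
    show "?l (c i * (f ^ i * (g ^ (n - i) * 1))) = ?l (c i) * (?l f ^ i * ?l g ^ (n - i))"
    proof -
      have "?l (c i * (f ^ i * (g ^ (n - i) * 1))) = ?l (c i) * ?l (f ^ i * (g ^ (n - i) * 1))"
        by (rule laurent_mult[OF \<phi>(1) c _ f]) (use intc i in blast)
      also have "?l (f ^ i * (g ^ (n - i) * 1)) = ?l f ^ i * ?l (g ^ (n - i) * 1)"
        by (rule laurent_power_mult[OF \<phi>(1) fg(2) _ g]) (use intf in blast)
      also have "?l (g ^ (n - i) * 1) = ?l g ^ (n - i) * ?l 1"
        by (rule laurent_power_mult[OF \<phi>(1) fg(3) _ R_closed(2)]) (use intg in blast)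
      finally show ?thesis unfolding laurent_one[OF \<phi>(1)] by simp
    qed
  qed
  finally have hom: "(\<Sum>i\<le>n. ?l (c i) * (?l f ^ i * ?l g ^ (n - i))) = 0" by simp
  define z where "z = ?l f / ?l g * ?T ^ L"
  (* Rescaling the root by T^L multiplies the i-th coefficient by T^(L (n - i)). For i < n this removes
     the negative exponents, and the leading coefficient stays 1. *)
  define d where "d i = ?l (c i) * ?T ^ (L * (n - i))" for i
  have dn: "d n = 1" using p(1) laurent_one[OF \<phi>(1)] by (simp add: d_def c_def n_def)
  define q where "q = (\<Sum>i\<le>n. Polynomial.monom (d i) i)"
  have cq: "Polynomial.coeff q i = (if i \<le> n then d i else 0)" for i
    by (simp add: q_def coeff_sum coeff_monom)
  have "degree q = n"
    using dn by (intro antisym degree_le le_degree) (auto simp: cq)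
  have "z \<in> range to_fract"
  proof (rule fract_poly_integrally_closed)
    show "lead_coeff q = 1" using \<open>degree q = n\<close> dn by (simp add: cq)
    fix i
    show "Polynomial.coeff q i \<in> range to_fract"
    proof (cases "i < n")
      case True
      have "?l (c i) * ?T ^ L = to_fract (laurent_shift \<phi> L (c i))"
        by (rule laurent_eq_shift) (use L True in \<open>force simp: E_def\<close>)
      moreover have "L * (n - i) = L + L * (n - i - 1)"
        using True by (metis Suc_diff_Suc diff_Suc_1 diff_diff_left add.commute mult_Suc_right plus_1_eq_Suc)
      ultimately have "d i = to_fract (laurent_shift \<phi> L (c i) * [:0, 1:] ^ (L * (n - i - 1)))"
        by (simp add: d_def power_add mult.assoc[symmetric] to_fract_power)
      then have "d i \<in> range to_fract" by (rule range_eqI)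
      then show ?thesis using True by (simp add: cq)
    next
      case False
      then have "Polynomial.coeff q i = to_fract (if i = n then 1 else 0)" using dn by (simp add: cq)
      then show ?thesis by blast
    qed
  next
    have "poly q z = (\<Sum>i\<le>n. d i * z ^ i)" by (simp add: q_def poly_sum poly_monom)
    also have "\<dots> = (\<Sum>i\<le>n. ?l (c i) * (?l f ^ i * ?l g ^ (n - i))) * (?T ^ (L * n) / ?l g ^ n)"
      unfolding sum_distrib_right
    proof (rule sum.cong[OF refl])
      fix i assume "i \<in> {..n}"
      then have "?l g ^ n = ?l g ^ (n - i) * ?l g ^ i" "L * n = L * (n - i) + L * i"
        by (simp_all flip: power_add add: diff_mult_distrib2)
      then show "d i * z ^ i = ?l (c i) * (?l f ^ i * ?l g ^ (n - i)) * (?T ^ (L * n) / ?l g ^ n)"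
        using lg0 by (simp add: d_def z_def power_mult_distrib power_divide power_add power_mult)
    qed
    finally show "poly q z = 0" using hom by simp
  qed
  then obtain y where y: "z = to_fract y" by blast
  define F where "F = laurent_shift \<phi> (L + L) f"
  have "to_fract F = ?l f * ?T ^ (L + L)"
    unfolding F_def by (rule laurent_eq_shift[symmetric]) (use L in \<open>fastforce simp: E_def\<close>)
  also have "\<dots> = (?l f * ?T ^ L) * ?T ^ L" by (simp add: power_add mult.assoc)
  also have "?l f * ?T ^ L = to_fract y * ?l g" using lg0 y by (simp add: z_def field_simps)
  also have "to_fract y * ?l g * ?T ^ L = to_fract (G * y)" using lg by (simp add: mult.assoc mult.commute)
  finally have FGy: "F = G * y" by (simp only: to_fract_eq_iff)
  have GyR: "Polynomial.coeff (G * y) i \<in> R" for i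
    unfolding FGy[symmetric] F_def by (rule coeff_laurent_shift[OF fg(2)])
  have "\<exists>m. \<forall>i. lead_coeff G ^ m * Polynomial.coeff y i \<in> R"
    by (rule leading_coeff_clears_quotient[OF subring _ GyR])
      (use coeff_laurent_shift[OF fg(3)] in \<open>simp add: G_def\<close>)
  then obtain m where m: "\<And>i. lead_coeff G ^ m * Polynomial.coeff y i \<in> R" by blast
  have "lead_coeff G \<in> H"
  proof -
    have "inj_on (\<lambda>\<gamma>. nat (\<lfloor>\<phi> \<gamma>\<rfloor> + int L)) {\<gamma>. hcomp g \<gamma> \<noteq> 0}"
    proof (rule inj_onI)
      fix \<gamma> \<delta> assume *: "\<gamma> \<in> {\<gamma>. hcomp g \<gamma> \<noteq> 0}" "\<delta> \<in> {\<gamma>. hcomp g \<gamma> \<noteq> 0}"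
        "nat (\<lfloor>\<phi> \<gamma>\<rfloor> + int L) = nat (\<lfloor>\<phi> \<delta>\<rfloor> + int L)"
      then have E: "\<gamma> \<in> E" "\<delta> \<in> E" by (auto simp: E_def)
      then have "\<lfloor>\<phi> \<gamma>\<rfloor> = \<lfloor>\<phi> \<delta>\<rfloor>" using *(3) L[OF E(1)] L[OF E(2)] by linarith
      then have "\<phi> \<gamma> = \<phi> \<delta>" using \<phi>(3)[OF E(1)] \<phi>(3)[OF E(2)] by (metis Ints_cases floor_of_int)
      then show "\<gamma> = \<delta>" using \<phi>(2) E by (auto dest: inj_onD)
    qed
    moreover have "lead_coeff G \<noteq> 0" using \<open>G \<noteq> 0\<close> by simp
    ultimately have "\<exists>\<gamma>\<in>{\<gamma>. hcomp g \<gamma> \<noteq> 0}. lead_coeff G = hcomp g \<gamma>"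
      unfolding G_def laurent_shift_def by (intro coeff_sum_monom_inj finite_supp[OF fg(3)])
    then show ?thesis using hcomp_H[OF fg(3)] by auto
  qed
  then have lH: "lead_coeff G ^ m \<in> H" by (rule H_power)
  have "x = poly y 1"
  proof -
    have "f = g * poly y 1"
      using poly_laurent_shift_1[OF fg(2), of \<phi> "L + L"] poly_laurent_shift_1[OF fg(3), of \<phi> L] FGy
      unfolding F_def G_def by simp
    then show ?thesis using fg by simp
  qed
  then have "lead_coeff G ^ m * x = (\<Sum>i\<le>degree y. lead_coeff G ^ m * Polynomial.coeff y i)"
    by (simp add: poly_altdef sum_distrib_left)
  then have "lead_coeff G ^ m * x \<in> R" using m by (simp add: R_sum)
  then show ?thesis using lH by (rule bexI)
qed

lemma integrally_closed_if_locally_comparable: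
  assumes locally_comparable
  shows "integrally_closed_domain R"
  unfolding integrally_closed_domain_def
proof (rule ballI, rule impI)
  fix x assume x: "x \<in> quotient_field R" and
    "\<exists>p. Polynomial.lead_coeff p = 1 \<and> (\<forall>i. Polynomial.coeff p i \<in> R) \<and> poly p x = 0"
  from this(2) have int: "integral_over R x" unfolding integral_over_def .
  obtain h where "h \<in> H" "h * x \<in> R" using integral_has_homogeneous_denominator[OF x int] by (rule bexE)
  then show "x \<in> R" by (rule integral_homogeneous_denominator[OF assms _ _ int])
qed

end

section \<open>Homogeneous overrings\<close>

context graded_domain
begin

abbreviation qpart :: "'g \<Rightarrow> 'k set" where
  "qpart \<equiv> quotient_component \<Gamma> A"

abbreviation qgroup :: "'g set" where
  "qgroup \<equiv> quotient_group \<Gamma>"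

lemma part_nonzero_degree: "b \<in> part \<beta> \<Longrightarrow> b \<noteq> 0 \<Longrightarrow> \<beta> \<in> \<Gamma>"
  by (auto simp: part_def split: if_splits)

text \<open>
  Multiplying by a homogeneous denominator reduces questions about the homogeneous quotient field
  to \<open>R\<close>. In this form the zero element needs no special treatment.
\<close>

lemma qpart_iff: "x \<in> qpart \<gamma> \<longleftrightarrow> (\<exists>\<beta> b. b \<in> part \<beta> \<and> b \<noteq> 0 \<and> b * x \<in> part (\<beta> + \<gamma>))"
proof
  assume "x \<in> qpart \<gamma>"
  then consider "x = 0" | a b \<alpha> \<beta> where "x = a / b" "\<alpha> \<in> \<Gamma>" "\<beta> \<in> \<Gamma>" "\<alpha> - \<beta> = \<gamma>" "a \<in> A \<alpha>" "b \<in> A \<beta>" "b \<noteq> 0"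
    unfolding quotient_component_def by auto
  then show "\<exists>\<beta> b. b \<in> part \<beta> \<and> b \<noteq> 0 \<and> b * x \<in> part (\<beta> + \<gamma>)"
  proof cases
    case 1
    then show ?thesis using one_part part_closed(1) by (intro exI[of _ 0] exI[of _ 1]) auto
  next
    case 2
    then have "\<beta> + \<gamma> = \<alpha>" by auto
    then show ?thesis using 2 by (intro exI[of _ \<beta>] exI[of _ b]) (auto simp: part_def)
  qed
next
  assume "\<exists>\<beta> b. b \<in> part \<beta> \<and> b \<noteq> 0 \<and> b * x \<in> part (\<beta> + \<gamma>)"
  then obtain \<beta> b where b: "b \<in> part \<beta>" "b \<noteq> 0" "b * x \<in> part (\<beta> + \<gamma>)" by blast
  show "x \<in> qpart \<gamma>"
  proof (cases "x = 0")
    case True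
    then show ?thesis by (simp add: quotient_component_def)
  next
    case False
    then have d: "\<beta> \<in> \<Gamma>" "\<beta> + \<gamma> \<in> \<Gamma>"
      using part_nonzero_degree[OF b(1,2)] part_nonzero_degree[OF b(3)] b(2) by simp_all
    then have "x = (b * x) / b \<and> \<beta> + \<gamma> \<in> \<Gamma> \<and> \<beta> \<in> \<Gamma> \<and> (\<beta> + \<gamma>) - \<beta> = \<gamma> \<and>
        b * x \<in> A (\<beta> + \<gamma>) \<and> b \<in> A \<beta> - {0}"
      using b by (auto simp: part_def)
    then show ?thesis unfolding quotient_component_def by blast
  qed
qed

lemma part_qpart: "part \<gamma> \<subseteq> qpart \<gamma>"
proof
  fix x assume "x \<in> part \<gamma>"
  then show "x \<in> qpart \<gamma>"
    unfolding qpart_iff using one_part by (intro exI[of _ 0] exI[of _ 1]) simp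
qed

lemma zero_qpart: "0 \<in> qpart \<gamma>"
  by (simp add: quotient_component_def)

lemma qpart_add:
  assumes "x \<in> qpart \<gamma>" "y \<in> qpart \<gamma>"
  shows "x + y \<in> qpart \<gamma>"
proof -
  obtain \<beta> b where b: "b \<in> part \<beta>" "b \<noteq> 0" "b * x \<in> part (\<beta> + \<gamma>)"
    using assms(1) unfolding qpart_iff by blast
  obtain \<delta> c where c: "c \<in> part \<delta>" "c \<noteq> 0" "c * y \<in> part (\<delta> + \<gamma>)"
    using assms(2) unfolding qpart_iff by blast
  have "c * (b * x) \<in> part (\<beta> + \<delta> + \<gamma>)" "b * (c * y) \<in> part (\<beta> + \<delta> + \<gamma>)"
    using part_mult[OF c(1) b(3)] part_mult[OF b(1) c(3)] by (simp_all add: ac_simps)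
  then have "c * (b * x) + b * (c * y) \<in> part (\<beta> + \<delta> + \<gamma>)" by (rule part_closed(2))
  moreover have "c * (b * x) + b * (c * y) = (b * c) * (x + y)" by (simp add: algebra_simps)
  ultimately show ?thesis unfolding qpart_iff
    using part_mult[OF b(1) c(1)] b(2) c(2) by (intro exI[of _ "\<beta> + \<delta>"] exI[of _ "b * c"]) simp
qed

lemma qpart_mult:
  assumes "x \<in> qpart \<gamma>" "y \<in> qpart \<gamma>'"
  shows "x * y \<in> qpart (\<gamma> + \<gamma>')"
proof -
  obtain \<beta> b where b: "b \<in> part \<beta>" "b \<noteq> 0" "b * x \<in> part (\<beta> + \<gamma>)"
    using assms(1) unfolding qpart_iff by blast
  obtain \<delta> c where c: "c \<in> part \<delta>" "c \<noteq> 0" "c * y \<in> part (\<delta> + \<gamma>')"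
    using assms(2) unfolding qpart_iff by blast
  have "(b * c) * (x * y) \<in> part (\<beta> + \<delta> + (\<gamma> + \<gamma>'))"
    using part_mult[OF b(3) c(3)] by (simp add: ac_simps)
  then show ?thesis unfolding qpart_iff
    using part_mult[OF b(1) c(1)] b(2) c(2) by (intro exI[of _ "\<beta> + \<delta>"] exI[of _ "b * c"]) simp
qed

lemma qpart_uminus: "x \<in> qpart \<gamma> \<Longrightarrow> - x \<in> qpart \<gamma>"
  unfolding qpart_iff using part_closed(3) by (metis mult_minus_right)

lemma qpart_common_denominator:
  assumes "finite F" "\<And>\<gamma>. \<gamma> \<in> F \<Longrightarrow> f \<gamma> \<in> qpart \<gamma>"
  shows "\<exists>\<beta> b. b \<in> part \<beta> \<and> b \<noteq> 0 \<and> (\<forall>\<gamma>\<in>F. b * f \<gamma> \<in> part (\<beta> + \<gamma>))"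
  using assms
proof (induction F rule: finite_induct)
  case empty
  then show ?case using one_part by (intro exI[of _ 0] exI[of _ 1]) simp
next
  case (insert \<delta> F)
  then obtain \<beta> b where b: "b \<in> part \<beta>" "b \<noteq> 0" "\<And>\<gamma>. \<gamma> \<in> F \<Longrightarrow> b * f \<gamma> \<in> part (\<beta> + \<gamma>)" by auto
  have "f \<delta> \<in> qpart \<delta>" using insert.prems by simp
  then obtain \<beta>' c where c: "c \<in> part \<beta>'" "c \<noteq> 0" "c * f \<delta> \<in> part (\<beta>' + \<delta>)"
    unfolding qpart_iff by blast
  have "(b * c) * f \<delta> \<in> part (\<beta> + \<beta>' + \<delta>)" using part_mult[OF b(1) c(3)] by (simp add: ac_simps)
  moreover have "(b * c) * f \<gamma> \<in> part (\<beta> + \<beta>' + \<gamma>)" if "\<gamma> \<in> F" for \<gamma>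
    using part_mult[OF c(1) b(3)[OF that]] by (simp add: ac_simps)
  ultimately show ?case
    using part_mult[OF b(1) c(1)] b(2) c(2) by (intro exI[of _ "\<beta> + \<beta>'"] exI[of _ "b * c"]) auto
qed

lemma qpart_independent:
  assumes F: "finite F" "\<And>\<gamma>. \<gamma> \<in> F \<Longrightarrow> f \<gamma> \<in> qpart \<gamma>" and sum: "(\<Sum>\<gamma>\<in>F. f \<gamma>) = 0" and \<gamma>: "\<gamma> \<in> F"
  shows "f \<gamma> = 0"
proof -
  obtain \<beta> b where b: "b \<in> part \<beta>" "b \<noteq> 0" "\<And>\<gamma>. \<gamma> \<in> F \<Longrightarrow> b * f \<gamma> \<in> part (\<beta> + \<gamma>)"
    using qpart_common_denominator[OF F] by blast
  define g where "g \<delta> = b * f (\<delta> - \<beta>)" for \<delta>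
  have "sum g ((+) \<beta> ` F) = (\<Sum>\<gamma>\<in>F. b * f \<gamma>)"
    by (subst sum.reindex) (auto intro: inj_onI simp: g_def)
  also have "\<dots> = 0" using sum by (simp flip: sum_distrib_left)
  finally have "sum g ((+) \<beta> ` F) = 0" .
  moreover have "g \<delta> \<in> part \<delta>" if "\<delta> \<in> (+) \<beta> ` F" for \<delta> using that b(3) by (auto simp: g_def)
  ultimately have "g (\<beta> + \<gamma>) = 0"
    using F(1) \<gamma> part_independent[of "(+) \<beta> ` F" g "\<beta> + \<gamma>"] by simp
  then show ?thesis using b(2) by (simp add: g_def)
qed

lemma monoid_subset_qgroup: "\<Gamma> \<subseteq> qgroup"
proof
  fix \<gamma> assume "\<gamma> \<in> \<Gamma>"
  moreover have "\<gamma> = \<gamma> - 0" by simp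
  ultimately show "\<gamma> \<in> qgroup" unfolding quotient_group_def using monoid_closed(1) by blast
qed

lemma qgroup_closed: "0 \<in> qgroup" "\<gamma> \<in> qgroup \<Longrightarrow> \<delta> \<in> qgroup \<Longrightarrow> \<gamma> + \<delta> \<in> qgroup"
proof -
  show "0 \<in> qgroup" using monoid_subset_qgroup monoid_closed(1) by blast
  assume "\<gamma> \<in> qgroup" "\<delta> \<in> qgroup"
  then obtain a b c d where *: "\<gamma> = a - b" "\<delta> = c - d" "a \<in> \<Gamma>" "b \<in> \<Gamma>" "c \<in> \<Gamma>" "d \<in> \<Gamma>"
    unfolding quotient_group_def by blast
  have "\<gamma> + \<delta> = (a + c) - (b + d)" unfolding * by simp
  then show "\<gamma> + \<delta> \<in> qgroup" unfolding quotient_group_def using * monoid_closed(2) by blast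
qed

lemma torsionless_qgroup: "torsionless_monoid qgroup"
  unfolding torsionless_monoid_def
proof (intro conjI ballI allI impI)
  fix \<gamma> \<delta> and n :: nat assume *: "\<gamma> \<in> qgroup" "\<delta> \<in> qgroup" "1 \<le> n" "nmult n \<gamma> = nmult n \<delta>"
  then obtain a b c d where d: "\<gamma> = a - b" "\<delta> = c - d" "a \<in> \<Gamma>" "b \<in> \<Gamma>" "c \<in> \<Gamma>" "d \<in> \<Gamma>"
    unfolding quotient_group_def by blast
  have "nmult n (a + d) = nmult n (c + b)"
    using *(4) unfolding d by (simp add: sum_subtractf sum.distrib algebra_simps)
  then have "a + d = c + b" using torsion_free[OF _ _ *(3)] d monoid_closed(2) by blast
  then show "\<gamma> = \<delta>" unfolding d by (simp add: algebra_simps)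
qed (use qgroup_closed in auto)

lemma graded_domain_overring:
  assumes T: "homogeneous_overring \<Gamma> A R T"
  shows "graded_domain qgroup (overring_component \<Gamma> A T) T"
proof -
  have sub: "subring T ambient" and ds: "is_direct_sum qgroup (overring_component \<Gamma> A T) T"
    using T unfolding homogeneous_overring_def by simp_all
  show ?thesis
  proof (rule graded_domain.intro)
    show "torsionless_monoid qgroup" by (rule torsionless_qgroup)
    show "qgroup \<noteq> {0}" using nonzero monoid_subset_qgroup monoid_closed(1) by blast
    show "subring T ambient" by (rule sub)
    show "is_direct_sum qgroup (overring_component \<Gamma> A T) T" by (rule ds)
  next
    fix \<alpha> \<beta> a b assume "a \<in> overring_component \<Gamma> A T \<alpha>" "b \<in> overring_component \<Gamma> A T \<beta>"
    then show "a * b \<in> overring_component \<Gamma> A T (\<alpha> + \<beta>)"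
      using qpart_mult subringD(4)[OF sub] unfolding overring_component_def by simp
  qed
qed

lemma homogeneous_overringI:
  assumes sub: "subring T ambient" and RT: "R \<subseteq> T" and Tq: "T \<subseteq> homogeneous_quotient_field \<Gamma> A R"
    and dec: "\<And>x. x \<in> T \<Longrightarrow> \<exists>F f. finite F \<and> F \<subseteq> qgroup \<and> (\<forall>\<gamma>\<in>F. f \<gamma> \<in> T \<inter> qpart \<gamma>) \<and> x = sum f F"
  shows "homogeneous_overring \<Gamma> A R T"
proof -
  have grp: "additive_subgroup (overring_component \<Gamma> A T \<gamma>) ambient" for \<gamma>
    using subringD[OF sub] zero_qpart qpart_add qpart_uminus
    by (intro additive_subgroup_ambientI) (auto simp: overring_component_def)
  have sums: "sum f F \<in> T" if "finite F" "\<forall>\<gamma>\<in>F. f \<gamma> \<in> overring_component \<Gamma> A T \<gamma>" for f and F :: "'g set"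
    using that by (induction F rule: finite_induct) (auto simp: overring_component_def intro: subringD[OF sub])
  have "T = {sum f F | F f. finite F \<and> F \<subseteq> qgroup \<and> (\<forall>\<gamma>\<in>F. f \<gamma> \<in> overring_component \<Gamma> A T \<gamma>)}" (is "T = ?S")
  proof
    show "T \<subseteq> ?S"
    proof
      fix x assume "x \<in> T"
      then obtain F f where "finite F" "F \<subseteq> qgroup" "\<forall>\<gamma>\<in>F. f \<gamma> \<in> T \<inter> qpart \<gamma>" "x = sum f F" using dec by blast
      then show "x \<in> ?S" unfolding overring_component_def by (intro CollectI exI[of _ F] exI[of _ f]) simp
    qed
    show "?S \<subseteq> T" using sums by blast
  qed
  moreover have "\<forall>F f. finite F \<and> F \<subseteq> qgroup \<and> (\<forall>\<gamma>\<in>F. f \<gamma> \<in> overring_component \<Gamma> A T \<gamma>) \<and> sum f F = 0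
      \<longrightarrow> (\<forall>\<gamma>\<in>F. f \<gamma> = 0)"
  proof (intro allI impI ballI, elim conjE)
    fix F f \<gamma> assume *: "finite F" "\<forall>\<gamma>\<in>F. f \<gamma> \<in> overring_component \<Gamma> A T \<gamma>" "sum f F = 0" "\<gamma> \<in> F"
    have "f \<gamma> \<in> qpart \<gamma>" if "\<gamma> \<in> F" for \<gamma> using *(2) that by (simp add: overring_component_def)
    then show "f \<gamma> = 0" by (rule qpart_independent[OF *(1) _ *(3,4)])
  qed
  moreover have "\<forall>\<gamma>\<in>qgroup. additive_subgroup (overring_component \<Gamma> A T \<gamma>) ambient" using grp by simp
  ultimately have "is_direct_sum qgroup (overring_component \<Gamma> A T) T"
    unfolding is_direct_sum_def by simp
  then show ?thesis unfolding homogeneous_overring_def using sub RT Tq by simp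
qed

end

locale graded_overring = graded_domain \<Gamma> A R for \<Gamma> :: "'g::ab_group_add set" and A :: "'g \<Rightarrow> 'k::field set" and R +
  fixes T :: "'k set"
  assumes overring: "homogeneous_overring \<Gamma> A R T"
begin

sublocale T: graded_domain "quotient_group \<Gamma>" "overring_component \<Gamma> A T" T
  by (rule graded_domain_overring[OF overring])

lemma R_subset_T: "R \<subseteq> T"
  using overring unfolding homogeneous_overring_def by simp

lemma part_T_part: "part \<gamma> \<subseteq> T.part \<gamma>"
proof
  fix x assume x: "x \<in> part \<gamma>"
  show "x \<in> T.part \<gamma>"
  proof (cases "x = 0")
    case True
    then show ?thesis using T.part_closed(1) by simp
  next
    case False
    then have "\<gamma> \<in> quotient_group \<Gamma>"
      using part_nonzero_degree[OF x] monoid_subset_qgroup by blast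
    moreover have "x \<in> T" using x part_subset R_subset_T by blast
    moreover have "x \<in> qpart \<gamma>" using x part_qpart by blast
    ultimately show ?thesis by (simp add: T.part_def overring_component_def)
  qed
qed

lemma T_part_qpart: "T.part \<gamma> \<subseteq> qpart \<gamma>"
  using zero_qpart by (auto simp: T.part_def overring_component_def)

lemma H_T_H: "H \<subseteq> T.H"
  using part_T_part H_iff T.H_iff by blast

lemma T_hcomp_eq:
  assumes x: "x \<in> R"
  shows "T.hcomp x \<gamma> = hcomp x \<gamma>"
proof -
  have "T.hcomp x \<gamma> = (if \<gamma> \<in> {\<gamma>. hcomp x \<gamma> \<noteq> 0} then hcomp x \<gamma> else 0)"
    by (rule T.hcomp_eqI[OF finite_supp[OF x] subsetD[OF part_T_part hcomp_part[OF x]] sum_hcomp[OF x, symmetric]])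
  then show ?thesis by simp
qed

text \<open>
  Comparability of numerator and denominator at \<open>P\<close> shows that every element \<open>t\<close> of \<open>T\<close> is carried
  into \<open>R\<close> by some homogeneous element of \<open>R\<close> outside \<open>P\<close>. Even if comparability yields \<open>s = r t\<close>
  rather than \<open>s t = r\<close>, for a homogeneous \<open>t\<close> and \<open>s \<notin> P\<close>, the element \<open>r\<close> is outside \<open>P\<close>, because
  \<open>Q\<close> lies over \<open>P\<close>, and carries \<open>t\<close> to \<open>s\<close>. So \<open>T\<close> and \<open>R\<close> have the
  same homogeneous localization at \<open>Q\<close> and \<open>P\<close>, and \<open>P\<^sub>0\<close> extends to the prime of \<open>T\<close> of all elements
  that are carried into \<open>P\<^sub>0\<close>.
\<close>

lemma gGD_extension_if_locally_comparable:
  assumes lc: locally_comparable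
  shows "gGD_extension \<Gamma> A R T"
  unfolding gGD_extension_def
proof (intro allI impI, elim conjE)
  fix P\<^sub>0 P Q
  assume P0: "homogeneous_prime \<Gamma> A R P\<^sub>0" and P: "homogeneous_prime \<Gamma> A R P" and le: "P\<^sub>0 \<subseteq> P"
    and Q: "homogeneous_prime (quotient_group \<Gamma>) (overring_component \<Gamma> A T) T Q" and QP: "Q \<inter> R = P"
  have mP: "s * t \<notin> P" if "s \<in> R" "t \<in> R" "s \<notin> P" "t \<notin> P" for s t
    using homogeneous_primeD(6)[OF P that(1,2)] that(3,4) by blast
  have hom: "\<exists>s\<in>H. s \<notin> P \<and> s * t \<in> R" if tT: "t \<in> T" and t: "t \<in> qpart \<gamma>" for t \<gamma>
  proof (cases "t = 0")
    case True
    then show ?thesis using H_one homogeneous_primeD(3)[OF P] R_closed(1) by (intro bexI[of _ 1]) auto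
  next
    case False
    obtain \<beta> b where b: "b \<in> part \<beta>" "b \<noteq> 0" "b * t \<in> part (\<beta> + \<gamma>)" using t unfolding qpart_iff by blast
    define a where "a = b * t"
    have ab: "a \<in> H" "b \<in> H" using b False unfolding H_iff a_def by auto
    have "\<exists>s\<in>H. s \<notin> P \<and> ((\<exists>r\<in>R. s * a = b * r) \<or> (\<exists>r\<in>R. s * b = a * r))"
      using lc P ab unfolding locally_comparable_def by simp
    then obtain s where s: "s \<in> H" "s \<notin> P" and "(\<exists>r\<in>R. s * a = b * r) \<or> (\<exists>r\<in>R. s * b = a * r)" by auto
    from this(3) show ?thesis
    proof
      assume "\<exists>r\<in>R. s * a = b * r"
      then obtain r where "r \<in> R" "s * a = b * r" by (rule bexE)
      then have "s * t = r" using b(2) by (simp add: a_def)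
      then show ?thesis using s \<open>r \<in> R\<close> by blast
    next
      assume "\<exists>r\<in>R. s * b = a * r"
      then obtain r where r: "r \<in> R" "s * b = a * r" by (rule bexE)
      then have st: "s = r * t" using b(2) by (simp add: a_def)
      have sR: "s \<in> R" using s(1) by (rule H_R)
      have "r \<notin> P"
      proof
        assume "r \<in> P"
        then have "r \<in> Q" using QP by blast
        then have "s \<in> Q" using T.homogeneous_primeD(5)[OF Q tT] st by (simp add: mult.commute)
        then show False using s(2) sR QP by blast
      qed
      moreover have "r \<in> H"
      proof -
        obtain \<sigma> where \<sigma>: "s \<in> part \<sigma>" using s(1) H_iff by blast
        have "a * r \<in> part (\<sigma> + \<beta>)" using part_mult[OF \<sigma> b(1)] r(2) by simp
        then have "r \<in> part (\<sigma> + \<beta> - (\<beta> + \<gamma>))"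
          using b False by (intro part_cancel[of a] r(1)) (auto simp: a_def)
        moreover have "s \<noteq> 0" using s(1) H_iff by blast
        then have "r \<noteq> 0" using st by auto
        ultimately show ?thesis unfolding H_iff by blast
      qed
      ultimately show ?thesis using st sR by blast
    qed
  qed
  have den: "\<exists>s\<in>H. s \<notin> P \<and> s * t \<in> R" if t: "t \<in> T" for t
  proof -
    have "\<exists>s\<in>H. s \<notin> P \<and> s * (\<Sum>\<gamma>\<in>F. T.hcomp t \<gamma>) \<in> R" if "finite F" for F
      using that
    proof (induction F rule: finite_induct)
      case empty
      then show ?case using H_one homogeneous_primeD(3)[OF P] R_closed(1) by (intro bexI[of _ 1]) auto
    next
      case (insert \<gamma> F)
      then obtain s where s: "s \<in> H" "s \<notin> P" "s * (\<Sum>\<gamma>\<in>F. T.hcomp t \<gamma>) \<in> R" by auto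
      have "T.hcomp t \<gamma> \<in> T" "T.hcomp t \<gamma> \<in> qpart \<gamma>"
        using T.hcomp_R[OF t] T.hcomp_part[OF t, of \<gamma>] T_part_qpart by auto
      from hom[OF this] obtain s' where s': "s' \<in> H" "s' \<notin> P" "s' * T.hcomp t \<gamma> \<in> R" by auto
      have R: "s \<in> R" "s' \<in> R" using s(1) s'(1) H_R by simp_all
      have "s * s' * (\<Sum>\<gamma>\<in>insert \<gamma> F. T.hcomp t \<gamma>) = s * (s' * T.hcomp t \<gamma>) + s' * (s * (\<Sum>\<gamma>\<in>F. T.hcomp t \<gamma>))"
        using insert.hyps by (simp add: algebra_simps)
      also have "\<dots> \<in> R" using R s(3) s'(3) R_closed(3,4) by simp
      finally show ?case using H_mult[OF s(1) s'(1)] mP[OF R s(2) s'(2)] by (intro bexI[of _ "s * s'"]) simp_all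
    qed
    from this[OF T.finite_supp[OF t]] show ?thesis unfolding T.sum_hcomp[OF t] .
  qed
  define Q0 where "Q0 = {t \<in> T. \<exists>s\<in>H. s \<notin> P \<and> s * t \<in> P\<^sub>0}"
  have Q0I: "t \<in> Q0" if "t \<in> T" "s \<in> H" "s \<notin> P" "s * t \<in> P\<^sub>0" for s t
    unfolding Q0_def using that by blast
  have Q0E: "\<exists>s\<in>H. s \<notin> P \<and> s * t \<in> P\<^sub>0" "t \<in> T" if "t \<in> Q0" for t using that unfolding Q0_def by blast+
  have P0_Q0: "P\<^sub>0 \<subseteq> Q0"
  proof
    fix x assume "x \<in> P\<^sub>0"
    then show "x \<in> Q0" using homogeneous_primeD(1)[OF P0] R_subset_T H_one homogeneous_primeD(3)[OF P]
      by (intro Q0I[of x 1]) auto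
  qed
  have "T.graded_ideal Q0"
  proof (rule T.graded_idealI)
    show "Q0 \<subseteq> T" unfolding Q0_def by blast
    show "0 \<in> Q0" using P0_Q0 homogeneous_primeD(2)[OF P0] by blast
  next
    fix x y assume xy: "x \<in> Q0" "y \<in> Q0"
    obtain s where s: "s \<in> H" "s \<notin> P" "s * x \<in> P\<^sub>0" using Q0E(1)[OF xy(1)] by auto
    obtain t where t: "t \<in> H" "t \<notin> P" "t * y \<in> P\<^sub>0" using Q0E(1)[OF xy(2)] by auto
    have R: "s \<in> R" "t \<in> R" using s(1) t(1) H_R by simp_all
    have "s * t * (x + y) = t * (s * x) + s * (t * y)" by (simp add: algebra_simps)
    also have "\<dots> \<in> P\<^sub>0" using homogeneous_primeD(4,5)[OF P0] R s(3) t(3) by simp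
    finally show "x + y \<in> Q0"
      using Q0E(2) xy T.R_closed(3) H_mult[OF s(1) t(1)] mP[OF R s(2) t(2)] by (intro Q0I[of _ "s * t"]) auto
  next
    fix r x assume r: "r \<in> T" and x: "x \<in> Q0"
    obtain s where s: "s \<in> H" "s \<notin> P" "s * x \<in> P\<^sub>0" using Q0E(1)[OF x] by auto
    obtain t where t: "t \<in> H" "t \<notin> P" "t * r \<in> R" using den[OF r] by auto
    have R: "s \<in> R" "t \<in> R" using s(1) t(1) H_R by simp_all
    have "s * t * (r * x) = (t * r) * (s * x)" by (simp add: algebra_simps)
    also have "\<dots> \<in> P\<^sub>0" by (rule homogeneous_primeD(5)[OF P0 t(3) s(3)])
    finally show "r * x \<in> Q0"
      using Q0E(2)[OF x] r T.R_closed(4) H_mult[OF s(1) t(1)] mP[OF R s(2) t(2)]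
      by (intro Q0I[of _ "s * t"]) auto
  next
    fix x \<gamma> assume x: "x \<in> Q0"
    obtain s where s: "s \<in> H" "s \<notin> P" "s * x \<in> P\<^sub>0" using Q0E(1)[OF x] by auto
    obtain \<sigma> where \<sigma>: "s \<in> part \<sigma>" using s(1) H_iff by blast
    have sxR: "s * x \<in> R" using s(3) homogeneous_primeD(1)[OF P0] by blast
    have "s \<in> T.part \<sigma>" using \<sigma> part_T_part by blast
    then have "s * T.hcomp x \<gamma> = hcomp (s * x) (\<sigma> + \<gamma>)"
      using T.hcomp_part_mult[OF _ Q0E(2)[OF x], of s \<sigma> "\<sigma> + \<gamma>"] T_hcomp_eq[OF sxR, of "\<sigma> + \<gamma>"] by simp
    also have "\<dots> \<in> P\<^sub>0" by (rule homogeneous_primeD(7)[OF P0 s(3)])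
    finally show "T.hcomp x \<gamma> \<in> Q0" using T.hcomp_R[OF Q0E(2)[OF x]] s(1,2) by (intro Q0I[of _ s])
  qed
  moreover have Q0P0: "Q0 \<inter> R = P\<^sub>0"
  proof
    show "Q0 \<inter> R \<subseteq> P\<^sub>0"
    proof
      fix x assume x: "x \<in> Q0 \<inter> R"
      then obtain s where s: "s \<in> H" "s \<notin> P" "s * x \<in> P\<^sub>0" using Q0E(1) by auto
      then have "s \<notin> P\<^sub>0" "s \<in> R" using le H_R by auto
      then show "x \<in> P\<^sub>0" using homogeneous_primeD(6)[OF P0 _ _ s(3)] x by blast
    qed
    show "P\<^sub>0 \<subseteq> Q0 \<inter> R" using P0_Q0 homogeneous_primeD(1)[OF P0] by blast
  qed
  moreover have "1 \<notin> Q0" using Q0P0 homogeneous_primeD(3)[OF P0] R_closed(2) by blast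
  moreover have "x \<in> Q0 \<or> y \<in> Q0" if xy: "x \<in> T" "y \<in> T" "x * y \<in> Q0" for x y
  proof -
    obtain s where s: "s \<in> H" "s \<notin> P" "s * (x * y) \<in> P\<^sub>0" using Q0E(1)[OF xy(3)] by auto
    obtain a where a: "a \<in> H" "a \<notin> P" "a * x \<in> R" using den[OF xy(1)] by auto
    obtain b where b: "b \<in> H" "b \<notin> P" "b * y \<in> R" using den[OF xy(2)] by auto
    have R: "a \<in> R" "b \<in> R" "s \<in> R" using a(1) b(1) s(1) H_R by simp_all
    have "s * ((a * x) * (b * y)) = (a * b) * (s * (x * y))" by (simp add: algebra_simps)
    also have "\<dots> \<in> P\<^sub>0" using homogeneous_primeD(5)[OF P0 R_closed(4)[OF R(1,2)] s(3)] .
    finally have "(a * x) * (b * y) \<in> P\<^sub>0"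
      using homogeneous_primeD(6)[OF P0 R(3) R_closed(4)[OF a(3) b(3)]] s(2) le by blast
    then have "a * x \<in> P\<^sub>0 \<or> b * y \<in> P\<^sub>0" by (rule homogeneous_primeD(6)[OF P0 a(3) b(3)])
    then show ?thesis using Q0I[OF xy(1) a(1,2)] Q0I[OF xy(2) b(1,2)] by blast
  qed
  ultimately have "homogeneous_prime (quotient_group \<Gamma>) (overring_component \<Gamma> A T) T Q0"
    unfolding T.homogeneous_prime_iff T.prime_iff T.graded_ideal_def by simp
  moreover have "Q0 \<subseteq> Q"
  proof
    fix x assume x: "x \<in> Q0"
    then obtain s where s: "s \<in> H" "s \<notin> P" "s * x \<in> P\<^sub>0" using Q0E(1) by auto
    have "s \<in> R" using s(1) by (rule H_R)
    then have "s \<in> T" "s \<notin> Q" using R_subset_T QP s(2) by auto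
    moreover have "s * x \<in> Q" using s(3) le QP by blast
    ultimately show "x \<in> Q" using T.homogeneous_primeD(6)[OF Q _ Q0E(2)[OF x]] by blast
  qed
  ultimately show "\<exists>Q\<^sub>0. homogeneous_prime (quotient_group \<Gamma>) (overring_component \<Gamma> A T) T Q\<^sub>0 \<and>
      Q\<^sub>0 \<subseteq> Q \<and> Q\<^sub>0 \<inter> R = P\<^sub>0"
    using Q0P0 by (intro exI[of _ Q0] conjI)
qed

end

context graded_domain
begin

lemma gGD_if_locally_comparable:
  assumes locally_comparable
  shows "gGD_domain \<Gamma> A R"
  unfolding gGD_domain_def
proof (intro allI impI)
  fix T assume "homogeneous_overring \<Gamma> A R T"
  then interpret graded_overring \<Gamma> A R T by unfold_locales
  show "gGD_extension \<Gamma> A R T" by (rule gGD_extension_if_locally_comparable[OF assms])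
qed

end

section \<open>Adjoining a homogeneous fraction\<close>

context graded_domain
begin

definition adjoin :: "'k \<Rightarrow> 'k set" where
  "adjoin u = {poly p u | p. \<forall>i. Polynomial.coeff p i \<in> R}"

lemma adjoinI: "(\<And>i. Polynomial.coeff p i \<in> R) \<Longrightarrow> poly p u \<in> adjoin u"
  unfolding adjoin_def by blast

lemma subring_adjoin: "subring (adjoin u) ambient"
proof (rule subring_ambientI)
  have "poly 1 u \<in> adjoin u" by (rule adjoinI) (simp add: coeff_1 R_closed)
  then show "1 \<in> adjoin u" by simp
  fix x assume x: "x \<in> adjoin u"
  then obtain p where p: "x = poly p u" "\<And>i. Polynomial.coeff p i \<in> R" unfolding adjoin_def by blast
  have "poly (- p) u \<in> adjoin u" by (rule adjoinI) (simp add: p R_closed)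
  then show "- x \<in> adjoin u" by (simp add: p)
  fix y assume "y \<in> adjoin u"
  then obtain q where q: "y = poly q u" "\<And>i. Polynomial.coeff q i \<in> R" unfolding adjoin_def by blast
  have "poly (p + q) u \<in> adjoin u" by (rule adjoinI) (simp add: p q R_closed)
  then show "x + y \<in> adjoin u" by (simp add: p q)
  have "poly (p * q) u \<in> adjoin u" by (rule adjoinI) (simp add: p q coeffs_in_mult[OF subring])
  then show "x * y \<in> adjoin u" by (simp add: p q)
qed

lemma R_subset_adjoin: "R \<subseteq> adjoin u"
proof
  fix r assume "r \<in> R"
  then have "poly [:r:] u \<in> adjoin u"
    by (intro adjoinI) (simp add: coeff_pCons R_closed split: nat.split)
  then show "r \<in> adjoin u" by simp
qed

lemma mem_adjoin: "u \<in> adjoin u"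
proof -
  have "poly [:0, 1:] u \<in> adjoin u"
    by (rule adjoinI) (simp add: coeff_pCons R_closed split: nat.split)
  then show ?thesis by simp
qed

lemma power_adjoin: "u ^ i \<in> adjoin u"
  using subringD[OF subring_adjoin] mem_adjoin by (induction i) auto

lemma fraction_qpart:
  assumes "a \<in> H" "b \<in> H"
  shows "\<exists>\<delta>\<in>qgroup. a / b \<in> qpart \<delta>"
proof -
  obtain \<alpha> where \<alpha>: "a \<in> part \<alpha>" using assms(1) H_iff by blast
  obtain \<beta> where \<beta>: "b \<in> part \<beta>" using assms(2) H_iff by blast
  have nz: "a \<noteq> 0" "b \<noteq> 0" using assms H_iff by blast+
  have "\<alpha> \<in> \<Gamma>" "\<beta> \<in> \<Gamma>" using part_nonzero_degree \<alpha> \<beta> nz by blast+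
  then have "\<alpha> - \<beta> \<in> qgroup" unfolding quotient_group_def by blast
  moreover have "a / b \<in> qpart (\<alpha> - \<beta>)"
    unfolding qpart_iff using \<alpha> \<beta> nz by (intro exI[of _ \<beta>] exI[of _ b]) simp
  ultimately show ?thesis by blast
qed

lemma power_qpart:
  assumes "\<delta> \<in> qgroup" "u \<in> qpart \<delta>"
  shows "\<exists>\<delta>'\<in>qgroup. u ^ i \<in> qpart \<delta>'"
proof (induction i)
  case 0
  have "1 \<in> qpart 0" using part_qpart one_part by blast
  then show ?case using qgroup_closed(1) by auto
next
  case (Suc i)
  then obtain \<delta>' where "\<delta>' \<in> qgroup" "u ^ i \<in> qpart \<delta>'" by (rule bexE)
  then have "\<delta> + \<delta>' \<in> qgroup" "u ^ Suc i \<in> qpart (\<delta> + \<delta>')"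
    using qgroup_closed(2)[OF assms(1)] qpart_mult[OF assms(2)] by simp_all
  then show ?case by (rule bexI[rotated])
qed

lemma homogeneous_overring_adjoin:
  assumes a: "a \<in> H" and b: "b \<in> H"
  shows "homogeneous_overring \<Gamma> A R (adjoin (a / b))"
proof (rule homogeneous_overringI[OF subring_adjoin R_subset_adjoin])
  define u where "u = a / b"
  obtain \<delta> where \<delta>: "\<delta> \<in> qgroup" "u \<in> qpart \<delta>" using fraction_qpart[OF a b] unfolding u_def by (rule bexE)
  have R: "a \<in> R" "b \<in> R" and b0: "b \<noteq> 0" using a b H_R H_iff by simp_all
  show "adjoin (a / b) \<subseteq> homogeneous_quotient_field \<Gamma> A R"
  proof
    fix x assume "x \<in> adjoin (a / b)"
    then obtain p where p: "x = poly p u" "\<And>i. Polynomial.coeff p i \<in> R" unfolding adjoin_def u_def by blast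
    define n where "n = degree p"
    have "b ^ n * x = (\<Sum>i\<le>n. Polynomial.coeff p i * (b ^ (n - i) * a ^ i))"
      unfolding p(1) poly_altdef n_def sum_distrib_left
    proof (rule sum.cong[OF refl])
      fix i assume "i \<in> {..degree p}"
      then have "b ^ degree p = b ^ (degree p - i) * b ^ i" by (simp flip: power_add)
      then show "b ^ degree p * (Polynomial.coeff p i * u ^ i) = Polynomial.coeff p i * (b ^ (degree p - i) * a ^ i)"
        using b0 by (simp add: u_def power_divide)
    qed
    also have "\<dots> \<in> R" using p(2) R R_power by (intro R_sum R_closed)
    finally have "b ^ n * x \<in> R" .
    moreover have "x = (b ^ n * x) / b ^ n" using b0 by simp
    moreover have "b ^ n \<in> H" by (rule H_power[OF b])
    ultimately show "x \<in> homogeneous_quotient_field \<Gamma> A R" unfolding homogeneous_quotient_field_def by blast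
  qed
  define dec where "dec x \<longleftrightarrow> (\<exists>F f. finite F \<and> F \<subseteq> qgroup \<and> (\<forall>\<gamma>\<in>F. f \<gamma> \<in> adjoin u \<inter> qpart \<gamma>) \<and> x = sum f F)" for x
  have dec_0: "dec 0" unfolding dec_def by (intro exI[of _ "{}"]) simp
  have dec_single: "dec x" if "\<gamma> \<in> qgroup" "x \<in> adjoin u" "x \<in> qpart \<gamma>" for x \<gamma>
    unfolding dec_def using that by (intro exI[of _ "{\<gamma>}"] exI[of _ "\<lambda>_. x"]) simp
  have dec_add: "dec (x + y)" if xy: "dec x" "dec y" for x y
  proof -
    obtain F f where F: "finite F" "F \<subseteq> qgroup" "\<And>\<gamma>. \<gamma> \<in> F \<Longrightarrow> f \<gamma> \<in> adjoin u \<inter> qpart \<gamma>" "x = sum f F"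
      using xy(1) unfolding dec_def by blast
    obtain G g where G: "finite G" "G \<subseteq> qgroup" "\<And>\<gamma>. \<gamma> \<in> G \<Longrightarrow> g \<gamma> \<in> adjoin u \<inter> qpart \<gamma>" "y = sum g G"
      using xy(2) unfolding dec_def by blast
    define f' g' where "f' \<gamma> = (if \<gamma> \<in> F then f \<gamma> else 0)" and "g' \<gamma> = (if \<gamma> \<in> G then g \<gamma> else 0)" for \<gamma>
    have "x = sum f' (F \<union> G)" "y = sum g' (F \<union> G)"
      unfolding F(4) G(4) using F(1) G(1)
      by (auto intro!: sum.mono_neutral_cong_left simp: f'_def g'_def)
    then have "x + y = (\<Sum>\<gamma>\<in>F \<union> G. f' \<gamma> + g' \<gamma>)" by (simp add: sum.distrib)
    moreover have "f' \<gamma> \<in> adjoin u" "f' \<gamma> \<in> qpart \<gamma>" "g' \<gamma> \<in> adjoin u" "g' \<gamma> \<in> qpart \<gamma>" for \<gamma>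
      using F(3) G(3) subringD(1)[OF subring_adjoin] zero_qpart by (simp_all add: f'_def g'_def)
    then have "f' \<gamma> + g' \<gamma> \<in> adjoin u \<inter> qpart \<gamma>" for \<gamma>
      using subringD(3)[OF subring_adjoin] qpart_add by blast
    ultimately show ?thesis unfolding dec_def using F(1,2) G(1,2)
      by (intro exI[of _ "F \<union> G"] exI[of _ "\<lambda>\<gamma>. f' \<gamma> + g' \<gamma>"]) simp
  qed
  have dec_sum: "dec (sum f F)" if "\<And>i. i \<in> F \<Longrightarrow> dec (f i)" for f :: "'i \<Rightarrow> 'k" and F
    using that by (induction F rule: infinite_finite_induct) (auto intro: dec_0 dec_add)
  fix x assume "x \<in> adjoin (a / b)"
  then obtain p where p: "x = poly p u" "\<And>i. Polynomial.coeff p i \<in> R" unfolding adjoin_def u_def by blast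
  have "dec (r * u ^ i)" if r: "r \<in> R" for r i
  proof -
    obtain \<delta>' where \<delta>': "\<delta>' \<in> qgroup" "u ^ i \<in> qpart \<delta>'" using power_qpart[OF \<delta>] by (rule bexE)
    have "r * u ^ i = (\<Sum>\<gamma>\<in>{\<gamma>. hcomp r \<gamma> \<noteq> 0}. hcomp r \<gamma> * u ^ i)"
      unfolding sum_distrib_right[symmetric] sum_hcomp[OF r] by (rule refl)
    also have "dec \<dots>"
    proof (rule dec_sum)
      fix \<gamma> assume "\<gamma> \<in> {\<gamma>. hcomp r \<gamma> \<noteq> 0}"
      then have "\<gamma> \<in> qgroup" using supp_subset[OF r] monoid_subset_qgroup by blast
      show "dec (hcomp r \<gamma> * u ^ i)"
      proof (rule dec_single)
        show "\<gamma> + \<delta>' \<in> qgroup" by (rule qgroup_closed(2)[OF \<open>\<gamma> \<in> qgroup\<close> \<delta>'(1)])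
        show "hcomp r \<gamma> * u ^ i \<in> adjoin u"
          using subringD(4)[OF subring_adjoin] R_subset_adjoin hcomp_R[OF r] power_adjoin by blast
        show "hcomp r \<gamma> * u ^ i \<in> qpart (\<gamma> + \<delta>')"
          using qpart_mult part_qpart hcomp_part[OF r] \<delta>'(2) by blast
      qed
    qed
    finally show ?thesis .
  qed
  then have "dec x" unfolding p(1) poly_altdef using p(2) by (intro dec_sum) simp
  then show "\<exists>F f. finite F \<and> F \<subseteq> qgroup \<and> (\<forall>\<gamma>\<in>F. f \<gamma> \<in> adjoin (a / b) \<inter> qpart \<gamma>) \<and> x = sum f F"
    unfolding dec_def u_def .
qed

text \<open>
  A unit of the localization at \<open>M\<close> in \<open>M R[u]\<close> would give an integral equation for a multiple of
  \<open>u\<^bsup>-1\<^esup>\<close>; then \<open>u\<^bsup>-1\<^esup>\<close> would be in that localization, and \<open>J\<close> says that it is not.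
\<close>

lemma extension_avoids_prime:
  assumes ic: "integrally_closed_domain R" and M: "homogeneous_prime \<Gamma> A R M" and u: "u \<in> quotient_field R" "u \<noteq> 0"
    and J: "\<And>j. j \<in> R \<Longrightarrow> j / u \<in> R \<Longrightarrow> j \<in> M"
    and x: "x \<in> R" "x = poly p u" "\<And>i. Polynomial.coeff p i \<in> M"
  shows "x \<in> M"
proof (rule ccontr)
  assume xM: "x \<notin> M"
  note MR = subsetD[OF homogeneous_primeD(1)[OF M]]
  define n s v where "n = degree p" and "s = x - Polynomial.coeff p 0" and "v = s / u"
  have sR: "s \<in> R" using x MR R_closed(6) by (simp add: s_def)
  have sM: "s \<notin> M"
  proof
    assume "s \<in> M"
    then have "s + Polynomial.coeff p 0 \<in> M" using homogeneous_primeD(4)[OF M] x(3) by blast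
    then show False using xM by (simp add: s_def)
  qed
  have s: "s = (\<Sum>k=1..n. Polynomial.coeff p k * u ^ k)"
  proof -
    have "x = (\<Sum>k\<in>{0..n}. Polynomial.coeff p k * u ^ k)"
      unfolding x(2) poly_altdef n_def by (simp add: atLeast0AtMost)
    then show ?thesis unfolding s_def by (simp add: sum.atLeast_Suc_atMost)
  qed
  have "n \<noteq> 0"
  proof
    assume "n = 0"
    then have "s = 0" using s by simp
    then show False using sM homogeneous_primeD(2)[OF M] by simp
  qed
  (* Dividing the n-th power of u out of the relation turns it into a monic equation for s / u. *)
  define q where "q = Polynomial.monom 1 n - (\<Sum>k=1..n. Polynomial.monom (Polynomial.coeff p k * s ^ (k - 1)) (n - k))"
  have cs: "Polynomial.coeff (\<Sum>k=1..n. Polynomial.monom (Polynomial.coeff p k * s ^ (k - 1)) (n - k)) i =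
      (\<Sum>k=1..n. if n - k = i then Polynomial.coeff p k * s ^ (k - 1) else 0)" for i
    unfolding coeff_sum coeff_monom by (rule refl)
  have "Polynomial.coeff q i \<in> R" for i
  proof -
    have "(\<Sum>k=1..n. if n - k = i then Polynomial.coeff p k * s ^ (k - 1) else 0) \<in> R"
      using x(3) MR R_power[OF sR] R_closed(1,4) by (intro R_sum) simp
    moreover have "Polynomial.coeff (Polynomial.monom 1 n) i \<in> R" using R_closed(1,2) by (simp add: coeff_monom)
    ultimately show ?thesis unfolding q_def coeff_diff cs by (rule R_closed(6)[rotated])
  qed
  moreover have "lead_coeff q = 1"
  proof -
    have small: "Polynomial.coeff (\<Sum>k=1..n. Polynomial.monom (Polynomial.coeff p k * s ^ (k - 1)) (n - k)) i = 0"
      if "i \<ge> n" for i unfolding cs using that \<open>n \<noteq> 0\<close> by (intro sum.neutral) auto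
    then have "Polynomial.coeff q n = 1" "\<forall>i>n. Polynomial.coeff q i = 0"
      unfolding q_def coeff_diff by (simp_all add: coeff_monom)
    moreover from this have "degree q = n" by (intro antisym degree_le le_degree) auto
    ultimately show ?thesis by simp
  qed
  moreover have "poly q v = 0"
  proof -
    have "v ^ n = s ^ (n - 1) * s / u ^ n"
      using power_minus_mult[of n s] \<open>n \<noteq> 0\<close> by (simp add: v_def power_divide)
    also have "\<dots> = (\<Sum>k=1..n. s ^ (n - 1) * (Polynomial.coeff p k * u ^ k) / u ^ n)"
      by (subst (2) s) (simp add: sum_distrib_left sum_divide_distrib)
    also have "\<dots> = (\<Sum>k=1..n. Polynomial.coeff p k * s ^ (k - 1) * v ^ (n - k))"
    proof (rule sum.cong[OF refl])
      fix k assume "k \<in> {1..n}"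
      then have "n - 1 = (k - 1) + (n - k)" "n = k + (n - k)" by auto
      then have "s ^ (n - 1) = s ^ (k - 1) * s ^ (n - k)" "u ^ n = u ^ k * u ^ (n - k)"
        by (metis power_add)+
      then show "s ^ (n - 1) * (Polynomial.coeff p k * u ^ k) / u ^ n = Polynomial.coeff p k * s ^ (k - 1) * v ^ (n - k)"
        using u(2) by (simp add: v_def power_divide)
    qed
    finally show ?thesis by (simp add: q_def poly_sum poly_monom)
  qed
  ultimately have int: "\<exists>q. lead_coeff q = 1 \<and> (\<forall>i. Polynomial.coeff q i \<in> R) \<and> poly q v = 0" by (intro exI[of _ q]) simp
  have "v \<in> quotient_field R"
  proof -
    obtain c d where cd: "u = c / d" "c \<in> R" "d \<in> R" "d \<noteq> 0" using u(1) unfolding quotient_field_def by blast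
    have "v = (s * d) / c \<and> s * d \<in> R \<and> c \<in> R - {0}" using cd u(2) sR R_closed(4) by (auto simp: v_def)
    then show ?thesis unfolding quotient_field_def by blast
  qed
  then have "v \<in> R" using ic int unfolding integrally_closed_domain_def by simp
  then show False using J[OF sR] sM by (simp add: v_def)
qed

lemma coeffs_in_ideal_mult:
  assumes I: "ideal I (ring_on R)"
    and "\<And>i. Polynomial.coeff p i \<in> R" "\<And>i. Polynomial.coeff q i \<in> I"
  shows "Polynomial.coeff (p * q) i \<in> I"
  unfolding coeff_mult using assms(2,3) I[unfolded ideal_iff] by (intro ideal_sum[OF I]) simp

text \<open>
  By \<open>extension_avoids_prime\<close> the extended ideal \<open>M R[u]\<close> meets no homogeneous element of \<open>R\<close> outside \<open>M\<close>,
  so a homogeneous prime that contains it can be chosen to avoid all of these elements.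
\<close>

lemma ex_prime_lying_over:
  assumes ic: "integrally_closed_domain R" and M: "homogeneous_prime \<Gamma> A R M"
    and ab: "a \<in> H" "b \<in> H" and J: "\<And>j. j \<in> R \<Longrightarrow> j / (a / b) \<in> R \<Longrightarrow> j \<in> M"
  shows "\<exists>Q. homogeneous_prime qgroup (overring_component \<Gamma> A (adjoin (a / b))) (adjoin (a / b)) Q \<and> Q \<inter> R = M"
proof -
  define u where "u = a / b"
  interpret E: graded_overring \<Gamma> A R "adjoin u"
    unfolding u_def using homogeneous_overring_adjoin[OF ab] by unfold_locales
  have R: "a \<in> R" "b \<in> R" and nz: "a \<noteq> 0" "b \<noteq> 0" using ab H_R H_iff by simp_all
  have u: "u \<in> quotient_field R" "u \<noteq> 0"
    using R nz unfolding u_def quotient_field_def by auto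
  obtain \<delta> where \<delta>: "\<delta> \<in> qgroup" "u \<in> qpart \<delta>" using fraction_qpart[OF ab] unfolding u_def by (rule bexE)
  note MR = subsetD[OF homogeneous_primeD(1)[OF M]]
  have Mid: "ideal M (ring_on R)" using M unfolding homogeneous_prime_iff graded_ideal_def by simp
  define N where "N = {poly p u | p. \<forall>i. Polynomial.coeff p i \<in> M}"
  have NI: "poly p u \<in> N" if "\<And>i. Polynomial.coeff p i \<in> M" for p using that unfolding N_def by blast
  have NE: "\<exists>p. x = poly p u \<and> (\<forall>i. Polynomial.coeff p i \<in> M)" if "x \<in> N" for x using that unfolding N_def by blast
  have "E.T.graded_ideal N"
  proof (rule E.T.graded_idealI)
    show "N \<subseteq> adjoin u" using MR unfolding N_def adjoin_def by blast
    show "0 \<in> N" using NI[of 0] homogeneous_primeD(2)[OF M] by simp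
  next
    fix x y assume xy: "x \<in> N" "y \<in> N"
    obtain p where p: "x = poly p u" "\<And>i. Polynomial.coeff p i \<in> M" using NE[OF xy(1)] by blast
    obtain q where q: "y = poly q u" "\<And>i. Polynomial.coeff q i \<in> M" using NE[OF xy(2)] by blast
    have "poly (p + q) u \<in> N" using p(2) q(2) homogeneous_primeD(4)[OF M] by (intro NI) simp
    then show "x + y \<in> N" by (simp add: p q)
  next
    fix r x assume r: "r \<in> adjoin u" and x: "x \<in> N"
    obtain p where p: "r = poly p u" "\<And>i. Polynomial.coeff p i \<in> R" using r unfolding adjoin_def by blast
    obtain q where q: "x = poly q u" "\<And>i. Polynomial.coeff q i \<in> M" using NE[OF x] by blast
    have "poly (p * q) u \<in> N" by (rule NI) (rule coeffs_in_ideal_mult[OF Mid p(2) q(2)])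
    then show "r * x \<in> N" by (simp add: p q)
  next
    fix x \<gamma> assume x: "x \<in> N"
    obtain q where q: "x = poly q u" "\<And>i. Polynomial.coeff q i \<in> M" using NE[OF x] by blast
    have "\<forall>i. \<exists>\<delta>'. \<delta>' \<in> qgroup \<and> u ^ i \<in> qpart \<delta>'" using power_qpart[OF \<delta>] by blast
    then obtain d where d: "\<And>i. d i \<in> qgroup" "\<And>i. u ^ i \<in> qpart (d i)" by metis
    have upart: "u ^ i \<in> E.T.part (d i)" for i
      using d power_adjoin by (simp add: E.T.part_def overring_component_def)
    define c where "c i = hcomp (Polynomial.coeff q i) (\<gamma> - d i)" for i
    have cM: "c i \<in> M" for i unfolding c_def by (rule homogeneous_primeD(7)[OF M q(2)])
    have qT: "Polynomial.coeff q i \<in> adjoin u" for i using q(2) MR R_subset_adjoin by blast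
    have "x = (\<Sum>i\<le>degree q. u ^ i * Polynomial.coeff q i)"
      unfolding q(1) poly_altdef by (simp add: mult.commute)
    then have "E.T.hcomp x \<gamma> = (\<Sum>i\<le>degree q. E.T.hcomp (u ^ i * Polynomial.coeff q i) \<gamma>)"
      using qT power_adjoin E.T.R_closed(4) by (simp add: E.T.hcomp_sum)
    also have "\<dots> = (\<Sum>i\<le>degree q. u ^ i * c i)"
      unfolding E.T.hcomp_part_mult[OF upart qT] c_def
      using q(2) MR by (simp add: E.T_hcomp_eq)
    also have "\<dots> = poly (\<Sum>i\<le>degree q. Polynomial.monom (c i) i) u"
      by (simp add: poly_sum poly_monom mult.commute)
    also have "\<dots> \<in> N"
    proof (rule NI)
      fix i
      show "Polynomial.coeff (\<Sum>i\<le>degree q. Polynomial.monom (c i) i) i \<in> M"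
        using cM homogeneous_primeD(2)[OF M] by (simp add: coeff_sum coeff_monom)
    qed
    finally show "E.T.hcomp x \<gamma> \<in> N" .
  qed
  moreover have NM: "x \<in> M" if xN: "x \<in> N" and xR: "x \<in> R" for x
  proof -
    obtain q where q: "x = poly q u" "\<And>i. Polynomial.coeff q i \<in> M" using NE[OF xN] by blast
    show ?thesis by (rule extension_avoids_prime[OF ic M u _ xR q]) (rule J, simp_all add: u_def)
  qed
  define W where "W = {s \<in> H. s \<notin> M}"
  have "W \<subseteq> E.T.H" using E.H_T_H unfolding W_def by blast
  moreover have "1 \<in> W" using H_one homogeneous_primeD(3)[OF M] unfolding W_def by simp
  moreover have "x * y \<in> W" if "x \<in> W" "y \<in> W" for x y
    using that H_mult H_R homogeneous_primeD(6)[OF M, of x y] unfolding W_def by auto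
  moreover have "N \<inter> W = {}" using NM H_R unfolding W_def by auto
  ultimately obtain Q where Q: "homogeneous_prime qgroup (overring_component \<Gamma> A (adjoin u)) (adjoin u) Q"
      "N \<subseteq> Q" "Q \<inter> W = {}"
    using E.T.ex_homogeneous_prime_avoiding[of N W] by auto
  have "Q \<inter> R = M"
  proof
    show "Q \<inter> R \<subseteq> M"
    proof
      fix x assume x: "x \<in> Q \<inter> R"
      show "x \<in> M"
      proof (rule ideal_memI_components[OF Mid])
        show "x \<in> R" using x by simp
        fix \<gamma>
        have "hcomp x \<gamma> \<in> Q" using E.T.homogeneous_primeD(7)[OF Q(1), of x \<gamma>] x E.T_hcomp_eq[of x \<gamma>] by simp
        then have "hcomp x \<gamma> \<notin> W" using Q(3) by blast
        then show "hcomp x \<gamma> \<in> M"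
          using hcomp_H[of x \<gamma>] x homogeneous_primeD(2)[OF M] unfolding W_def by (cases "hcomp x \<gamma> = 0") simp_all
      qed
    qed
    have "x \<in> N" if "x \<in> M" for x
      using NI[of "[:x:]"] that homogeneous_primeD(2)[OF M] by (simp add: coeff_pCons split: nat.split)
    then show "M \<subseteq> Q \<inter> R" using Q(2) MR by blast
  qed
  then show ?thesis using Q(1) unfolding u_def by (intro exI[of _ Q] conjI)
qed

text \<open>
  Among the monomials in \<open>Y\<close>, those with an exponent at least \<open>N\<close> multiply \<open>s\<close> into \<open>I\<close>. The
  hypothesis \<open>sat\<close> then lowers exponents one at a time, down to the monomial \<open>1\<close>.
\<close>

lemma mem_if_power_multiples_mem:
  assumes I: "ideal I (ring_on R)" and Y: "finite Y" "Y \<subseteq> R" and s: "s \<in> R"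
    and pow: "\<And>y. y \<in> Y \<Longrightarrow> s * y ^ N \<in> I"
    and sat: "\<And>z. z \<in> R \<Longrightarrow> (\<And>y. y \<in> Y \<Longrightarrow> z * y \<in> I) \<Longrightarrow> z \<in> I"
  shows "s \<in> I"
proof -
  have "s * (\<Prod>y\<in>Y. y ^ e y) \<in> I" for e :: "'k \<Rightarrow> nat"
  proof (induction "\<Sum>y\<in>Y. N - e y" arbitrary: e rule: less_induct)
    case less
    show ?case
    proof (cases "\<exists>y\<in>Y. e y \<ge> N")
      case True
      then obtain y where y: "y \<in> Y" "N \<le> e y" by (rule bexE)
      have "y ^ e y = y ^ N * y ^ (e y - N)" using y(2) by (simp flip: power_add)
      then have "s * (\<Prod>y\<in>Y. y ^ e y) = (y ^ (e y - N) * (\<Prod>y\<in>Y - {y}. y ^ e y)) * (s * y ^ N)"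
        using y(1) Y(1) by (simp add: prod.remove[of Y y])
      moreover have "y ^ (e y - N) * (\<Prod>y\<in>Y - {y}. y ^ e y) \<in> R"
        using y(1) Y(2) by (intro R_closed(4) R_prod R_power) auto
      then have "(y ^ (e y - N) * (\<Prod>y\<in>Y - {y}. y ^ e y)) * (s * y ^ N) \<in> I"
        using I[unfolded ideal_iff] pow[OF y(1)] by blast
      ultimately show ?thesis by (simp only:)
    next
      case False
      show ?thesis
      proof (rule sat)
        show "s * (\<Prod>y\<in>Y. y ^ e y) \<in> R" using s Y(2) by (intro R_closed(4) R_prod R_power) auto
        fix y assume y: "y \<in> Y"
        have "(\<Sum>x\<in>Y. N - (e(y := Suc (e y))) x) < (\<Sum>x\<in>Y. N - e x)"
          using False y Y(1) by (intro sum_strict_mono_ex1) (auto simp: not_le intro!: bexI[of _ y])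
        then have "s * (\<Prod>x\<in>Y. x ^ (e(y := Suc (e y))) x) \<in> I" by (rule less.hyps)
        moreover have "(\<Prod>x\<in>Y. x ^ (e(y := Suc (e y))) x) = (\<Prod>x\<in>Y. x ^ e x) * y"
        proof -
          have "(\<Prod>x\<in>Y. x ^ (e(y := Suc (e y))) x) = (\<Prod>x\<in>Y. x ^ e x * (if x = y then y else 1))"
            by (rule prod.cong) auto
          then show ?thesis using y Y(1) by (simp add: prod.distrib prod.delta)
        qed
        ultimately show "s * (\<Prod>y\<in>Y. y ^ e y) * y \<in> I" by (simp add: mult.assoc)
      qed
    qed
  qed
  from this[of "\<lambda>_. 0"] show ?thesis by simp
qed

lemma graded_ideal_conductor:
  assumes ab: "a \<in> H" "b \<in> H"
  shows "graded_ideal {r \<in> R. r * (a / b) \<in> R}"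
proof (rule graded_idealI)
  have b: "b \<noteq> 0" using ab(2) H_iff by blast
  show "0 \<in> {r \<in> R. r * (a / b) \<in> R}" using R_closed(1) by simp
  show "x + y \<in> {r \<in> R. r * (a / b) \<in> R}"
    if "x \<in> {r \<in> R. r * (a / b) \<in> R}" "y \<in> {r \<in> R. r * (a / b) \<in> R}" for x y
    using that R_closed(3) by (simp add: distrib_right add_divide_distrib)
  show "r * x \<in> {r \<in> R. r * (a / b) \<in> R}" if "r \<in> R" "x \<in> {r \<in> R. r * (a / b) \<in> R}" for r x
  proof -
    have "r * (x * (a / b)) \<in> R" using that R_closed(4) by blast
    then show ?thesis using that R_closed(4) by (simp add: mult.assoc)
  qed
  fix x \<gamma> assume x: "x \<in> {r \<in> R. r * (a / b) \<in> R}"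
  then have "x \<in> R" "x * (a / b) \<in> R" "x * a = b * (x * (a / b))" using b by simp_all
  then obtain r where "r \<in> R" "hcomp x \<gamma> * a = b * r" using component_multiplier[OF ab] by blast
  then show "hcomp x \<gamma> \<in> {r \<in> R. r * (a / b) \<in> R}" using b hcomp_R[OF \<open>x \<in> R\<close>] by simp
qed blast

text \<open>
  Multiplication by \<open>b\<close> maps the ideal \<open>J\<close> of all \<open>r\<close> with \<open>r b / a \<in> R\<close> onto \<open>(a) \<inter> (b)\<close>, so the
  homogeneous generators of the latter, divided by \<open>b\<close>, generate \<open>J\<close>.
\<close>

lemma conductor_finitely_generated:
  assumes fc: "g_finite_conductor_domain \<Gamma> A R" and ab: "a \<in> H" "b \<in> H"
  shows "\<exists>Y. finite Y \<and> Y \<subseteq> H \<and> Y \<subseteq> {r \<in> R. r / (a / b) \<in> R} \<and>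
    (\<forall>j. j \<in> R \<longrightarrow> j / (a / b) \<in> R \<longrightarrow> (\<exists>c. (\<forall>y\<in>Y. c y \<in> R) \<and> j = (\<Sum>y\<in>Y. c y * y)))"
proof -
  have R: "a \<in> R" "b \<in> R" and nz: "a \<noteq> 0" "b \<noteq> 0" using ab H_R H_iff by simp_all
  obtain \<beta> where \<beta>: "b \<in> part \<beta>" using ab(2) H_iff by blast
  have "\<exists>U. finite U \<and> U \<subseteq> H \<and> PIdl\<^bsub>ring_on R\<^esub> a \<inter> PIdl\<^bsub>ring_on R\<^esub> b = Idl\<^bsub>ring_on R\<^esub> U"
    using fc ab unfolding g_finite_conductor_domain_def by simp
  then obtain U where "finite U \<and> U \<subseteq> H \<and> PIdl\<^bsub>ring_on R\<^esub> a \<inter> PIdl\<^bsub>ring_on R\<^esub> b = Idl\<^bsub>ring_on R\<^esub> U"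
    by (rule exE)
  then have U: "finite U" "U \<subseteq> H" "PIdl\<^bsub>ring_on R\<^esub> a \<inter> PIdl\<^bsub>ring_on R\<^esub> b = Idl\<^bsub>ring_on R\<^esub> U" by simp_all
  have UR: "U \<subseteq> R" using U(2) H_R by blast
  define Y where "Y = (\<lambda>w. w / b) ` U"
  have YJ: "w / b \<in> R \<and> w / b / (a / b) \<in> R" if "w \<in> U" for w
  proof -
    have "w \<in> PIdl\<^bsub>ring_on R\<^esub> a \<inter> PIdl\<^bsub>ring_on R\<^esub> b" unfolding U(3) using subset_Idl[of U R] that by blast
    then obtain r t where w: "w = r * a" "w = t * b" "r \<in> R" "t \<in> R" unfolding PIdl_ring_on by blast
    have "w / b = t" using nz by (simp add: w(2))
    moreover have "w / b / (a / b) = r" using nz by (simp add: w(1))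
    ultimately show ?thesis using w(3,4) by simp
  qed
  have "Y \<subseteq> H"
  proof
    fix y assume "y \<in> Y"
    then obtain w where w: "w \<in> U" "y = w / b" unfolding Y_def by blast
    obtain \<omega> where \<omega>: "w \<in> part \<omega>" using w(1) U(2) H_iff by blast
    have "w \<noteq> 0" using w(1) U(2) H_iff by blast
    then have "y \<noteq> 0" using w(2) nz by simp
    moreover have "b * y \<in> part \<omega>" using \<omega> w(2) nz by simp
    then have "y \<in> part (\<omega> - \<beta>)" using YJ[OF w(1)] w(2) by (intro part_cancel[OF \<beta> nz(2)]) simp_all
    ultimately show "y \<in> H" unfolding H_iff by blast
  qed
  moreover have "\<exists>c. (\<forall>y\<in>Y. c y \<in> R) \<and> j = (\<Sum>y\<in>Y. c y * y)" if j: "j \<in> R" "j / (a / b) \<in> R" for j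
  proof -
    have "j * b = (j / (a / b)) * a" using nz by simp
    then have "j * b \<in> PIdl\<^bsub>ring_on R\<^esub> a \<inter> PIdl\<^bsub>ring_on R\<^esub> b" unfolding PIdl_ring_on using j by blast
    then obtain c where c: "\<forall>w\<in>U. c w \<in> R" "j * b = (\<Sum>w\<in>U. c w * w)"
      unfolding U(3) Idl_finite[OF subring UR U(1)] by blast
    have "j = (\<Sum>w\<in>U. c w * w) / b" using c(2) nz by (simp add: field_simps)
    also have "\<dots> = (\<Sum>w\<in>U. c (w / b * b) * (w / b))" using nz by (simp add: sum_divide_distrib)
    also have "\<dots> = (\<Sum>y\<in>Y. c (y * b) * y)"
      unfolding Y_def using nz by (subst sum.reindex) (auto intro!: inj_onI)
    finally have "j = (\<Sum>y\<in>Y. c (y * b) * y)" .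
    moreover have "\<forall>y\<in>Y. c (y * b) \<in> R" using c(1) nz by (auto simp: Y_def)
    ultimately show ?thesis by (intro exI[of _ "\<lambda>y. c (y * b)"] conjI)
  qed
  moreover have "finite Y" using U(1) by (simp add: Y_def)
  moreover have "Y \<subseteq> {r \<in> R. r / (a / b) \<in> R}" using YJ by (auto simp: Y_def)
  ultimately show ?thesis by (intro exI[of _ Y] conjI) simp_all
qed

text \<open>
  Suppose that \<open>a\<close> and \<open>b\<close> are not comparable at \<open>M\<close> and put \<open>u = a / b\<close>. The conductors
  \<open>I = (R : u)\<close> and \<open>J = (R : u\<^bsup>-1\<^esup>) = u I\<close> lie in \<open>M\<close>. Since \<open>J\<close> is finitely generated and \<open>R\<close> is
  integrally closed, no homogeneous \<open>s \<notin> M\<close> carries powers of all generators of \<open>J\<close> into \<open>I\<close>; hence some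
  homogeneous prime \<open>P\<close> between \<open>I\<close> and \<open>M\<close> misses a generator \<open>y\<close> of \<open>J\<close>. But going down from a
  prime of \<open>R[u]\<close> over \<open>M\<close> yields a prime of \<open>R[u]\<close> over \<open>P\<close>, which contains \<open>y / u \<in> I\<close> and therefore
  \<open>y = u (y / u)\<close>.
\<close>

lemma locally_comparable_if_going_down:
  assumes ic: "integrally_closed_domain R" and fc: "g_finite_conductor_domain \<Gamma> A R" and gd: "gGD_domain \<Gamma> A R"
  shows locally_comparable
  unfolding locally_comparable_def
proof (intro allI impI ballI)
  fix M a b assume M: "homogeneous_prime \<Gamma> A R M" and ab: "a \<in> H" "b \<in> H"
  show "\<exists>s\<in>H. s \<notin> M \<and> ((\<exists>r\<in>R. s * a = b * r) \<or> (\<exists>r\<in>R. s * b = a * r))"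
  proof (rule ccontr)
    assume neg: "\<not> ?thesis"
    have R: "a \<in> R" "b \<in> R" and nz: "a \<noteq> 0" "b \<noteq> 0" using ab H_R H_iff by simp_all
    define u where "u = a / b"
    have u0: "u \<noteq> 0" using nz by (simp add: u_def)
    have uq: "z * u \<in> quotient_field R" if "z \<in> R" for z
    proof -
      have "z * u = (z * a) / b \<and> z * a \<in> R \<and> b \<in> R - {0}" using R nz that R_closed(4) by (simp add: u_def)
      then show ?thesis unfolding quotient_field_def by blast
    qed
    have Mid: "ideal M (ring_on R)" using M unfolding homogeneous_prime_iff graded_ideal_def by simp
    define I where "I = {r \<in> R. r * u \<in> R}"
    have I: "graded_ideal I" unfolding I_def u_def by (rule graded_ideal_conductor[OF ab])
    have Iid: "ideal I (ring_on R)" using I unfolding graded_ideal_def by simp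
    have J: "graded_ideal {r \<in> R. r * (b / a) \<in> R}" by (rule graded_ideal_conductor[OF ab(2,1)])
    have sub: "K \<subseteq> M" if K: "graded_ideal K" "\<And>s. s \<in> H \<Longrightarrow> s \<in> K \<Longrightarrow> s \<in> M" for K
    proof
      fix x assume x: "x \<in> K"
      have xR: "x \<in> R" using x graded_idealD(1)[OF K(1)] by blast
      show "x \<in> M"
      proof (rule ideal_memI_components[OF Mid xR])
        fix \<gamma>
        show "hcomp x \<gamma> \<in> M"
          using K(2)[OF hcomp_H[OF xR, of \<gamma>] graded_idealD(5)[OF K(1) x]] homogeneous_primeD(2)[OF M]
          by (cases "hcomp x \<gamma> = 0") simp_all
      qed
    qed
    have IM: "I \<subseteq> M"
    proof (rule sub[OF I])
      fix s assume s: "s \<in> H" "s \<in> I"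
      then have "s * a = b * (s * u)" "s * u \<in> R" using nz by (simp_all add: u_def I_def)
      then show "s \<in> M" using neg s(1) by blast
    qed
    have JM: "j \<in> M" if j: "j \<in> R" "j / u \<in> R" for j
    proof -
      have "{r \<in> R. r * (b / a) \<in> R} \<subseteq> M"
      proof (rule sub[OF J])
        fix s assume s: "s \<in> H" "s \<in> {r \<in> R. r * (b / a) \<in> R}"
        then have "s * b = a * (s * (b / a))" "s * (b / a) \<in> R" using nz by simp_all
        then show "s \<in> M" using neg s(1) by blast
      qed
      moreover have "j / u = j * (b / a)" by (simp add: u_def)
      ultimately show ?thesis using j by auto
    qed
    obtain Q where Q: "homogeneous_prime qgroup (overring_component \<Gamma> A (adjoin u)) (adjoin u) Q" "Q \<inter> R = M"
      using ex_prime_lying_over[OF ic M ab JM[unfolded u_def]] unfolding u_def by blast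
    have "\<exists>Y. finite Y \<and> Y \<subseteq> H \<and> Y \<subseteq> {r \<in> R. r / u \<in> R} \<and>
        (\<forall>j. j \<in> R \<longrightarrow> j / u \<in> R \<longrightarrow> (\<exists>c. (\<forall>y\<in>Y. c y \<in> R) \<and> j = (\<Sum>y\<in>Y. c y * y)))"
      unfolding u_def by (rule conductor_finitely_generated[OF fc ab])
    then obtain Y where Y: "finite Y" "Y \<subseteq> H" "Y \<subseteq> {r \<in> R. r / u \<in> R}"
      and gen: "\<And>j. j \<in> R \<Longrightarrow> j / u \<in> R \<Longrightarrow> \<exists>c. (\<forall>y\<in>Y. c y \<in> R) \<and> j = (\<Sum>y\<in>Y. c y * y)" by auto
    have YR: "Y \<subseteq> R" using Y(2) H_R by blast
    have Ynz: "\<exists>y\<in>Y. y \<noteq> 0"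
    proof -
      have "a / u \<in> R" using R nz by (simp add: u_def)
      then obtain c where "a = (\<Sum>y\<in>Y. c y * y)" using gen[OF R(1)] by blast
      then have "Y \<noteq> {}" using nz(1) by auto
      then show ?thesis using Y(2) H_iff by blast
    qed
    (* If z J lies in I, then multiplication by z u maps the finitely generated ideal J into itself. *)
    have sat: "z \<in> I" if z: "z \<in> R" "\<And>y. y \<in> Y \<Longrightarrow> z * y \<in> I" for z
    proof -
      have "integral_over R (z * u)"
      proof (rule integral_over_if_stabilizes[OF subring Y(1) Ynz])
        fix y assume y: "y \<in> Y"
        have "z * y \<in> R" "z * y * u \<in> R" using z(2)[OF y] by (simp_all add: I_def)
        moreover have "z * u * y / u = z * y" using u0 by simp
        moreover have "z * u * y = z * y * u" by simp
        ultimately show "\<exists>c. (\<forall>y\<in>Y. c y \<in> R) \<and> z * u * y = (\<Sum>y\<in>Y. c y * y)"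
          using gen[of "z * u * y"] by (simp only:)
      qed
      then have "z * u \<in> R"
        using ic uq[OF z(1)] unfolding integrally_closed_domain_def integral_over_def by simp
      then show ?thesis using z(1) by (simp add: I_def)
    qed
    have "\<exists>y\<in>Y. \<forall>n. \<forall>s\<in>H. s \<notin> M \<longrightarrow> s * y ^ n \<notin> I"
    proof (rule ccontr)
      assume "\<not> ?thesis"
      then have "\<forall>y\<in>Y. \<exists>n s. s \<in> H \<and> s \<notin> M \<and> s * y ^ n \<in> I" by blast
      then obtain n s where ns: "\<And>y. y \<in> Y \<Longrightarrow> s y \<in> H" "\<And>y. y \<in> Y \<Longrightarrow> s y \<notin> M"
        "\<And>y. y \<in> Y \<Longrightarrow> s y * y ^ n y \<in> I" by metis
      define S N where "S = prod s Y" and "N = sum n Y"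
      have prodM: "prod s F \<notin> M" if "F \<subseteq> Y" for F
        using finite_subset[OF that Y(1)] that
      proof (induction F rule: finite_induct)
        case empty
        then show ?case using homogeneous_primeD(3)[OF M] by simp
      next
        case (insert y F)
        then have "s y \<in> R" "prod s F \<in> R" using ns(1) H_R by (auto intro!: R_prod)
        then show ?case using insert ns(2) homogeneous_primeD(6)[OF M, of "s y" "prod s F"] by auto
      qed
      have "S * y ^ N \<in> I" if y: "y \<in> Y" for y
      proof -
        have "S = s y * prod s (Y - {y})" "N = n y + sum n (Y - {y})"
          unfolding S_def N_def using y Y(1) by (simp_all add: prod.remove sum.remove)
        then have "S * y ^ N = (prod s (Y - {y}) * y ^ sum n (Y - {y})) * (s y * y ^ n y)"
          by (simp add: power_add)
        moreover have "prod s (Y - {y}) * y ^ sum n (Y - {y}) \<in> R"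
          using ns(1) H_R y YR by (intro R_closed(4) R_prod R_power) auto
        ultimately show ?thesis using graded_idealD(4)[OF I _ ns(3)[OF y]] by (simp only:)
      qed
      moreover have "S \<in> R" unfolding S_def using ns(1) H_R by (intro R_prod) simp
      ultimately have "S \<in> I" using mem_if_power_multiples_mem[OF Iid Y(1) YR _ _ sat] by blast
      then show False using IM prodM[of Y] unfolding S_def by blast
    qed
    then obtain y where y: "y \<in> Y" "\<And>n s. s \<in> H \<Longrightarrow> s \<notin> M \<Longrightarrow> s * y ^ n \<notin> I" by auto
    have yH: "y \<in> H" and yR: "y \<in> R" and yu: "y / u \<in> R" using y(1) Y(2,3) YR by auto
    define W where "W = {s * y ^ n | s n. s \<in> H \<and> s \<notin> M}"
    have WI: "s * y ^ n \<in> W" if "s \<in> H" "s \<notin> M" for s n using that unfolding W_def by blast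
    have "W \<subseteq> H" using H_mult H_power[OF yH] unfolding W_def by blast
    moreover have "1 \<in> W" using WI[of 1 0] H_one homogeneous_primeD(3)[OF M] by simp
    moreover have "v * w \<in> W" if vw: "v \<in> W" "w \<in> W" for v w
    proof -
      obtain s m where s: "v = s * y ^ m" "s \<in> H" "s \<notin> M" using vw(1) unfolding W_def by blast
      obtain t n where t: "w = t * y ^ n" "t \<in> H" "t \<notin> M" using vw(2) unfolding W_def by blast
      have "s * t \<in> H" by (rule H_mult[OF s(2) t(2)])
      moreover have "s * t \<notin> M" using homogeneous_primeD(6)[OF M H_R[OF s(2)] H_R[OF t(2)]] s(3) t(3) by blast
      ultimately have "(s * t) * y ^ (m + n) \<in> W" by (rule WI)
      then show ?thesis by (simp add: s t power_add ac_simps)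
    qed
    moreover have "I \<inter> W = {}" using y(2) unfolding W_def by blast
    ultimately obtain P where P: "homogeneous_prime \<Gamma> A R P" "I \<subseteq> P" "P \<inter> W = {}"
      using ex_homogeneous_prime_avoiding[OF I, of W] by auto
    have Pg: "graded_ideal P" using P(1) unfolding homogeneous_prime_iff by simp
    have PM: "P \<subseteq> M"
    proof (rule sub[OF Pg])
      fix s assume s: "s \<in> H" "s \<in> P"
      then show "s \<in> M" using WI[of s 0] P(3) by auto
    qed
    have "1 * y ^ 1 \<in> W" using H_one homogeneous_primeD(3)[OF M] by (rule WI)
    then have yP: "y \<notin> P" using P(3) by auto
    have ov: "homogeneous_overring \<Gamma> A R (adjoin u)" unfolding u_def by (rule homogeneous_overring_adjoin[OF ab])
    then interpret E: graded_overring \<Gamma> A R "adjoin u" by unfold_locales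
    have "gGD_extension \<Gamma> A R (adjoin u)" using gd ov unfolding gGD_domain_def by simp
    then have "\<exists>Q\<^sub>0. homogeneous_prime qgroup (overring_component \<Gamma> A (adjoin u)) (adjoin u) Q\<^sub>0 \<and> Q\<^sub>0 \<subseteq> Q \<and> Q\<^sub>0 \<inter> R = P"
      using \<open>gGD_extension \<Gamma> A R (adjoin u)\<close>[unfolded gGD_extension_def, rule_format, of P M Q]
        P(1) M PM Q by simp
    then obtain Q0 where Q0: "homogeneous_prime qgroup (overring_component \<Gamma> A (adjoin u)) (adjoin u) Q0" "Q0 \<inter> R = P" by auto
    have "y / u * u = y" using u0 by simp
    then have "y / u \<in> I" using yu yR by (simp add: I_def)
    then have "y / u \<in> Q0" using P(2) Q0(2) by blast
    then have "u * (y / u) \<in> Q0" by (rule E.T.homogeneous_primeD(5)[OF Q0(1) mem_adjoin])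
    then have "y \<in> Q0" using u0 by simp
    then show False using yP yR Q0(2) by blast
  qed
qed

end

section \<open>The characterization of graded-Pruefer domains\<close>

theorem corollary3p8:
  fixes \<Gamma> :: "'g::ab_group_add set" and A :: "'g \<Rightarrow> 'k::field set" and R :: "'k set"
  assumes "graded_domain \<Gamma> A R"
  shows "graded_Prufer_domain \<Gamma> A R \<longleftrightarrow>
           integrally_closed_domain R \<and> g_finite_conductor_domain \<Gamma> A R \<and> gGD_domain \<Gamma> A R"
proof -
  interpret graded_domain \<Gamma> A R by (rule assms)
  show ?thesis
    using Prufer_locally_comparable Prufer_if_locally_comparable Prufer_finite_conductor
      integrally_closed_if_locally_comparable gGD_if_locally_comparable locally_comparable_if_going_down
    by metis
qed

end
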